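(* Let $n\ge 1$ be an integer. There exists a measurable function (symbol) $g:\mathbb C^n\to\mathbb C$ such that: (1) $gk_a\in L^2(\mathbb C^n,d\mu)$ for every $a\in\mathbb C^n$; (2) the Toeplitz operator $T_g$ extends to a bounded operator on $H^2(\mathbb C^n,d\mu)$; (3) the heat transform $g^{(1/4)}$ is unbounded on $\mathbb C^n$.
   Context: Let $n\ge 1$ and let $dv$ be Lebesgue measure on $\mathbb C^n\simeq\mathbb R^{2n}$. Set $d\mu(z)=(2\pi)^{-n}e^{-|z|^2/2}\,dv(z)$. The Bargmann space $H^2(\mathbb C^n,d\mu)$ is the closed subspace of $L^2(\mathbb C^n,d\mu)$ consisting of entire functions. $P:L^2(d\mu)\to H^2(d\mu)$ is the orthogonal projection, and the reproducing kernel is $K(z,w)=e^{z\cdot\overline w/2}$ with $z\cdot\overline w=\sum_j z_j\overline{w_j}$. The normalized reproducing kernel at $a\in\mathbb C^n$ is $k_a(z)=K(z,a)/\sqrt{K(a,a)}=\exp\big(\tfrac{z\cdot\overline a}{2}-\tfrac{|a|^2}{4}\big)$. If $g$ is measurable and $gk_a\in L^2(d\mu)$ for every $a\in\mathbb C^n$, the Toeplitz operator $T_g$ is the densely defined operator $T_gf=P(gf)$ on $H^2(d\mu)$ with domain $\{f\in H^2(d\mu): gf\in L^2(d\mu)\}$. This domain contains the dense subspace $\operatorname{span}\{k_a: a\in\mathbb C^n\}$. For $t>0$ the heat transform of $g$ is $g^{(t)}(a)=(4\pi t)^{-n}\int_{\mathbb C^n}g(w)e^{-|w-a|^2/(4t)}\,dv(w)$,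 whenever the integral converges absolutely. In particular $g^{(1/4)}(a)=\pi^{-n}\int_{\mathbb C^n} g(w)e^{-|w-a|^2}\,dv(w)$. *)

theory Defs
  imports "HOL-Analysis.Analysis"
begin

text \<open>
  The space of dimension \<open>n\<close> over the complex numbers is \<open>complex ^ 'n\<close>, with \<open>n = CARD('n) \<ge> 1\<close>;
  its \<open>norm\<close> is the Euclidean norm and \<open>lborel\<close> is Lebesgue measure of the underlying real space
  of dimension \<open>2 n\<close>. Square-integrable functions are handled as Borel measurable
  representatives, never as classes modulo null sets.
\<close>

definition gauss_measure :: "(complex ^ 'n) measure" where
  "gauss_measure =
     density lborel (\<lambda>z. ennreal (exp (- (norm z)\<^sup>2 / 2) / (2 * pi) ^ CARD('n)))"

definition L2_gauss :: "(complex ^ 'n \<Rightarrow> complex) set" where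
  "L2_gauss = {f. f \<in> borel_measurable gauss_measure \<and>
                  integrable gauss_measure (\<lambda>z. (cmod (f z))\<^sup>2)}"

definition L2_inner :: "(complex ^ 'n \<Rightarrow> complex) \<Rightarrow> (complex ^ 'n \<Rightarrow> complex) \<Rightarrow> complex" where
  "L2_inner f h = (LINT z|gauss_measure. f z * cnj (h z))"

definition L2_norm :: "(complex ^ 'n \<Rightarrow> complex) \<Rightarrow> real" where
  "L2_norm f = sqrt (LINT z|gauss_measure. (cmod (f z))\<^sup>2)"

text \<open>Entire functions of several variables: the real Frechet derivative, which exists
  everywhere, is complex-linear.\<close>

definition entire :: "(complex ^ 'n \<Rightarrow> complex) \<Rightarrow> bool" where
  "entire f \<longleftrightarrow>
     (\<forall>z. \<exists>D. (f has_derivative D) (at z) \<and> (\<forall>c v. D (c *s v) = c * D v))"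

definition bargmann :: "(complex ^ 'n \<Rightarrow> complex) set" where
  "bargmann = {f. entire f \<and> f \<in> L2_gauss}"

text \<open>The description is proper for every \<open>f \<in> L2_gauss\<close>: the space \<open>bargmann\<close> is closed in it, and
  two entire functions agreeing almost everywhere are equal.\<close>

definition bargmann_proj :: "(complex ^ 'n \<Rightarrow> complex) \<Rightarrow> (complex ^ 'n \<Rightarrow> complex)" where
  "bargmann_proj f =
     (THE p. p \<in> bargmann \<and> (\<forall>h\<in>bargmann. L2_inner (\<lambda>z. f z - p z) h = 0))"

definition bargmann_kernel :: "complex ^ 'n \<Rightarrow> complex ^ 'n \<Rightarrow> complex" where
  "bargmann_kernel z w = exp ((\<Sum>j\<in>UNIV. z $ j * cnj (w $ j)) / 2)"

definition normalized_kernel :: "complex ^ 'n \<Rightarrow> complex ^ 'n \<Rightarrow> complex" where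
  "normalized_kernel a z = bargmann_kernel z a / csqrt (bargmann_kernel a a)"

lemma normalized_kernel_eq:
  "normalized_kernel a z =
     exp ((\<Sum>j\<in>UNIV. z $ j * cnj (a $ j)) / 2 - of_real ((norm a)\<^sup>2 / 4))"
proof -
  have "(\<Sum>j\<in>UNIV. a $ j * cnj (a $ j)) = of_real ((norm a)\<^sup>2)"
    by (simp add: norm_vec_def L2_set_def sum_nonneg complex_norm_square del: of_real_power)
  then have "bargmann_kernel a a = exp (of_real ((norm a)\<^sup>2 / 4)) ^ 2"
    by (simp add: bargmann_kernel_def flip: exp_of_nat_mult)
  moreover have "csqrt (exp (of_real ((norm a)\<^sup>2 / 4)) ^ 2) = exp (of_real ((norm a)\<^sup>2 / 4))"
    by (rule csqrt_square) (simp add: exp_of_real del: of_real_divide)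
  ultimately show ?thesis
    by (simp add: normalized_kernel_def bargmann_kernel_def exp_diff)
qed

definition toeplitz_domain :: "(complex ^ 'n \<Rightarrow> complex) \<Rightarrow> (complex ^ 'n \<Rightarrow> complex) set" where
  "toeplitz_domain g = {f \<in> bargmann. (\<lambda>z. g z * f z) \<in> L2_gauss}"

definition toeplitz ::
    "(complex ^ 'n \<Rightarrow> complex) \<Rightarrow> (complex ^ 'n \<Rightarrow> complex) \<Rightarrow> (complex ^ 'n \<Rightarrow> complex)" where
  "toeplitz g f = bargmann_proj (\<lambda>z. g z * f z)"

definition bounded_operator_on_bargmann ::
    "((complex ^ 'n \<Rightarrow> complex) \<Rightarrow> (complex ^ 'n \<Rightarrow> complex)) \<Rightarrow> bool" where
  "bounded_operator_on_bargmann S \<longleftrightarrow>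
     (\<forall>f\<in>bargmann. S f \<in> bargmann) \<and>
     (\<forall>f\<in>bargmann. \<forall>h\<in>bargmann. S (\<lambda>z. f z + h z) = (\<lambda>z. S f z + S h z)) \<and>
     (\<forall>c. \<forall>f\<in>bargmann. S (\<lambda>z. c * f z) = (\<lambda>z. c * S f z)) \<and>
     (\<exists>C. \<forall>f\<in>bargmann. L2_norm (S f) \<le> C * L2_norm f)"

definition toeplitz_extends_bounded :: "(complex ^ 'n \<Rightarrow> complex) \<Rightarrow> bool" where
  "toeplitz_extends_bounded g \<longleftrightarrow>
     (\<exists>S. bounded_operator_on_bargmann S \<and> (\<forall>f\<in>toeplitz_domain g. S f = toeplitz g f))"

text \<open>Where the integral does not converge absolutely, the Bochner integral is \<open>0\<close> by
  convention; such points cannot make the transform unbounded. If every \<open>g k\<^sub>a\<close> is in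
  \<open>L2_gauss\<close>, the integral for \<open>t = 1/4\<close> converges absolutely everywhere.\<close>

definition heat_transform ::
    "real \<Rightarrow> (complex ^ 'n \<Rightarrow> complex) \<Rightarrow> complex ^ 'n \<Rightarrow> complex" where
  "heat_transform t g a =
     (LINT w|lborel. g w * of_real (exp (- (norm (w - a))\<^sup>2 / (4 * t))))
       / of_real ((4 * pi * t) ^ CARD('n))"

end

theory Submission imports Defs "HOL-Complex_Analysis.Complex_Analysis"
begin

text \<open>
  For a small real angle \<open>\<tau>\<close> put \<open>c = exp (2 i \<tau>)\<close> and consider the symbol
  \<open>exp ((1 - c) |z|\<^sup>2 / 2)\<close>. Multiplied by the Gaussian density it turns \<open>exp (- |z|\<^sup>2 / 2)\<close> into
  \<open>exp (- c |z|\<^sup>2 / 2)\<close>, and a Gaussian with a complex parameter \<open>c\<close> still reproduces entire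
  functions, up to the scaling by \<open>1 / c\<close> (\<open>gaussian_reproducing\<close>). Hence the Toeplitz operator of
  this symbol extends to the unitary map \<open>f \<mapsto> c\<^sup>-\<^sup>n f (z / c)\<close>: as a function of \<open>\<tau>\<close> it is a one-parameter
  group. The same formula shows that the heat transform at time \<open>1/4\<close> is
  \<open>(exp (- i \<tau>) / cos \<tau>)\<^sup>n exp (- i tan \<tau> |a|\<^sup>2)\<close> (\<open>heat_circle_symbol\<close>). The operator
  therefore depends on \<open>\<tau>\<close> through the frequency \<open>\<tau>\<close>, the heat transform through the frequency
  \<open>tan \<tau>\<close>; this change of variable is not linear, and such changes do not preserve the
  boundedness of Fourier transforms. That is the source of the counterexample.

  Concretely, take \<open>2\<^sup>k\<close> angles in arithmetic progression and add the corresponding symbols with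
  Rudin-Shapiro signs. The parallelogram law, applied along the Rudin-Shapiro recursion to powers of
  a single isometry, bounds the norm of the sum of the operators by \<open>sqrt 2 * sqrt 2 ^ k\<close>
  (\<open>rs_op_L2_bound\<close>). The tangents of the angles, on the other hand, are linearly independent over
  the integers for all but countably many positions of the progression
  (\<open>generic_angle_exists\<close>), so Kronecker's theorem provides a point \<open>a\<close> at which all \<open>2\<^sup>k\<close>
  phases of the heat transform are nearly aligned: there the heat transform has modulus at least
  \<open>2\<^sup>k / 2\<close> (\<open>rs_symbol_heat_large\<close>). After division by \<open>sqrt 2 ^ k\<close> the operators are uniformly
  bounded while the heat transforms are not.

  It remains to merge these symbols into one. The normalized symbols are dominated, uniformly in
  \<open>k\<close>, by \<open>4 exp (|z|\<^sup>2 / 8)\<close> (\<open>rs_symbol_bound\<close>), because Rudin-Shapiro sums of a slowly varying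
  sequence are of the same order as those of a constant one. So every absolutely summable combination of them
  converges, satisfies the integrability conditions, and has a Toeplitz operator with a bounded
  extension. A gliding hump (\<open>gliding_hump\<close>) selects a combination whose heat transform is unbounded.

  Two further points need care. The individual operators are compared with the Toeplitz operator of
  the sum only in pairings with kernel functions, where all integrals converge absolutely; that this determines the
  projection is \<open>bargmann_proj_eqI\<close>, a Fubini argument resting on the Gaussian decay of the
  kernel. And the series of operators produces entire functions by Cauchy's estimates
  (\<open>entire_series\<close>).
\<close>

section \<open>Rotation invariance and mean values\<close>

lemma nn_integral_lborel_affine_unit:
  fixes h :: "'a::euclidean_space \<Rightarrow> ennreal"
  assumes [measurable]: "h \<in> borel_measurable borel" and c: "\<bar>c\<bar> = 1"
  shows "(\<integral>\<^sup>+x. h (t + c *\<^sub>R x) \<partial>lborel) = (\<integral>\<^sup>+x. h x \<partial>lborel)"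
proof -
  have "(\<integral>\<^sup>+x. h x \<partial>lborel) = (\<integral>\<^sup>+x. h x \<partial>density (distr lborel borel (\<lambda>x. t + c *\<^sub>R x)) (\<lambda>_. ennreal (\<bar>c\<bar> ^ DIM('a))))"
    using c by (subst lborel_affine[of c t]) auto
  also have "\<dots> = (\<integral>\<^sup>+x. h (t + c *\<^sub>R x) \<partial>lborel)"
    by (simp add: nn_integral_density nn_integral_distr c)
  finally show ?thesis ..
qed

text \<open>
  Uniqueness of translation-invariant measures in its shortest form: integrating the product of the
  indicators of \<open>A\<close> and of the unit ball against the image measure and Lebesgue measure, and
  translating each variable by the other one, interchanges the two measures. The unit ball has the
  same finite positive mass for both of them, so it can be cancelled.
\<close>

lemma lborel_distr_linear_isometry:
  fixes f :: "'a::euclidean_space \<Rightarrow> 'a"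
  assumes lin: "linear f" and iso: "\<And>x. norm (f x) = norm x"
  shows "distr lborel borel f = lborel"
proof (rule measure_eqI)
  fix A :: "'a set"
  assume "A \<in> sets (distr lborel borel f)"
  then have A[measurable]: "A \<in> sets borel" by simp
  interpret lin: linear f by fact
  have [measurable]: "f \<in> borel_measurable borel"
    using linear_continuous_on[of f UNIV] lin
    by (simp add: borel_measurable_continuous_onI linear_conv_bounded_linear)
  have "inj f"
    using iso by (metis lin linear_injective_0 norm_eq_zero)
  then have "surj f"
    using lin linear_injective_imp_surjective by blast
  then obtain g where g: "\<And>y. f (g y) = y"
    by (metis surj_f_inv_f)
  define B where "B = ball (0::'a) 1"
  have [measurable]: "B \<in> sets borel" by (simp add: B_def)
  have fB: "indicator B (f x) = (indicator B x :: ennreal)" for x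
    by (simp add: B_def indicator_def iso)
  let ?a = "\<lambda>x. indicator A x :: ennreal" and ?b = "\<lambda>x. indicator B x :: ennreal"
  have "emeasure (distr lborel borel f) A = (\<integral>\<^sup>+x. ?a x \<partial>distr lborel borel f)"
    by simp
  also have "\<dots> = (\<integral>\<^sup>+x. ?a (f x) \<partial>lborel)"
    by (subst nn_integral_distr) simp_all
  finally have "emeasure (distr lborel borel f) A * emeasure lborel B
      = (\<integral>\<^sup>+x. ?a (f x) \<partial>lborel) * emeasure lborel B"
    by simp
  also have "\<dots> = (\<integral>\<^sup>+x. ?a (f x) * (\<integral>\<^sup>+y. ?b y \<partial>lborel) \<partial>lborel)"
    by (simp add: nn_integral_multc)
  also have "\<dots> = (\<integral>\<^sup>+x. ?a (f x) * (\<integral>\<^sup>+y. ?b (f x + 1 *\<^sub>R y) \<partial>lborel) \<partial>lborel)"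
    by (subst nn_integral_lborel_affine_unit) simp_all
  also have "\<dots> = (\<integral>\<^sup>+x. (\<integral>\<^sup>+y. ?a (f x) * ?b (f x + y) \<partial>lborel) \<partial>lborel)"
    by (subst nn_integral_cmult) simp_all
  also have "\<dots> = (\<integral>\<^sup>+y. (\<integral>\<^sup>+x. ?a (f x) * ?b (f x + y) \<partial>lborel) \<partial>lborel)"
    by (rule lborel_pair.Fubini') measurable
  also have "\<dots> = (\<integral>\<^sup>+y. (\<integral>\<^sup>+x. ?a (f (- g y + 1 *\<^sub>R x)) * ?b (f (- g y + 1 *\<^sub>R x) + y) \<partial>lborel) \<partial>lborel)"
    by (subst nn_integral_lborel_affine_unit[where h="\<lambda>x. ?a (f x) * ?b (f x + _)"]) simp_all
  also have "\<dots> = (\<integral>\<^sup>+y. (\<integral>\<^sup>+x. ?a (f x - y) * ?b (f x) \<partial>lborel) \<partial>lborel)"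
    by (simp add: lin.diff g)
  also have "\<dots> = (\<integral>\<^sup>+x. (\<integral>\<^sup>+y. ?a (f x - y) * ?b (f x) \<partial>lborel) \<partial>lborel)"
    by (rule lborel_pair.Fubini') measurable
  also have "\<dots> = (\<integral>\<^sup>+x. (\<integral>\<^sup>+y. ?a (f x + (-1) *\<^sub>R y) \<partial>lborel) * ?b (f x) \<partial>lborel)"
    by (subst nn_integral_multc) simp_all
  also have "\<dots> = emeasure lborel A * emeasure lborel B"
    by (subst nn_integral_lborel_affine_unit) (simp_all add: nn_integral_cmult fB)
  finally have eq: "emeasure (distr lborel borel f) A * emeasure lborel B = emeasure lborel A * emeasure lborel B" .
  have "unit_ball_vol (real DIM('a)) \<noteq> 0"
    by (metis less_irrefl of_nat_0_le_iff unit_ball_vol_pos)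
  then have "emeasure lborel B \<noteq> 0" "emeasure lborel B \<noteq> \<infinity>"
    by (simp_all add: B_def emeasure_ball)
  with eq show "emeasure (distr lborel borel f) A = emeasure lborel A"
    by (metis ennreal_mult_cancel_left infinity_ennreal_def mult.commute)
qed simp

lemma norm_vector_smult: "norm (c *s v) = cmod c * norm (v :: complex ^ 'n)"
  by (simp add: norm_vec_def norm_mult L2_set_right_distrib)

lemma linear_vector_smult: "linear ((*s) c :: complex ^ 'n \<Rightarrow> complex ^ 'n)"
  by (rule linearI) (simp_all add: vec_eq_iff algebra_simps)

lemma lborel_distr_rotation:
  assumes "cmod c = 1"
  shows "distr lborel borel ((*s) c) = (lborel :: (complex ^ 'n) measure)"
  by (rule lborel_distr_linear_isometry[OF linear_vector_smult]) (simp add: norm_vector_smult assms)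

lemma continuous_on_vector_smult [continuous_intros]:
  fixes g :: "'a::topological_space \<Rightarrow> complex ^ 'n"
  assumes "continuous_on S f" "continuous_on S g"
  shows "continuous_on S (\<lambda>x. f x *s g x)"
  unfolding vector_scalar_mult_def using assms by (intro continuous_intros)

lemma measurable_vector_smult [measurable]:
  "((*s) c :: complex ^ 'n \<Rightarrow> complex ^ 'n) \<in> borel_measurable borel"
  by (intro borel_measurable_continuous_onI continuous_intros)

lemma has_integral_circle_mean:
  assumes "f holomorphic_on UNIV"
  shows "((\<lambda>t. f (cis (2 * pi * t))) has_integral f 0) {0..1}"
proof -
  have "((\<lambda>u. f u/(u-0)) has_contour_integral (2 * of_real pi * \<i> * f 0)) (circlepath 0 1)"
    using assms by (intro Cauchy_integral_circlepath_simple) (auto intro: holomorphic_on_subset)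
  then have "((\<lambda>x. f (circlepath 0 1 x) / circlepath 0 1 x * vector_derivative (circlepath 0 1) (at x within {0..1}))
      has_integral (2 * of_real pi * \<i> * f 0)) {0..1}"
    by (simp add: has_contour_integral_def)
  then have "((\<lambda>x. 2 * of_real pi * \<i> * f (cis (2 * pi * x))) has_integral (2 * of_real pi * \<i> * f 0)) {0..1}"
    by (rule has_integral_eq[rotated])
       (simp add: vector_derivative_circlepath01, simp add: circlepath cis_conv_exp mult_ac)
  then have "((\<lambda>x. 2 * of_real pi * \<i> * f (cis (2 * pi * x)) / (2 * of_real pi * \<i>)) has_integral (2 * of_real pi * \<i> * f 0) / (2 * of_real pi * \<i>)) {0..1}"
    by (rule has_integral_divide)
  then show ?thesis by simp
qed

text \<open>
  Replacing \<open>v\<close> by \<open>exp (2 \<pi> i t) v\<close> does not change the integral. Averaging over \<open>t\<close> under the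
  integral sign replaces \<open>F v\<close> by the mean of a holomorphic function of one variable over a circle,
  which is \<open>F 0\<close>.
\<close>

lemma rotation_invariant_mean_value:
  fixes F :: "complex ^ 'n \<Rightarrow> complex"
  assumes F: "continuous_on UNIV F" and hol: "\<And>v. (\<lambda>\<zeta>. F (\<zeta> *s v)) holomorphic_on UNIV"
    and W[measurable]: "W \<in> borel_measurable borel"
    and rot: "\<And>c v. cmod c = 1 \<Longrightarrow> W (c *s v) = W v"
    and int: "integrable lborel (\<lambda>v. F v * W v)"
  shows "(LINT v|lborel. F v * W v) = F 0 * (LINT v|lborel. W v)"
proof -
  let ?H = "\<lambda>(v :: complex ^ 'n) t. indicator {0..1::real} t *\<^sub>R (F (cis (2 * pi * t) *s v) * W v)"
  have [measurable]: "F \<in> borel_measurable borel"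
    by (intro borel_measurable_continuous_onI F)
  have "continuous_on UNIV (\<lambda>(v :: complex ^ 'n, t). F (cis (2 * pi * t) *s v))"
    unfolding split_def cis_conv_exp
    by (intro continuous_on_compose2[OF F] continuous_intros) auto
  then have [measurable]: "(\<lambda>(v :: complex ^ 'n, t). F (cis (2 * pi * t) *s v)) \<in> borel_measurable (borel \<Otimes>\<^sub>M borel)"
    unfolding borel_prod by (rule borel_measurable_continuous_onI)
  have inv: "(LINT v|lborel. F (cis s *s v) * W v) = (LINT v|lborel. F v * W v)"
    "(\<integral>\<^sup>+v. norm (F (cis s *s v) * W v) \<partial>lborel) = (\<integral>\<^sup>+v. norm (F v * W v) \<partial>lborel)" for s
    by (subst (2) lborel_distr_rotation[of "cis s", symmetric],
        simp, simp add: integral_distr nn_integral_distr rot)+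
  have "integrable (lborel \<Otimes>\<^sub>M lborel) (\<lambda>(v, t). ?H v t)"
  proof (rule integrableI_bounded)
    show "(\<lambda>(v, t). ?H v t) \<in> borel_measurable (lborel \<Otimes>\<^sub>M lborel)"
      by measurable
    have "(\<integral>\<^sup>+x. norm (case x of (v, t) \<Rightarrow> ?H v t) \<partial>(lborel \<Otimes>\<^sub>M lborel)) =
      (\<integral>\<^sup>+t. (\<integral>\<^sup>+v. norm (?H v t) \<partial>lborel) \<partial>lborel)"
      by (subst lborel_pair.nn_integral_snd[symmetric]) (auto intro!: measurable_compose[OF _ measurable_ennreal] simp: split_def)
    also have "\<dots> = (\<integral>\<^sup>+t. indicator {0..1::real} t * (\<integral>\<^sup>+v. norm (F (cis (2 * pi * t) *s v) * W v) \<partial>lborel) \<partial>lborel)"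
      by (intro nn_integral_cong) (auto simp: indicator_def)
    also have "\<dots> = (\<integral>\<^sup>+v. norm (F v * W v) \<partial>lborel)"
      by (simp add: inv nn_integral_multc)
    also have "\<dots> < \<infinity>"
      using int by (simp add: integrable_iff_bounded)
    finally show "(\<integral>\<^sup>+x. norm (case x of (v, t) \<Rightarrow> ?H v t) \<partial>(lborel \<Otimes>\<^sub>M lborel)) < \<infinity>" .
  qed
  note fub = lborel_pair.Fubini_integral[OF this]
  have "(LINT v|lborel. F v * W v) = (LINT t|lborel. indicator {0..1::real} t *\<^sub>R (LINT v|lborel. F (cis (2 * pi * t) *s v) * W v))"
    by (simp add: inv)
  also have "\<dots> = (LINT t|lborel. LINT v|lborel. ?H v t)"
    by simp
  also have "\<dots> = (LINT v|lborel. LINT t|lborel. ?H v t)"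
    by (rule fub)
  also have "\<dots> = (LINT v|lborel. F 0 * W v)"
  proof (rule Bochner_Integration.integral_cong[OF refl])
    fix v :: "complex ^ 'n"
    have "continuous_on {0..1} (\<lambda>t. F (cis (2 * pi * t) *s v))"
      unfolding cis_conv_exp by (intro continuous_on_compose2[OF F] continuous_intros) auto
    then have si: "set_integrable lborel {0..1} (\<lambda>t. F (cis (2 * pi * t) *s v))"
      by (rule borel_integrable_atLeastAtMost')
    have "(LINT t:{0..1}|lborel. F (cis (2 * pi * t) *s v)) = F (0 *s v)"
      using set_borel_integral_eq_integral(2)[OF si] has_integral_circle_mean[OF hol[of v]]
      by (simp add: integral_unique)
    then show "(LINT t|lborel. ?H v t) = F 0 * W v"
      by (simp add: set_lebesgue_integral_def flip: mult_scaleR_left)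
  qed
  finally show ?thesis by simp
qed

section \<open>Gaussian integrals with a complex parameter\<close>

lemma set_integral_FTC_Ioi:
  fixes F f :: "real \<Rightarrow> complex"
  assumes F: "\<And>t. t \<ge> u \<Longrightarrow> (F has_vector_derivative f t) (at t)"
    and f: "\<And>t. t > u \<Longrightarrow> isCont f t" and int: "set_integrable lborel {u<..} f"
    and lim: "(F \<longlongrightarrow> 0) at_top"
  shows "(LINT t:{u<..}|lborel. f t) = - F u"
proof -
  have cont: "isCont F u"
    using F[of u] has_vector_derivative_continuous by auto
  have "(LBINT t=ereal u..\<infinity>. f t) = 0 - F u"
  proof (rule interval_integral_FTC_integrable)
    show "set_integrable lborel (einterval (ereal u) \<infinity>) f"
      using int by (simp add: einterval_def greaterThan_def)
    show "((F \<circ> real_of_ereal) \<longlongrightarrow> F u) (at_right (ereal u))"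
      using cont by (simp add: ereal_tendsto_simps continuous_at filterlim_at_split)
    show "((F \<circ> real_of_ereal) \<longlongrightarrow> 0) (at_left \<infinity>)"
      using lim by (simp add: ereal_tendsto_simps)
  qed (auto intro: F f)
  then show ?thesis
    by (simp add: interval_lebesgue_integral_def einterval_def greaterThan_def)
qed

lemma power_div_fact_le_exp:
  assumes "x \<ge> (0::real)"
  shows "x ^ n / fact n \<le> exp x"
proof -
  have "(\<Sum>k\<in>{n}. x ^ k /\<^sub>R fact k) \<le> (\<Sum>k. x ^ k /\<^sub>R fact k)"
    using assms by (intro sum_le_suminf summable_exp_generic) auto
  then show ?thesis by (simp add: exp_def divide_inverse mult.commute)
qed

lemma norm_power_exp_le:
  assumes "Re c > 0" "t \<ge> 0"
  shows "cmod (of_real t ^ n * exp (- c * of_real t)) \<le> fact n * (2 / Re c) ^ n * exp (- (Re c / 2) * t)"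
proof -
  have "(Re c / 2 * t) ^ n / fact n \<le> exp (Re c / 2 * t)"
    using assms by (intro power_div_fact_le_exp) auto
  then have "t ^ n \<le> fact n * (2 / Re c) ^ n * exp (Re c / 2 * t)"
    using assms by (simp add: field_simps)
  then have "t ^ n * exp (- Re c * t) \<le> fact n * (2 / Re c) ^ n * exp (Re c / 2 * t) * exp (- Re c * t)"
    by (intro mult_right_mono) auto
  also have "\<dots> = fact n * (2 / Re c) ^ n * exp (- (Re c / 2) * t)"
    by (simp add: mult.assoc flip: exp_add)
  finally show ?thesis
    using assms by (simp add: norm_mult norm_power)
qed

lemma set_integrable_exp_Ici:
  assumes "r > (0::real)"
  shows "set_integrable lborel {0..} (\<lambda>t. exp (- r * t))"
proof -
  have "(\<lambda>t. exp (- r * t)) absolutely_integrable_on {0..}"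
    using has_integral_exp_minus_to_infinity[OF assms, of 0]
    by (intro nonnegative_absolutely_integrable_1) (auto simp: integrable_on_def)
  then show ?thesis
    by (simp add: set_integrable_def integrable_completion)
qed

lemma set_integrable_power_exp:
  assumes "Re c > 0" "u \<ge> 0"
  shows "set_integrable lborel {u<..} (\<lambda>t. of_real t ^ n * exp (- c * of_real t))"
proof (rule set_integrable_bound)
  show "set_integrable lborel {u<..} (\<lambda>t. fact n * (2 / Re c) ^ n * exp (- (Re c / 2) * t))"
    using assms set_integrable_exp_Ici[of "Re c / 2"]
    by (intro set_integrable_mult_right) (auto intro: set_integrable_subset)
  show "set_borel_measurable lborel {u<..} (\<lambda>t. of_real t ^ n * exp (- c * of_real t))"
    unfolding set_borel_measurable_def by measurable
  show "AE x in lborel. x \<in> {u<..} \<longrightarrow> cmod (of_real x ^ n * exp (- c * of_real x))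
      \<le> norm (fact n * (2 / Re c) ^ n * exp (- (Re c / 2) * x))"
    using assms norm_power_exp_le[OF assms(1), of _ n] by (auto simp: abs_mult)
qed

lemma power_exp_tendsto_0:
  assumes "Re c > 0"
  shows "((\<lambda>t. of_real t ^ n * exp (- c * of_real t)) \<longlongrightarrow> 0) at_top"
proof (rule Lim_null_comparison)
  show "\<forall>\<^sub>F t in at_top. cmod (of_real t ^ n * exp (- c * of_real t)) \<le> fact n * (2 / Re c) ^ n * exp (- (Re c / 2) * t)"
    using eventually_ge_at_top[of 0] by eventually_elim (rule norm_power_exp_le[OF assms])
  have "((\<lambda>t. exp (- (Re c / 2) * t)) \<longlongrightarrow> 0) at_top"
    using assms
    by (intro filterlim_compose[OF exp_at_bot] filterlim_tendsto_neg_mult_at_bot[OF tendsto_const] filterlim_ident) auto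
  then show "((\<lambda>t. fact n * (2 / Re c) ^ n * exp (- (Re c / 2) * t)) \<longlongrightarrow> 0) at_top"
    by (rule tendsto_mult_right_zero)
qed

lemma power_exp_has_vector_derivative:
  fixes c :: complex
  shows
  "((\<lambda>t::real. of_real t ^ Suc n * exp (- c * of_real t)) has_vector_derivative
     of_nat (Suc n) * (of_real t ^ n * exp (- c * of_real t)) - c * (of_real t ^ Suc n * exp (- c * of_real t))) (at t)"
proof -
  have "((\<lambda>z::complex. z ^ Suc n * exp (- c * z)) has_field_derivative
     of_nat (Suc n) * (of_real t ^ n * exp (- c * of_real t)) - c * (of_real t ^ Suc n * exp (- c * of_real t))) (at (of_real t))"
    by (auto intro!: derivative_eq_intros simp: algebra_simps simp del: power_Suc)
  then show ?thesis
    by (rule has_vector_derivative_real_field)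
qed

lemma set_integral_exp_Ioi:
  assumes "Re c > 0" "u \<ge> 0"
  shows "(LINT t:{u<..}|lborel. c * exp (- c * of_real t)) = exp (- c * of_real u)"
proof -
  have "((\<lambda>t. - exp (- c * of_real t)) has_vector_derivative c * exp (- c * of_real t)) (at t)" for t
    by (rule has_vector_derivative_real_field) (auto intro!: derivative_eq_intros)
  moreover have "((\<lambda>t. - exp (- c * of_real t)) \<longlongrightarrow> 0) at_top"
    using tendsto_minus[OF power_exp_tendsto_0[OF assms(1), of 0]] by simp
  moreover have "set_integrable lborel {u<..} (\<lambda>t. c * exp (- c * of_real t))"
    using set_integrable_power_exp[OF assms, of 0] by (intro set_integrable_mult_right) simp
  ultimately have "(LINT t:{u<..}|lborel. c * exp (- c * of_real t)) = - (- exp (- c * of_real u))"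
    by (intro set_integral_FTC_Ioi) auto
  then show ?thesis by simp
qed

lemma set_integral_power_exp:
  assumes "Re c > 0"
  shows "(LINT t:{0<..}|lborel. of_real t ^ n * exp (- c * of_real t)) = fact n / c ^ Suc n"
proof (induction n)
  case 0
  have "c * (LINT t:{0<..}|lborel. exp (- c * of_real t)) = 1"
    using set_integral_exp_Ioi[OF assms, of 0] by simp
  moreover have "c \<noteq> 0" using assms by auto
  ultimately show ?case by (simp add: field_simps)
next
  case (Suc n)
  note int = set_integrable_power_exp[OF assms order_refl]
  have c: "c \<noteq> 0" using assms by auto
  have "(LINT t:{0<..}|lborel. of_nat (Suc n) * (of_real t ^ n * exp (- c * of_real t)) - c * (of_real t ^ Suc n * exp (- c * of_real t)))
      = - (of_real 0 ^ Suc n * exp (- c * of_real 0))"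
  proof (rule set_integral_FTC_Ioi[OF power_exp_has_vector_derivative])
    show "((\<lambda>t. of_real t ^ Suc n * exp (- c * of_real t)) \<longlongrightarrow> 0) at_top"
      by (rule power_exp_tendsto_0[OF assms])
  qed (intro continuous_intros set_integral_diff set_integrable_mult_right int)+
  then have "of_nat (Suc n) * (LINT t:{0<..}|lborel. of_real t ^ n * exp (- c * of_real t))
     = c * (LINT t:{0<..}|lborel. of_real t ^ Suc n * exp (- c * of_real t))"
    by (subst (asm) set_integral_diff) (intro set_integrable_mult_right int, intro set_integrable_mult_right int, simp del: of_nat_Suc)
  then show ?case
    using c unfolding Suc by (simp add: field_simps)
qed

lemma emeasure_ball_complex_vec:
  "emeasure lborel {v :: complex ^ 'n. (norm v)\<^sup>2 / 2 < t} =
     ennreal (indicator {0<..} t * ((2 * pi * t) ^ CARD('n) / fact CARD('n)))"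
proof (cases "t > 0")
  case True
  then have "{v :: complex ^ 'n. (norm v)\<^sup>2 / 2 < t} = ball 0 (sqrt (2 * t))"
    by (auto simp: real_less_rsqrt dest: real_less_lsqrt) (smt (verit) norm_ge_zero real_sqrt_less_iff real_sqrt_unique)
  moreover have "sqrt (2 * t) ^ (2 * CARD('n)) = (2 * t) ^ CARD('n)"
    using True by (simp add: power_mult)
  ultimately show ?thesis
    using True unit_ball_vol_even[of "CARD('n)"]
    by (simp add: emeasure_ball mult.commute power_mult_distrib)
next
  case False
  then have "{v :: complex ^ 'n. (norm v)\<^sup>2 / 2 < t} = {}"
    by (auto simp: not_less) (smt (verit) zero_le_power2)
  then show ?thesis using False by simp
qed

text \<open>
  The Gaussian \<open>exp (- c |v|\<^sup>2 / 2)\<close> is the integral of \<open>c exp (- c t)\<close> over all \<open>t > |v|\<^sup>2 / 2\<close>.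
  Interchanging the integrals leaves the volumes of balls, which for even real dimension are
  monomials in \<open>t\<close>; in this way a complex \<open>c\<close> costs no more than a real one.
\<close>

lemma gaussian_layer_cake_integrable:
  assumes "Re c > 0"
  shows "integrable (lborel \<Otimes>\<^sub>M lborel)
    (\<lambda>(v :: complex ^ 'n, t). indicator {(norm v)\<^sup>2 / 2<..} t *\<^sub>R (c * exp (- c * of_real t)))"
    (is "integrable _ (\<lambda>(v, t). ?H v t)")
proof (rule integrableI_bounded)
  show meas: "(\<lambda>(v :: complex ^ 'n, t). ?H v t) \<in> borel_measurable (lborel \<Otimes>\<^sub>M lborel)"
    by (simp add: split_def indicator_def greaterThan_def)
  have meas': "(\<lambda>x. ennreal (norm (case x of (v :: complex ^ 'n, t) \<Rightarrow> ?H v t))) \<in> borel_measurable (lborel \<Otimes>\<^sub>M lborel)"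
    using meas by measurable
  let ?g = "\<lambda>t. c * ((2 * of_real pi) ^ CARD('n) / fact CARD('n)) * (of_real t ^ CARD('n) * exp (- c * of_real t))"
  have "(\<integral>\<^sup>+x. norm (case x of (v :: complex ^ 'n, t) \<Rightarrow> ?H v t) \<partial>(lborel \<Otimes>\<^sub>M lborel)) =
      (\<integral>\<^sup>+t. (\<integral>\<^sup>+(v :: complex ^ 'n). norm (?H v t) \<partial>lborel) \<partial>lborel)"
    by (subst lborel_pair.nn_integral_snd[OF meas', symmetric]) simp
  also have "\<dots> = (\<integral>\<^sup>+t. norm (c * exp (- c * of_real t)) * emeasure lborel {v :: complex ^ 'n. (norm v)\<^sup>2 / 2 < t} \<partial>lborel)"
    by (intro nn_integral_cong, subst nn_integral_cmult_indicator[symmetric])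
       (auto intro!: nn_integral_cong simp: indicator_def)
  also have "\<dots> = (\<integral>\<^sup>+t. norm (indicator {0<..} t *\<^sub>R ?g t) \<partial>lborel)"
    unfolding emeasure_ball_complex_vec
    by (intro nn_integral_cong)
       (auto simp: indicator_def norm_mult norm_power norm_divide power_mult_distrib mult_ac simp flip: ennreal_mult')
  also have "\<dots> < \<infinity>"
    using set_integrable_mult_right[OF set_integrable_power_exp[OF assms order_refl, of "CARD('n)"], of "c * ((2 * of_real pi) ^ CARD('n) / fact CARD('n))"]
    unfolding set_integrable_def integrable_iff_bounded by simp
  finally show "(\<integral>\<^sup>+x. norm (case x of (v :: complex ^ 'n, t) \<Rightarrow> ?H v t) \<partial>(lborel \<Otimes>\<^sub>M lborel)) < \<infinity>" .
qed

lemma gaussian_layer_cake: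
  assumes "Re c > 0"
  shows "(LINT t|lborel. indicator {(norm v)\<^sup>2 / 2<..} t *\<^sub>R (c * exp (- c * of_real t))) = exp (- c * of_real ((norm v)\<^sup>2) / 2)"
proof -
  have "exp (- c * of_real ((norm v)\<^sup>2 / 2)) = exp (- c * of_real ((norm v)\<^sup>2) / 2)"
    by simp
  with set_integral_exp_Ioi[OF assms, of "(norm v)\<^sup>2 / 2"] show ?thesis
    by (simp only: set_lebesgue_integral_def zero_le_power2 zero_le_divide_iff) simp
qed

lemma complex_gaussian_integral:
  assumes "Re c > 0"
  shows "integrable lborel (\<lambda>v :: complex ^ 'n. exp (- c * of_real ((norm v)\<^sup>2) / 2))"
    and "(LINT v|lborel. exp (- c * of_real ((norm (v :: complex ^ 'n))\<^sup>2) / 2)) = (2 * of_real pi / c) ^ CARD('n)"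
proof -
  note H = gaussian_layer_cake_integrable[OF assms, where 'n='n]
  show "integrable lborel (\<lambda>v :: complex ^ 'n. exp (- c * of_real ((norm v)\<^sup>2) / 2))"
    using lborel_pair.integrable_fst[OF H] by (simp only: split gaussian_layer_cake[OF assms])
  have "(LINT v|lborel. exp (- c * of_real ((norm (v :: complex ^ 'n))\<^sup>2) / 2))
      = (LINT t|lborel. LINT (v :: complex ^ 'n)|lborel. indicator {(norm v)\<^sup>2 / 2<..} t *\<^sub>R (c * exp (- c * of_real t)))"
    unfolding gaussian_layer_cake[OF assms, symmetric] by (rule lborel_pair.Fubini_integral[OF H, symmetric])
  also have "\<dots> = (LINT t|lborel. measure lborel {v :: complex ^ 'n. (norm v)\<^sup>2 / 2 < t} *\<^sub>R (c * exp (- c * of_real t)))"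
  proof (intro Bochner_Integration.integral_cong refl)
    fix t :: real
    have eq: "indicator {(norm v)\<^sup>2 / 2<..} t = (indicator {v. (norm v)\<^sup>2 / 2 < t} v :: real)" for v :: "complex ^ 'n"
      by (simp add: indicator_def)
    have "integrable lborel (indicator {v :: complex ^ 'n. (norm v)\<^sup>2 / 2 < t} :: _ \<Rightarrow> real)"
      by (rule integrable_real_indicator) (simp, subst emeasure_ball_complex_vec, simp)
    then show "(LINT (v :: complex ^ 'n)|lborel. indicator {(norm v)\<^sup>2 / 2<..} t *\<^sub>R (c * exp (- c * of_real t)))
        = measure lborel {v :: complex ^ 'n. (norm v)\<^sup>2 / 2 < t} *\<^sub>R (c * exp (- c * of_real t))"
      unfolding eq by simp
  qed
  also have "\<dots> = (LINT t:{0<..}|lborel. c * (2 * of_real pi) ^ CARD('n) / fact CARD('n) * (of_real t ^ CARD('n) * exp (- c * of_real t)))"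
    unfolding set_lebesgue_integral_def measure_def emeasure_ball_complex_vec
    by (intro Bochner_Integration.integral_cong refl)
       (auto simp: indicator_def scaleR_conv_of_real power_mult_distrib)
  also have "\<dots> = (2 * of_real pi / c) ^ CARD('n)"
    using assms by (simp only: set_integral_mult_right set_integral_power_exp) (auto simp: field_simps)
  finally show "(LINT v|lborel. exp (- c * of_real ((norm (v :: complex ^ 'n))\<^sup>2) / 2)) = (2 * of_real pi / c) ^ CARD('n)" .
qed

section \<open>Entire functions and the reproducing Gaussian\<close>

definition cdot :: "complex ^ 'n \<Rightarrow> complex ^ 'n \<Rightarrow> complex" where
  "cdot z w = (\<Sum>j\<in>UNIV. z $ j * cnj (w $ j))"

lemma cdot_add_left: "cdot (x + y) w = cdot x w + cdot y w"
  and cdot_add_right: "cdot w (x + y) = cdot w x + cdot w y"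
  and cdot_smult_left: "cdot (c *s x) w = c * cdot x w"
  by (simp_all add: cdot_def algebra_simps sum.distrib sum_distrib_left)

lemma cdot_self: "cdot z z = of_real ((norm z)\<^sup>2)"
  by (simp add: cdot_def norm_vec_def L2_set_def sum_nonneg complex_norm_square del: of_real_power)

lemma cnj_cdot: "cnj (cdot z w) = cdot w z"
  by (simp add: cdot_def mult.commute)

lemma Re_cdot: "Re (cdot z w) = inner z w"
  by (simp add: cdot_def inner_vec_def inner_complex_def)

lemma continuous_on_cdot [continuous_intros]:
  "continuous_on S f \<Longrightarrow> continuous_on S g \<Longrightarrow> continuous_on S (\<lambda>x. cdot (f x) (g x))"
  unfolding cdot_def by (intro continuous_intros)

lemma bargmann_kernel_cdot: "bargmann_kernel z w = exp (cdot z w / 2)"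
  by (simp add: bargmann_kernel_def cdot_def)

lemma cnj_bargmann_kernel: "cnj (bargmann_kernel z w) = bargmann_kernel w z"
  by (simp add: bargmann_kernel_cdot exp_cnj cnj_cdot)

lemma norm_bargmann_kernel: "cmod (bargmann_kernel z w) = exp (inner z w / 2)"
  by (simp add: bargmann_kernel_cdot Re_cdot)

lemma entire_imp_continuous: "entire f \<Longrightarrow> continuous_on S f"
  unfolding entire_def by (metis continuous_at_imp_continuous_on has_derivative_continuous)

lemma entire_imp_borel [measurable_dest]: "entire f \<Longrightarrow> f \<in> borel_measurable borel"
  by (intro borel_measurable_continuous_onI entire_imp_continuous)

lemma entire_imp_holomorphic_on_line:
  assumes "entire f"
  shows "(\<lambda>\<zeta>. f (b + \<zeta> *s v)) holomorphic_on S"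
    and "(f has_derivative D) (at b) \<Longrightarrow> ((\<lambda>\<zeta>. f (b + \<zeta> *s v)) has_field_derivative D v) (at 0)"
proof -
  have der: "((\<lambda>\<zeta>. f (b + \<zeta> *s v)) has_field_derivative D v) (at \<zeta>)"
    if D: "(f has_derivative D) (at (b + \<zeta> *s v))" for D \<zeta>
  proof -
    from assms obtain D' where D': "(f has_derivative D') (at (b + \<zeta> *s v))" "\<And>c v. D' (c *s v) = c * D' v"
      unfolding entire_def by blast
    have "D = D'" using has_derivative_unique[OF D D'(1)] .
    have "((\<lambda>\<zeta>. b + \<zeta> *s v) has_derivative (\<lambda>\<zeta>. \<zeta> *s v)) (at \<zeta>)"
    proof -
      have "linear (\<lambda>\<zeta>::complex. \<zeta> *s v)"
        by (rule linearI) (simp_all add: vec_eq_iff algebra_simps)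
      then have "((\<lambda>\<zeta>. \<zeta> *s v) has_derivative (\<lambda>\<zeta>. \<zeta> *s v)) (at \<zeta>)"
        by (intro bounded_linear_imp_has_derivative) (simp add: linear_conv_bounded_linear)
      then show ?thesis by (auto intro!: derivative_eq_intros)
    qed
    note comp = has_derivative_compose[OF this D]
    have "(\<lambda>\<zeta>. D (\<zeta> *s v)) = (*) (D v)"
      by (rule ext) (simp add: \<open>D = D'\<close> D'(2))
    with comp show ?thesis
      by (simp only: has_field_derivative_def)
  qed
  show "(\<lambda>\<zeta>. f (b + \<zeta> *s v)) holomorphic_on S"
  proof (rule holomorphic_on_subset[OF _ subset_UNIV], subst holomorphic_on_open)
    show "\<forall>\<zeta>\<in>UNIV. \<exists>d. ((\<lambda>\<zeta>. f (b + \<zeta> *s v)) has_field_derivative d) (at \<zeta>)"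
    proof
      fix \<zeta>
      obtain D where "(f has_derivative D) (at (b + \<zeta> *s v))"
        using assms unfolding entire_def by blast
      from der[OF this] show "\<exists>d. ((\<lambda>\<zeta>. f (b + \<zeta> *s v)) has_field_derivative d) (at \<zeta>)" ..
    qed
  qed simp
  show "((\<lambda>\<zeta>. f (b + \<zeta> *s v)) has_field_derivative D v) (at 0)" if "(f has_derivative D) (at b)"
    using der[of D 0] that by simp
qed

lemma entire_add: "entire f \<Longrightarrow> entire g \<Longrightarrow> entire (\<lambda>z. f z + g z)"
  unfolding entire_def
proof safe
  fix z
  assume "\<forall>z. \<exists>D. (f has_derivative D) (at z) \<and> (\<forall>c v. D (c *s v) = c * D v)"
    "\<forall>z. \<exists>D. (g has_derivative D) (at z) \<and> (\<forall>c v. D (c *s v) = c * D v)"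
  then obtain D E where "(f has_derivative D) (at z)" "\<forall>c v. D (c *s v) = c * D v"
    "(g has_derivative E) (at z)" "\<forall>c v. E (c *s v) = c * E v" by metis
  then show "\<exists>D. ((\<lambda>z. f z + g z) has_derivative D) (at z) \<and> (\<forall>c v. D (c *s v) = c * D v)"
    by (intro exI[of _ "\<lambda>v. D v + E v"]) (simp add: has_derivative_add distrib_left)
qed

lemma entire_const: "entire (\<lambda>z. c)"
  unfolding entire_def by (intro allI exI[of _ "\<lambda>v. 0"]) simp

lemma entire_cmult: "entire f \<Longrightarrow> entire (\<lambda>z. c * f z)"
  unfolding entire_def
proof safe
  fix z
  assume "\<forall>z. \<exists>D. (f has_derivative D) (at z) \<and> (\<forall>c v. D (c *s v) = c * D v)"
  then obtain D where "(f has_derivative D) (at z)" "\<forall>c v. D (c *s v) = c * D v" by metis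
  then show "\<exists>D. ((\<lambda>z. c * f z) has_derivative D) (at z) \<and> (\<forall>c v. D (c *s v) = c * D v)"
    by (intro exI[of _ "\<lambda>v. c * D v"]) (simp add: has_derivative_mult_right)
qed

lemma entire_sum: "(\<And>i. i \<in> A \<Longrightarrow> entire (f i)) \<Longrightarrow> entire (\<lambda>z. \<Sum>i\<in>A. f i z)"
  by (induction A rule: infinite_finite_induct) (auto intro: entire_const entire_add)

lemma entire_compose_smult:
  assumes "entire f"
  shows "entire (\<lambda>z. f (c *s z))"
  unfolding entire_def
proof
  fix z
  from assms obtain D where D: "(f has_derivative D) (at (c *s z))" "\<forall>c v. D (c *s v) = c * D v"
    unfolding entire_def by metis
  have "((\<lambda>z. c *s z) has_derivative (\<lambda>z. c *s z)) (at z)"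
    using linear_vector_smult[of c] by (intro bounded_linear_imp_has_derivative) (simp add: linear_conv_bounded_linear)
  from has_derivative_compose[OF this D(1)]
  show "\<exists>D. ((\<lambda>z. f (c *s z)) has_derivative D) (at z) \<and> (\<forall>c v. D (c *s v) = c * D v)"
    using D(2) by (intro exI[of _ "\<lambda>v. D (c *s v)"]) (simp add: mult.left_commute)
qed

lemma entire_exp_cdot:
  fixes a :: "complex ^ 'n"
  shows "entire (\<lambda>z. exp (c * cdot z a))"
  unfolding entire_def
proof
  fix z :: "complex ^ 'n"
  have "linear (\<lambda>z. cdot z a)"
    by (rule linearI) (simp_all add: cdot_def algebra_simps sum.distrib scaleR_sum_right)
  then have "((\<lambda>z. cdot z a) has_derivative (\<lambda>v. cdot v a)) (at z)"
    by (intro bounded_linear_imp_has_derivative) (simp add: linear_conv_bounded_linear)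
  then have "((\<lambda>z. exp (c * cdot z a)) has_derivative (\<lambda>v. exp (c * cdot z a) * (c * cdot v a))) (at z)"
    by (rule has_derivative_compose[OF has_derivative_mult_right DERIV_exp[THEN has_field_derivative_imp_has_derivative]])
  then show "\<exists>D. ((\<lambda>z. exp (c * cdot z a)) has_derivative D) (at z) \<and> (\<forall>c v. D (c *s v) = c * D v)"
    by (intro exI[of _ "\<lambda>v. exp (c * cdot z a) * (c * cdot v a)"]) (simp add: cdot_smult_left mult_ac)
qed

lemma lborel_integral_translate:
  fixes f :: "'a::euclidean_space \<Rightarrow> 'b::{banach, second_countable_topology}"
  assumes [measurable]: "f \<in> borel_measurable borel"
  shows "(LINT x|lborel. f (x + b)) = (LINT x|lborel. f x)"
    and "integrable lborel (\<lambda>x. f (x + b)) \<longleftrightarrow> integrable lborel f"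
proof -
  have eq: "lborel = distr lborel borel ((+) b)" by (rule lborel_distr_plus[symmetric])
  show "(LINT x|lborel. f (x + b)) = (LINT x|lborel. f x)"
    by (subst (2) eq) (simp add: integral_distr add.commute)
  show "integrable lborel (\<lambda>x. f (x + b)) \<longleftrightarrow> integrable lborel f"
    by (subst (2) eq) (simp add: integrable_distr_eq add.commute)
qed

text \<open>
  With \<open>b = a / c\<close>, the translation \<open>w = v + b\<close> cancels the antiholomorphic part \<open>a \<cdot> cnj v\<close> of
  the exponent. What remains besides the radial Gaussian is an entire function of \<open>v\<close> with value
  \<open>f b\<close> at the origin, so that the mean value property applies. Reproducing kernel, Toeplitz
  operators and heat transforms are all instances of this formula.
\<close>

proposition gaussian_reproducing:
  fixes f :: "complex ^ 'n \<Rightarrow> complex"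
  assumes c: "Re c > 0" and f: "entire f"
    and int: "integrable lborel (\<lambda>w. f w * exp (cdot a w / 2 - c * of_real ((norm w)\<^sup>2) / 2))"
  shows "(LINT w|lborel. f w * exp (cdot a w / 2 - c * of_real ((norm w)\<^sup>2) / 2))
           = (2 * of_real pi / c) ^ CARD('n) * f ((1 / c) *s a)"
proof -
  \<comment> \<open>The antiholomorphic part of the exponent vanishes exactly for this centre.\<close>
  define b where "b = (1 / c) *s a"
  have a: "a = c *s b" using c by (auto simp: b_def vec_eq_iff)
  let ?g = "\<lambda>w. f w * exp (cdot a w / 2 - c * of_real ((norm w)\<^sup>2) / 2)"
  let ?F = "\<lambda>v. f (v + b) * exp (- (c / 2) * cdot v b)"
  let ?W = "\<lambda>v :: complex ^ 'n. exp (- c * of_real ((norm v)\<^sup>2) / 2)"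
  have [measurable]: "f \<in> borel_measurable borel" using f by measurable
  have "continuous_on UNIV (\<lambda>w. exp (cdot a w / 2 - c * of_real ((norm w)\<^sup>2) / 2))"
    by (intro continuous_intros) auto
  then have [measurable]: "(\<lambda>w. exp (cdot a w / 2 - c * of_real ((norm w)\<^sup>2) / 2)) \<in> borel_measurable borel"
    by (rule borel_measurable_continuous_onI)
  have shift: "?g (v + b) = ?F v * ?W v" for v
  proof -
    have "cdot a (v + b) / 2 - c * of_real ((norm (v + b))\<^sup>2) / 2 = - (c / 2) * cdot v b - c * of_real ((norm v)\<^sup>2) / 2"
      unfolding cdot_self[symmetric] a
      by (simp add: cdot_add_left cdot_add_right cdot_smult_left field_simps)
    then show ?thesis by (simp add: mult.assoc flip: exp_add)
  qed
  have "(LINT w|lborel. ?g w) = (LINT v|lborel. ?g (v + b))"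
    by (rule lborel_integral_translate(1)[symmetric]) measurable
  also have "\<dots> = (LINT v|lborel. ?F v * ?W v)" by (simp only: shift)
  also have "\<dots> = ?F 0 * (LINT v|lborel. ?W v)"
  proof (rule rotation_invariant_mean_value)
    show "continuous_on UNIV ?F"
      by (intro continuous_intros continuous_on_compose2[OF entire_imp_continuous[OF f, of UNIV]]) auto
    show "(\<lambda>\<zeta>. ?F (\<zeta> *s v)) holomorphic_on UNIV" for v
      unfolding cdot_smult_left add.commute[of _ b]
      by (intro holomorphic_intros entire_imp_holomorphic_on_line f)
    show "?W \<in> borel_measurable borel" by simp
    show "?W (z *s v) = ?W v" if "cmod z = 1" for z v using that by (simp add: norm_vector_smult)
    have "integrable lborel (\<lambda>v. ?g (v + b))"
      by (subst lborel_integral_translate(2)) (use int in measurable)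
    then show "integrable lborel (\<lambda>v. ?F v * ?W v)" by (simp only: shift)
  qed
  also have "\<dots> = (2 * of_real pi / c) ^ CARD('n) * f ((1 / c) *s a)"
    by (simp only: complex_gaussian_integral(2)[OF c]) (simp add: b_def cdot_def)
  finally show ?thesis .
qed

section \<open>The Bargmann space\<close>

definition gauss_weight :: "complex ^ 'n \<Rightarrow> real" where
  "gauss_weight z = exp (- (norm z)\<^sup>2 / 2) / (2 * pi) ^ CARD('n)"

lemma gauss_weight_pos: "gauss_weight z > 0"
  by (simp add: gauss_weight_def)

lemma gauss_weight_measurable [measurable]: "gauss_weight \<in> borel_measurable borel"
  unfolding gauss_weight_def by measurable

lemma gauss_measure_density: "gauss_measure = density lborel (\<lambda>z. ennreal (gauss_weight z))"
  by (simp add: gauss_measure_def gauss_weight_def)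

lemma sets_gauss_measure [measurable_cong, simp]: "sets gauss_measure = sets borel"
  and space_gauss_measure [simp]: "space gauss_measure = UNIV"
  by (simp_all add: gauss_measure_density)

lemma borel_measurable_gauss_measure [simp]: "f \<in> borel_measurable gauss_measure \<longleftrightarrow> f \<in> borel_measurable borel"
  by (simp add: gauss_measure_density)

lemma gauss_integral:
  fixes f :: "complex ^ 'n \<Rightarrow> 'b::{banach, second_countable_topology}"
  assumes "f \<in> borel_measurable borel"
  shows "(LINT z|gauss_measure. f z) = (LINT z|lborel. gauss_weight z *\<^sub>R f z)"
    and "integrable gauss_measure f \<longleftrightarrow> integrable lborel (\<lambda>z. gauss_weight z *\<^sub>R f z)"
  unfolding gauss_measure_density using assms
  by (simp_all add: integral_density integrable_density less_imp_le[OF gauss_weight_pos])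

lemma real_gaussian_integrable:
  assumes "r > 0"
  shows "integrable lborel (\<lambda>v :: complex ^ 'n. exp (- r * (norm v)\<^sup>2))"
proof -
  have "integrable lborel (\<lambda>v :: complex ^ 'n. norm (exp (- of_real (2 * r) * of_real ((norm v)\<^sup>2) / 2) :: complex))"
    using assms by (intro integrable_norm complex_gaussian_integral) simp
  then show ?thesis by simp
qed

lemma integrable_gaussian_bound:
  fixes f :: "complex ^ 'n \<Rightarrow> 'b::{banach, second_countable_topology}"
  assumes f: "f \<in> borel_measurable borel" and r: "r > 0"
    and bound: "\<And>z. norm (f z) \<le> C * exp (b * norm z - r * (norm z)\<^sup>2)"
  shows "integrable lborel f"
proof (rule Bochner_Integration.integrable_bound)
  show "integrable lborel (\<lambda>z :: complex ^ 'n. C * exp (b\<^sup>2 / (2 * r)) * exp (- (r / 2) * (norm z)\<^sup>2))"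
    using r by (intro integrable_mult_right real_gaussian_integrable) auto
  have "C \<ge> 0"
    using order_trans[OF norm_ge_zero bound[of 0]] by simp
  have "norm (f z) \<le> C * exp (b\<^sup>2 / (2 * r)) * exp (- (r / 2) * (norm z)\<^sup>2)" for z
  proof -
    have "0 \<le> (b - r * norm z)\<^sup>2 / (2 * r)" using r by simp
    also have "\<dots> = b\<^sup>2 / (2 * r) - b * norm z + r / 2 * (norm z)\<^sup>2"
      using r by (simp add: power2_eq_square field_simps)
    finally have "b * norm z - r * (norm z)\<^sup>2 \<le> b\<^sup>2 / (2 * r) + - (r / 2) * (norm z)\<^sup>2"
      by simp
    then have "exp (b * norm z - r * (norm z)\<^sup>2) \<le> exp (b\<^sup>2 / (2 * r) + - (r / 2) * (norm z)\<^sup>2)"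
      by simp
    then have "C * exp (b * norm z - r * (norm z)\<^sup>2) \<le> C * (exp (b\<^sup>2 / (2 * r)) * exp (- (r / 2) * (norm z)\<^sup>2))"
      unfolding exp_add[symmetric] by (rule mult_left_mono) fact
    with bound[of z] show ?thesis by (simp add: mult.assoc)
  qed
  then show "AE z in lborel. norm (f z) \<le> norm (C * exp (b\<^sup>2 / (2 * r)) * exp (- (r / 2) * (norm z)\<^sup>2))"
    using \<open>C \<ge> 0\<close> by (simp add: abs_mult)
qed (use f in simp)

lemma L2_gaussI:
  assumes "f \<in> borel_measurable borel" "integrable gauss_measure (\<lambda>z. (cmod (f z))\<^sup>2)"
  shows "f \<in> L2_gauss"
  using assms by (simp add: L2_gauss_def)

lemma L2_gaussD:
  assumes "f \<in> L2_gauss"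
  shows "f \<in> borel_measurable borel" "integrable gauss_measure (\<lambda>z. (cmod (f z))\<^sup>2)"
  using assms by (simp_all add: L2_gauss_def)

lemma bargmannD:
  assumes "f \<in> bargmann"
  shows "entire f" "f \<in> L2_gauss" "f \<in> borel_measurable borel"
  using assms by (simp_all add: bargmann_def L2_gaussD)

lemma mult_le_sum_squares: "x * y \<le> x\<^sup>2 + y\<^sup>2" for x y :: real
  using sum_squares_bound[of x y] sum_power2_ge_zero[of x y] by linarith

lemma norm_add_power2_le: "(norm (x + y))\<^sup>2 \<le> 2 * (norm x)\<^sup>2 + 2 * (norm y)\<^sup>2"
proof -
  have "(norm (x + y))\<^sup>2 \<le> (norm x + norm y)\<^sup>2"
    by (intro power_mono norm_triangle_ineq) simp
  also have "\<dots> \<le> 2 * (norm x)\<^sup>2 + 2 * (norm y)\<^sup>2"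
    using sum_squares_bound[of "norm x" "norm y"] by (simp add: power2_sum)
  finally show ?thesis .
qed

lemma borel_measurable_cnj [measurable]: "cnj \<in> borel_measurable borel"
  by (intro borel_measurable_continuous_onI continuous_intros)

lemma L2_gauss_mult_integrable:
  assumes "f \<in> L2_gauss" "h \<in> L2_gauss"
  shows "integrable gauss_measure (\<lambda>z. f z * cnj (h z))"
proof (rule Bochner_Integration.integrable_bound)
  note [measurable] = assms[THEN L2_gaussD(1)]
  show "integrable gauss_measure (\<lambda>z. (cmod (f z))\<^sup>2 + (cmod (h z))\<^sup>2)"
    using assms[THEN L2_gaussD(2)] by simp
  have "cmod (f z * cnj (h z)) \<le> (cmod (f z))\<^sup>2 + (cmod (h z))\<^sup>2" for z
    by (simp add: norm_mult mult_le_sum_squares)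
  then show "AE z in gauss_measure. cmod (f z * cnj (h z)) \<le> norm ((cmod (f z))\<^sup>2 + (cmod (h z))\<^sup>2)"
    by simp
  show "(\<lambda>z. f z * cnj (h z)) \<in> borel_measurable gauss_measure" by simp
qed

lemma L2_gauss_add:
  assumes "f \<in> L2_gauss" "h \<in> L2_gauss"
  shows "(\<lambda>z. f z + h z) \<in> L2_gauss"
proof (rule L2_gaussI)
  note [measurable] = assms[THEN L2_gaussD(1)]
  show "(\<lambda>z. f z + h z) \<in> borel_measurable borel" by simp
  show "integrable gauss_measure (\<lambda>z. (cmod (f z + h z))\<^sup>2)"
  proof (rule Bochner_Integration.integrable_bound)
    show "integrable gauss_measure (\<lambda>z. 2 * (cmod (f z))\<^sup>2 + 2 * (cmod (h z))\<^sup>2)"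
      using assms[THEN L2_gaussD(2)] by simp
    show "AE z in gauss_measure. norm ((cmod (f z + h z))\<^sup>2) \<le> norm (2 * (cmod (f z))\<^sup>2 + 2 * (cmod (h z))\<^sup>2)"
      by (simp add: norm_add_power2_le)
    show "(\<lambda>z. (cmod (f z + h z))\<^sup>2) \<in> borel_measurable gauss_measure" by simp
  qed
qed

lemma L2_gauss_cmult: "f \<in> L2_gauss \<Longrightarrow> (\<lambda>z. c * f z) \<in> L2_gauss"
  by (rule L2_gaussI) (auto dest: L2_gaussD simp: norm_mult power_mult_distrib)

lemma L2_gauss_diff:
  assumes "f \<in> L2_gauss" "h \<in> L2_gauss"
  shows "(\<lambda>z. f z - h z) \<in> L2_gauss"
  using L2_gauss_add[OF assms(1) L2_gauss_cmult[OF assms(2), of "-1"]] by simp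

lemma bargmann_add: "f \<in> bargmann \<Longrightarrow> h \<in> bargmann \<Longrightarrow> (\<lambda>z. f z + h z) \<in> bargmann"
  by (simp add: bargmann_def entire_add L2_gauss_add)

lemma bargmann_cmult: "f \<in> bargmann \<Longrightarrow> (\<lambda>z. c * f z) \<in> bargmann"
  by (simp add: bargmann_def entire_cmult L2_gauss_cmult)

lemma bargmann_diff: "f \<in> bargmann \<Longrightarrow> h \<in> bargmann \<Longrightarrow> (\<lambda>z. f z - h z) \<in> bargmann"
  using bargmann_add[OF _ bargmann_cmult, of f h "-1"] by simp

lemma bargmann_kernel_measurable [measurable]:
  "(\<lambda>z. bargmann_kernel z a) \<in> borel_measurable borel" "bargmann_kernel a \<in> borel_measurable borel"
proof -
  have "continuous_on UNIV (\<lambda>z. exp (cdot z a / 2))" "continuous_on UNIV (\<lambda>z. exp (cdot a z / 2))"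
    by (intro continuous_intros; simp)+
  then show "(\<lambda>z. bargmann_kernel z a) \<in> borel_measurable borel" "bargmann_kernel a \<in> borel_measurable borel"
    unfolding bargmann_kernel_cdot[abs_def] by (auto intro: borel_measurable_continuous_onI)
qed

lemma gauss_weight_kernel:
  "gauss_weight w *\<^sub>R (exp ((1 - c) / 2 * of_real ((norm w)\<^sup>2)) * f w * bargmann_kernel a w)
     = 1 / (2 * of_real pi) ^ CARD('n) * (f w * exp (cdot a w / 2 - c * of_real ((norm w)\<^sup>2) / 2))"
  for w :: "complex ^ 'n"
proof -
  have "exp (cdot a w / 2 - c * of_real ((norm w)\<^sup>2) / 2) =
     exp (of_real (- (norm w)\<^sup>2 / 2)) * exp ((1 - c) / 2 * of_real ((norm w)\<^sup>2)) * exp (cdot a w / 2)"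
    unfolding exp_add[symmetric] by (simp add: field_simps)
  then show ?thesis
    unfolding gauss_weight_def scaleR_conv_of_real of_real_divide exp_of_real[symmetric] bargmann_kernel_cdot
    by (simp add: mult_ac)
qed

text \<open>
  This identifies the Toeplitz operator of the radial Gaussian symbol with parameter \<open>c\<close>: pairing
  with the kernel at \<open>a\<close> evaluates \<open>c\<^sup>-\<^sup>n f (z / c)\<close> at \<open>a\<close>.
\<close>

proposition gaussian_symbol_reproducing:
  fixes f :: "complex ^ 'n \<Rightarrow> complex"
  assumes c: "Re c > 0" and f: "entire f"
    and int: "integrable gauss_measure (\<lambda>w. exp ((1 - c) / 2 * of_real ((norm w)\<^sup>2)) * f w * bargmann_kernel a w)"
  shows "(LINT w|gauss_measure. exp ((1 - c) / 2 * of_real ((norm w)\<^sup>2)) * f w * bargmann_kernel a w)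
     = (1 / c) ^ CARD('n) * f ((1 / c) *s a)"
proof -
  have [measurable]: "f \<in> borel_measurable borel" using f by (rule entire_imp_borel)
  let ?h = "\<lambda>w. exp ((1 - c) / 2 * of_real ((norm w)\<^sup>2)) * f w * bargmann_kernel a w"
  have meas: "?h \<in> borel_measurable borel" by simp
  have "integrable lborel (\<lambda>w. (2 * of_real pi) ^ CARD('n) * (1 / (2 * of_real pi) ^ CARD('n) * (f w * exp (cdot a w / 2 - c * of_real ((norm w)\<^sup>2) / 2))))"
    using int gauss_integral(2)[OF meas] unfolding gauss_weight_kernel by (intro integrable_mult_right[of "(2 * of_real pi) ^ CARD('n)"]) blast
  then have int': "integrable lborel (\<lambda>w. f w * exp (cdot a w / 2 - c * of_real ((norm w)\<^sup>2) / 2))"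
    by (simp only: mult.assoc[symmetric]) simp
  have "(LINT w|gauss_measure. ?h w) = 1 / (2 * of_real pi) ^ CARD('n) * ((2 * of_real pi / c) ^ CARD('n) * f ((1 / c) *s a))"
    unfolding gauss_integral(1)[OF meas] gauss_weight_kernel integral_mult_right_zero gaussian_reproducing[OF c f int'] ..
  then show ?thesis by (simp add: power_divide)
qed

text \<open>
  The rate \<open>1/8\<close> leaves room below the critical rate \<open>1/4\<close>, at which the square of the growth
  would cancel the Gaussian density.
\<close>

lemma L2_gauss_growth:
  assumes g[measurable]: "g \<in> borel_measurable borel"
    and bound: "\<And>z. cmod (g z) \<le> C * exp ((norm z)\<^sup>2 / 8)"
  shows "(\<lambda>z. g z * bargmann_kernel z a) \<in> L2_gauss"
proof (rule L2_gaussI)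
  show "integrable gauss_measure (\<lambda>z. (cmod (g z * bargmann_kernel z a))\<^sup>2)"
  proof (subst gauss_integral(2), simp, rule integrable_gaussian_bound)
    show "norm (gauss_weight z *\<^sub>R (cmod (g z * bargmann_kernel z a))\<^sup>2)
       \<le> C\<^sup>2 / (2 * pi) ^ CARD('a) * exp (norm a * norm z - 1 / 4 * (norm z)\<^sup>2)" for z
    proof -
      have "inner z a \<le> norm a * norm z"
        using norm_cauchy_schwarz[of z a] by (simp add: mult.commute)
      then have "(cmod (bargmann_kernel z a))\<^sup>2 \<le> exp (norm a * norm z)"
        by (simp add: norm_bargmann_kernel flip: exp_double)
      moreover have "(cmod (g z))\<^sup>2 \<le> C\<^sup>2 * exp ((norm z)\<^sup>2 / 4)"
        using power_mono[OF bound[of z], of 2] by (simp add: power_mult_distrib flip: exp_double)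
      ultimately have "(cmod (g z * bargmann_kernel z a))\<^sup>2 \<le> (C\<^sup>2 * exp ((norm z)\<^sup>2 / 4)) * exp (norm a * norm z)"
        by (simp add: norm_mult power_mult_distrib mult_mono)
      then have "gauss_weight z * (cmod (g z * bargmann_kernel z a))\<^sup>2 \<le> gauss_weight z * ((C\<^sup>2 * exp ((norm z)\<^sup>2 / 4)) * exp (norm a * norm z))"
        using gauss_weight_pos[of z] by (intro mult_left_mono) auto
      also have "\<dots> = C\<^sup>2 / (2 * pi) ^ CARD('a) * (exp (- (norm z)\<^sup>2 / 2) * exp ((norm z)\<^sup>2 / 4) * exp (norm a * norm z))"
        by (simp add: gauss_weight_def)
      also have "exp (- (norm z)\<^sup>2 / 2) * exp ((norm z)\<^sup>2 / 4) * exp (norm a * norm z) = exp (norm a * norm z - 1 / 4 * (norm z)\<^sup>2)"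
        unfolding exp_add[symmetric] by simp
      finally show ?thesis using gauss_weight_pos[of z] by simp
    qed
  qed simp_all
qed simp

lemma bargmann_kernel_L2: "(\<lambda>z. bargmann_kernel z a) \<in> L2_gauss"
  using L2_gauss_growth[of "\<lambda>z. 1" 1 a] by simp

lemma bargmann_kernel_in_bargmann: "(\<lambda>z. bargmann_kernel z a) \<in> bargmann"
  using entire_exp_cdot[of "1 / 2" a] bargmann_kernel_L2[of a]
  by (simp add: bargmann_def bargmann_kernel_cdot)

proposition bargmann_reproducing:
  assumes f: "f \<in> bargmann"
  shows "L2_inner f (\<lambda>z. bargmann_kernel z a) = f a"
proof -
  have "integrable gauss_measure (\<lambda>w. exp ((1 - 1) / 2 * of_real ((norm w)\<^sup>2)) * f w * bargmann_kernel a w)"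
    using L2_gauss_mult_integrable[OF bargmannD(2)[OF f] bargmann_kernel_L2[of a]] by (simp add: cnj_bargmann_kernel)
  from gaussian_symbol_reproducing[OF _ bargmannD(1)[OF f] this] show ?thesis
    by (simp add: L2_inner_def cnj_bargmann_kernel)
qed

text \<open>
  A locally uniform bound in terms of the norm is all that the convergence arguments below require,
  so the product in the reproducing formula is estimated by a sum of squares.
\<close>

lemma bargmann_pointwise_bound:
  assumes f: "f \<in> bargmann"
  shows "cmod (f a) \<le> (LINT z|gauss_measure. (cmod (f z))\<^sup>2) + exp ((norm a)\<^sup>2 / 2)"
proof -
  let ?K = "\<lambda>z. bargmann_kernel z a"
  note L2 = bargmannD(2)[OF f] bargmann_kernel_L2[of a]
  have "complex_of_real (LINT z|gauss_measure. (cmod (?K z))\<^sup>2) = L2_inner ?K ?K"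
    unfolding L2_inner_def by (simp only: integral_complex_of_real[symmetric] complex_norm_square)
  also have "\<dots> = of_real (exp ((norm a)\<^sup>2 / 2))"
    unfolding bargmann_reproducing[OF bargmann_kernel_in_bargmann]
    by (simp add: bargmann_kernel_cdot cdot_self exp_of_real del: of_real_power) (simp flip: exp_of_real)
  finally have K: "(LINT z|gauss_measure. (cmod (?K z))\<^sup>2) = exp ((norm a)\<^sup>2 / 2)"
    by (simp only: of_real_eq_iff)
  have "cmod (f a) = cmod (LINT z|gauss_measure. f z * cnj (?K z))"
    using bargmann_reproducing[OF f, of a] by (simp add: L2_inner_def)
  also have "\<dots> \<le> (LINT z|gauss_measure. cmod (f z * cnj (?K z)))"
    by (rule integral_norm_bound)
  also have "\<dots> \<le> (LINT z|gauss_measure. (cmod (f z))\<^sup>2 + (cmod (?K z))\<^sup>2)"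
  proof (rule integral_mono)
    show "cmod (f z * cnj (?K z)) \<le> (cmod (f z))\<^sup>2 + (cmod (?K z))\<^sup>2" for z
      by (simp add: norm_mult mult_le_sum_squares)
  qed (intro integrable_norm Bochner_Integration.integrable_add L2_gauss_mult_integrable L2 L2[THEN L2_gaussD(2)])+
  also have "\<dots> = (LINT z|gauss_measure. (cmod (f z))\<^sup>2) + exp ((norm a)\<^sup>2 / 2)"
    using L2[THEN L2_gaussD(2)] by (simp add: K)
  finally show ?thesis .
qed

lemma bargmann_eqI:
  assumes "p \<in> bargmann" "q \<in> bargmann" and orth: "\<forall>h\<in>bargmann. L2_inner (\<lambda>z. p z - q z) h = 0"
  shows "p = q"
proof
  fix a
  have "p a - q a = L2_inner (\<lambda>z. p z - q z) (\<lambda>z. bargmann_kernel z a)"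
    using bargmann_reproducing[OF bargmann_diff[OF assms(1,2)]] by simp
  also have "\<dots> = 0" using orth bargmann_kernel_in_bargmann by blast
  finally show "p a = q a" by simp
qed

section \<open>The projection is determined by the kernels\<close>

lemma sigma_finite_gauss_measure: "sigma_finite_measure (gauss_measure :: (complex ^ 'n) measure)"
proof -
  have "integrable lborel (gauss_weight :: complex ^ 'n \<Rightarrow> real)"
    by (rule integrable_gaussian_bound[where r="1 / 2" and b=0 and C="1 / (2 * pi) ^ CARD('n)"])
       (simp_all, simp add: gauss_weight_def)
  then have "integrable gauss_measure (\<lambda>z :: complex ^ 'n. 1 :: real)"
    by (subst gauss_integral(2)) simp_all
  then have "emeasure gauss_measure (space (gauss_measure :: (complex ^ 'n) measure)) \<noteq> (\<infinity> :: ennreal)"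
    using integrable_iff_bounded[of gauss_measure "\<lambda>z :: complex ^ 'n. 1 :: real"] by (simp add: less_top)
  then show ?thesis
    using finite_measureI finite_measure.axioms(1) by blast
qed

lemma gauss_kernel_mass:
  fixes z :: "complex ^ 'n"
  shows "(\<integral>\<^sup>+w. exp ((norm w)\<^sup>2 / 2 - (norm (z - w))\<^sup>2 / 4) \<partial>gauss_measure)
     = (\<integral>\<^sup>+v. exp (- (norm (v :: complex ^ 'n))\<^sup>2 / 4) / (2 * pi) ^ CARD('n) \<partial>lborel)"
proof -
  have "(\<integral>\<^sup>+w. exp ((norm w)\<^sup>2 / 2 - (norm (z - w))\<^sup>2 / 4) \<partial>gauss_measure)
     = (\<integral>\<^sup>+w. gauss_weight w * exp ((norm w)\<^sup>2 / 2 - (norm (z - w))\<^sup>2 / 4) \<partial>lborel)"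
    unfolding gauss_measure_density
    by (subst nn_integral_density) (simp_all add: ennreal_mult' less_imp_le[OF gauss_weight_pos])
  also have "\<dots> = (\<integral>\<^sup>+w. exp (- (norm (z + (-1) *\<^sub>R w))\<^sup>2 / 4) / (2 * pi) ^ CARD('n) \<partial>lborel)"
  proof (intro nn_integral_cong arg_cong[where f=ennreal])
    fix w :: "complex ^ 'n"
    have "exp (- (norm w)\<^sup>2 / 2) * exp ((norm w)\<^sup>2 / 2 - (norm (z - w))\<^sup>2 / 4) = exp (- (norm (z - w))\<^sup>2 / 4)"
      unfolding exp_add[symmetric] by simp
    then show "gauss_weight w * exp ((norm w)\<^sup>2 / 2 - (norm (z - w))\<^sup>2 / 4)
        = exp (- (norm (z + (-1) *\<^sub>R w))\<^sup>2 / 4) / (2 * pi) ^ CARD('n)"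
      by (simp add: gauss_weight_def)
  qed
  also have "\<dots> = (\<integral>\<^sup>+v. exp (- (norm (v :: complex ^ 'n))\<^sup>2 / 4) / (2 * pi) ^ CARD('n) \<partial>lborel)"
    by (subst nn_integral_lborel_affine_unit) simp_all
  finally show ?thesis .
qed

lemma gauss_kernel_mass_finite:
  "(\<integral>\<^sup>+v. exp (- (norm (v :: complex ^ 'n))\<^sup>2 / 4) / (2 * pi) ^ CARD('n) \<partial>lborel) < \<infinity>"
proof -
  have "integrable lborel (\<lambda>v :: complex ^ 'n. exp (- (1 / 4) * (norm v)\<^sup>2) / (2 * pi) ^ CARD('n))"
    by (intro integrable_divide real_gaussian_integrable) simp
  then show ?thesis
    by (simp add: integrable_iff_bounded)
qed

text \<open>
  The weight attached to each square integrates over the other variable to a constant, since against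
  the Gaussian density it is a translated Gaussian. This makes the kernel integrable against any
  two functions in \<open>L\<^sup>2\<close>, although the kernel itself is unbounded.
\<close>

lemma kernel_product_bound:
  "cmod (a * b * bargmann_kernel w z) \<le> (cmod a)\<^sup>2 * exp ((norm w)\<^sup>2 / 2 - (norm (z - w))\<^sup>2 / 4)
      + (cmod b)\<^sup>2 * exp ((norm z)\<^sup>2 / 2 - (norm (w - z))\<^sup>2 / 4)"
proof -
  have "inner w z / 2 = (norm w)\<^sup>2 / 4 + (norm z)\<^sup>2 / 4 - (norm (z - w))\<^sup>2 / 4"
    by (simp add: dot_norm_neg[of w z] norm_minus_commute field_simps)
  then have "cmod (a * b * bargmann_kernel w z)
      = (cmod a * exp ((norm w)\<^sup>2 / 4)) * (cmod b * exp ((norm z)\<^sup>2 / 4)) * exp (- (norm (z - w))\<^sup>2 / 4)"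
    unfolding norm_mult norm_bargmann_kernel by (simp only: exp_add diff_conv_add_uminus) simp
  also have "\<dots> \<le> ((cmod a * exp ((norm w)\<^sup>2 / 4))\<^sup>2 + (cmod b * exp ((norm z)\<^sup>2 / 4))\<^sup>2) * exp (- (norm (z - w))\<^sup>2 / 4)"
    by (intro mult_right_mono mult_le_sum_squares) simp
  also have "\<dots> = (cmod a)\<^sup>2 * exp ((norm w)\<^sup>2 / 2 - (norm (z - w))\<^sup>2 / 4)
      + (cmod b)\<^sup>2 * exp ((norm z)\<^sup>2 / 2 - (norm (w - z))\<^sup>2 / 4)"
  proof -
    have "(exp (x / 4))\<^sup>2 * exp (- y / 4) = exp (x / 2 - y / 4)" for x y :: real
      unfolding exp_double[symmetric] exp_add[symmetric] by simp
    then show ?thesis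
      by (simp only: power_mult_distrib distrib_right mult.assoc norm_minus_commute[of w z])
  qed
  finally show ?thesis .
qed

lemma nn_integral_L2_gauss_finite:
  assumes "f \<in> L2_gauss"
  shows "(\<integral>\<^sup>+z. (cmod (f z))\<^sup>2 \<partial>gauss_measure) < \<infinity>"
  using L2_gaussD(2)[OF assms] by (simp add: integrable_iff_bounded)

lemma kernel_product_integrable:
  fixes u h :: "complex ^ 'n \<Rightarrow> complex"
  assumes u: "u \<in> L2_gauss" and h: "h \<in> L2_gauss"
  shows "integrable (gauss_measure \<Otimes>\<^sub>M gauss_measure) (\<lambda>(z, w). u z * cnj (h w) * bargmann_kernel w z)"
proof (rule integrableI_bounded)
  interpret G: sigma_finite_measure "gauss_measure :: (complex ^ 'n) measure"
    by (rule sigma_finite_gauss_measure)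
  interpret GG: pair_sigma_finite "gauss_measure :: (complex ^ 'n) measure" "gauss_measure :: (complex ^ 'n) measure" ..
  let ?E = "\<lambda>z w :: complex ^ 'n. exp ((norm w)\<^sup>2 / 2 - (norm (z - w))\<^sup>2 / 4)"
  note [measurable] = u[THEN L2_gaussD(1)] h[THEN L2_gaussD(1)]
  have "continuous_on UNIV (\<lambda>(z :: complex ^ 'n, w). bargmann_kernel w z)"
    unfolding split_def bargmann_kernel_cdot by (intro continuous_intros) simp
  then have [measurable]: "(\<lambda>(z :: complex ^ 'n, w). bargmann_kernel w z) \<in> borel_measurable (borel \<Otimes>\<^sub>M borel)"
    unfolding borel_prod by (rule borel_measurable_continuous_onI)
  show meas: "(\<lambda>(z, w). u z * cnj (h w) * bargmann_kernel w z) \<in> borel_measurable (gauss_measure \<Otimes>\<^sub>M gauss_measure)"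
    by measurable
  define \<kappa> where "\<kappa> = (\<integral>\<^sup>+v. exp (- (norm (v :: complex ^ 'n))\<^sup>2 / 4) / (2 * pi) ^ CARD('n) \<partial>lborel)"
  have mass: "(\<integral>\<^sup>+w. ?E z w \<partial>gauss_measure) = \<kappa>" for z
    unfolding \<kappa>_def by (rule gauss_kernel_mass)
  have "(\<integral>\<^sup>+x. norm (case x of (z, w) \<Rightarrow> u z * cnj (h w) * bargmann_kernel w z) \<partial>(gauss_measure \<Otimes>\<^sub>M gauss_measure))
     \<le> (\<integral>\<^sup>+(z, w). ennreal ((cmod (u z))\<^sup>2) * ?E z w + ennreal ((cmod (h w))\<^sup>2) * ?E w z \<partial>(gauss_measure \<Otimes>\<^sub>M gauss_measure))"
    using kernel_product_bound[of "u _" "cnj (h _)"]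
    by (intro nn_integral_mono) (auto simp: ennreal_mult'[symmetric] ennreal_plus[symmetric] simp del: ennreal_plus)
  also have "\<dots> = (\<integral>\<^sup>+(z, w). ennreal ((cmod (u z))\<^sup>2) * ?E z w \<partial>(gauss_measure \<Otimes>\<^sub>M gauss_measure))
      + (\<integral>\<^sup>+(z, w). ennreal ((cmod (h w))\<^sup>2) * ?E w z \<partial>(gauss_measure \<Otimes>\<^sub>M gauss_measure))"
    by (subst nn_integral_add[symmetric]) (auto simp: split_def)
  also have "(\<integral>\<^sup>+(z, w). ennreal ((cmod (u z))\<^sup>2) * ?E z w \<partial>(gauss_measure \<Otimes>\<^sub>M gauss_measure))
      = (\<integral>\<^sup>+z. \<integral>\<^sup>+w. ennreal ((cmod (u z))\<^sup>2) * ?E z w \<partial>gauss_measure \<partial>gauss_measure)"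
    by (subst G.nn_integral_fst[symmetric]) (auto simp: split_def)
  also have "\<dots> = (\<integral>\<^sup>+z. ennreal ((cmod (u z))\<^sup>2) \<partial>gauss_measure) * \<kappa>"
    by (subst nn_integral_cmult) (simp_all add: mass nn_integral_multc)
  also have "(\<integral>\<^sup>+(z, w). ennreal ((cmod (h w))\<^sup>2) * ?E w z \<partial>(gauss_measure \<Otimes>\<^sub>M gauss_measure))
      = (\<integral>\<^sup>+w. \<integral>\<^sup>+z. ennreal ((cmod (h w))\<^sup>2) * ?E w z \<partial>gauss_measure \<partial>gauss_measure)"
    by (subst GG.nn_integral_snd[symmetric]) (auto simp: split_def)
  also have "\<dots> = (\<integral>\<^sup>+w. ennreal ((cmod (h w))\<^sup>2) \<partial>gauss_measure) * \<kappa>"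
    by (subst nn_integral_cmult) (simp_all add: mass nn_integral_multc)
  also have "(\<integral>\<^sup>+z. ennreal ((cmod (u z))\<^sup>2) \<partial>gauss_measure) * \<kappa> + (\<integral>\<^sup>+w. ennreal ((cmod (h w))\<^sup>2) \<partial>gauss_measure) * \<kappa> < \<infinity>"
    using nn_integral_L2_gauss_finite[OF u] nn_integral_L2_gauss_finite[OF h] gauss_kernel_mass_finite[where 'n='n]
    by (simp add: \<kappa>_def ennreal_mult_less_top)
  finally show "(\<integral>\<^sup>+x. norm (case x of (z, w) \<Rightarrow> u z * cnj (h w) * bargmann_kernel w z) \<partial>(gauss_measure \<Otimes>\<^sub>M gauss_measure)) < \<infinity>" .
qed

text \<open>
  Write \<open>h\<close> by its reproducing formula and interchange the integrals: the inner integral is then the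
  pairing of \<open>u\<close> with a kernel.
\<close>

proposition orthogonal_to_kernels_imp_orthogonal:
  fixes u h :: "complex ^ 'n \<Rightarrow> complex"
  assumes u: "u \<in> L2_gauss" and orth: "\<And>a. L2_inner u (\<lambda>z. bargmann_kernel z a) = 0" and h: "h \<in> bargmann"
  shows "L2_inner u h = 0"
proof -
  interpret G: sigma_finite_measure "gauss_measure :: (complex ^ 'n) measure"
    by (rule sigma_finite_gauss_measure)
  interpret GG: pair_sigma_finite "gauss_measure :: (complex ^ 'n) measure" "gauss_measure :: (complex ^ 'n) measure" ..
  have cnj_h: "cnj (h z) = (LINT w|gauss_measure. cnj (h w) * bargmann_kernel w z)" for z
  proof -
    have "cnj (h z) = cnj (LINT w|gauss_measure. h w * cnj (bargmann_kernel w z))"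
      using bargmann_reproducing[OF h, of z] by (simp add: L2_inner_def)
    also have "\<dots> = (LINT w|gauss_measure. cnj (h w * cnj (bargmann_kernel w z)))"
      by (rule Bochner_Integration.integral_cnj[symmetric])
    finally show ?thesis by simp
  qed
  have "L2_inner u h = (LINT z|gauss_measure. LINT w|gauss_measure. u z * cnj (h w) * bargmann_kernel w z)"
    unfolding L2_inner_def mult.assoc integral_mult_right_zero
    by (intro Bochner_Integration.integral_cong refl arg_cong2[where f="(*)"] cnj_h)
  also have "\<dots> = (LINT w|gauss_measure. LINT z|gauss_measure. u z * cnj (h w) * bargmann_kernel w z)"
    by (rule GG.Fubini_integral[OF kernel_product_integrable[OF u bargmannD(2)[OF h]], symmetric])
  also have "\<dots> = (LINT w|gauss_measure. cnj (h w) * L2_inner u (\<lambda>z. bargmann_kernel z w))"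
    unfolding L2_inner_def cnj_bargmann_kernel integral_mult_right_zero[symmetric]
    by (intro Bochner_Integration.integral_cong refl) (simp add: mult_ac)
  also have "\<dots> = 0" by (simp add: orth)
  finally show ?thesis .
qed

corollary bargmann_proj_eqI:
  assumes f: "f \<in> L2_gauss" and p: "p \<in> bargmann"
    and eq: "\<And>a. L2_inner f (\<lambda>z. bargmann_kernel z a) = p a"
  shows "bargmann_proj f = p"
  unfolding bargmann_proj_def
proof (rule the_equality)
  have "L2_inner (\<lambda>z. f z - p z) (\<lambda>z. bargmann_kernel z a) = 0" for a
  proof -
    have "L2_inner (\<lambda>z. f z - p z) (\<lambda>z. bargmann_kernel z a)
        = L2_inner f (\<lambda>z. bargmann_kernel z a) - L2_inner p (\<lambda>z. bargmann_kernel z a)"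
      unfolding L2_inner_def left_diff_distrib
      by (intro Bochner_Integration.integral_diff L2_gauss_mult_integrable f bargmannD(2)[OF p] bargmann_kernel_L2)
    then show ?thesis by (simp add: eq bargmann_reproducing[OF p])
  qed
  then have orth: "\<forall>h\<in>bargmann. L2_inner (\<lambda>z. f z - p z) h = 0"
    using orthogonal_to_kernels_imp_orthogonal[OF L2_gauss_diff[OF f bargmannD(2)[OF p]]] by blast
  with p show "p \<in> bargmann \<and> (\<forall>h\<in>bargmann. L2_inner (\<lambda>z. f z - p z) h = 0)" ..
  fix q assume q: "q \<in> bargmann \<and> (\<forall>h\<in>bargmann. L2_inner (\<lambda>z. f z - q z) h = 0)"
  show "q = p"
  proof (rule bargmann_eqI)
    show "\<forall>h\<in>bargmann. L2_inner (\<lambda>z. q z - p z) h = 0"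
    proof
      fix h :: "complex ^ 'a \<Rightarrow> complex" assume h: "h \<in> bargmann"
      have "L2_inner (\<lambda>z. q z - p z) h = L2_inner (\<lambda>z. f z - p z) h - L2_inner (\<lambda>z. f z - q z) h"
        unfolding L2_inner_def using h q f p
        by (subst Bochner_Integration.integral_diff[symmetric])
           (simp_all add: L2_gauss_mult_integrable L2_gauss_diff bargmannD(2) flip: left_diff_distrib)
      then show "L2_inner (\<lambda>z. q z - p z) h = 0" using h q orth by simp
    qed
  qed (use p q in auto)
qed

section \<open>Rudin-Shapiro sums\<close>

text \<open>
  The Rudin-Shapiro pair: each sign pattern of length \<open>2\<^sup>k\<^sup>+\<^sup>1\<close> is the first pattern of length
  \<open>2\<^sup>k\<close> followed by the second one, or by its negative.
\<close>

fun rs_p :: "nat \<Rightarrow> nat \<Rightarrow> real" and rs_q :: "nat \<Rightarrow> nat \<Rightarrow> real" where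
  "rs_p 0 j = 1"
| "rs_p (Suc k) j = (if j < 2 ^ k then rs_p k j else rs_q k (j - 2 ^ k))"
| "rs_q 0 j = 1"
| "rs_q (Suc k) j = (if j < 2 ^ k then rs_p k j else - rs_q k (j - 2 ^ k))"

definition rs_sum_p :: "nat \<Rightarrow> (nat \<Rightarrow> complex) \<Rightarrow> complex" where
  "rs_sum_p k u = (\<Sum>j<2 ^ k. of_real (rs_p k j) * u j)"

definition rs_sum_q :: "nat \<Rightarrow> (nat \<Rightarrow> complex) \<Rightarrow> complex" where
  "rs_sum_q k u = (\<Sum>j<2 ^ k. of_real (rs_q k j) * u j)"

lemma rs_sign: "rs_p k j = 1 \<or> rs_p k j = -1" "rs_q k j = 1 \<or> rs_q k j = -1"
proof (induction k arbitrary: j)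
  case (Suc k)
  { case 1 then show ?case using Suc by simp }
  { case 2 then show ?case using Suc(1)[of j] Suc(2)[of "j - 2 ^ k"] by auto }
qed simp_all

lemma sum_lessThan_add:
  fixes f :: "nat \<Rightarrow> 'a::comm_monoid_add"
  shows "sum f {..<m + k} = sum f {..<m} + (\<Sum>j<k. f (j + m))"
  by (induction k) (simp_all add: ac_simps)

lemma rs_sum_Suc:
  "rs_sum_p (Suc k) u = rs_sum_p k u + rs_sum_q k (\<lambda>j. u (j + 2 ^ k))"
  "rs_sum_q (Suc k) u = rs_sum_p k u - rs_sum_q k (\<lambda>j. u (j + 2 ^ k))"
  unfolding rs_sum_p_def rs_sum_q_def power_Suc mult_2 sum_lessThan_add by (simp_all add: sum_negf)

lemma rs_sum_0 [simp]: "rs_sum_p 0 u = u 0" "rs_sum_q 0 u = u 0"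
  by (simp_all add: rs_sum_p_def rs_sum_q_def)

lemma rs_sum_cmult: "rs_sum_p k (\<lambda>j. c * u j) = c * rs_sum_p k u" "rs_sum_q k (\<lambda>j. c * u j) = c * rs_sum_q k u"
  by (simp_all add: rs_sum_p_def rs_sum_q_def sum_distrib_left mult_ac)

lemma complex_parallelogram: "(cmod (x + y))\<^sup>2 + (cmod (x - y))\<^sup>2 = 2 * (cmod x)\<^sup>2 + 2 * (cmod y)\<^sup>2"
  unfolding cmod_power2 by (simp add: power2_eq_square algebra_simps)

lemma rs_sum_const: "(cmod (rs_sum_p k (\<lambda>j. 1)))\<^sup>2 + (cmod (rs_sum_q k (\<lambda>j. 1)))\<^sup>2 = 2 ^ Suc k"
proof (induction k)
  case (Suc k)
  have "(cmod (rs_sum_p (Suc k) (\<lambda>j. 1)))\<^sup>2 + (cmod (rs_sum_q (Suc k) (\<lambda>j. 1)))\<^sup>2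
      = 2 * ((cmod (rs_sum_p k (\<lambda>j. 1)))\<^sup>2 + (cmod (rs_sum_q k (\<lambda>j. 1)))\<^sup>2)"
    unfolding rs_sum_Suc complex_parallelogram by simp
  then show ?case unfolding Suc by simp
qed simp

lemma rs_sum_const_bound: "cmod (rs_sum_p k (\<lambda>j. 1)) \<le> sqrt 2 ^ Suc k" "cmod (rs_sum_q k (\<lambda>j. 1)) \<le> sqrt 2 ^ Suc k"
proof -
  have "(sqrt 2 ^ Suc k)\<^sup>2 = ((sqrt 2)\<^sup>2) ^ Suc k"
    by (rule trans[OF power_even_eq[symmetric] power_mult])
  also have "(sqrt 2)\<^sup>2 = 2" by simp
  finally have eq: "(sqrt 2 ^ Suc k)\<^sup>2 = (2 :: real) ^ Suc k" .
  show "cmod (rs_sum_p k (\<lambda>j. 1)) \<le> sqrt 2 ^ Suc k"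
    by (rule power2_le_imp_le, unfold eq rs_sum_const[of k, symmetric]) simp_all
  show "cmod (rs_sum_q k (\<lambda>j. 1)) \<le> sqrt 2 ^ Suc k"
    by (rule power2_le_imp_le, unfold eq rs_sum_const[of k, symmetric]) simp_all
qed

text \<open>
  Cancellation survives slow variation. In the step from \<open>k\<close> to \<open>k + 1\<close> the second half of the
  sequence is compared with its own first value, and the change of base point costs only the
  Lipschitz bound times a sum with constant entries, which is already known to be small. The
  constants close up because \<open>4 \<le> 3 * sqrt 2\<close>.
\<close>

lemma rs_sum_lipschitz:
  assumes "\<And>i j. i \<le> j \<Longrightarrow> j < 2 ^ k \<Longrightarrow> cmod (u i - u j) \<le> L * real (j - i)" and "L \<ge> 0"
  shows "cmod (rs_sum_p k u - u 0 * rs_sum_p k (\<lambda>j. 1)) \<le> 2 * sqrt 2 ^ k * (L * 2 ^ k)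
       \<and> cmod (rs_sum_q k u - u 0 * rs_sum_q k (\<lambda>j. 1)) \<le> 2 * sqrt 2 ^ k * (L * 2 ^ k)"
  using assms(1)
proof (induction k arbitrary: u)
  case (Suc k)
  let ?v = "\<lambda>j. u (j + 2 ^ k)"
  let ?p = "rs_sum_p k u - u 0 * rs_sum_p k (\<lambda>j. 1)" and ?q = "rs_sum_q k ?v - ?v 0 * rs_sum_q k (\<lambda>j. 1)"
    and ?r = "(u (2 ^ k) - u 0) * rs_sum_q k (\<lambda>j. 1)" and ?M = "2 * sqrt 2 ^ k * (L * 2 ^ k)"
  have p: "cmod ?p \<le> ?M"
    by (rule Suc.IH[THEN conjunct1]) (use Suc.prems in auto)
  have q: "cmod ?q \<le> ?M"
  proof (rule Suc.IH[THEN conjunct2])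
    fix i j :: nat assume "i \<le> j" "j < 2 ^ k"
    then show "cmod (?v i - ?v j) \<le> L * real (j - i)"
      using Suc.prems[of "i + 2 ^ k" "j + 2 ^ k"] by simp
  qed
  have "cmod (u (2 ^ k) - u 0) \<le> L * 2 ^ k"
    using Suc.prems[of 0 "2 ^ k"] by (simp add: norm_minus_commute)
  then have r: "cmod ?r \<le> (L * 2 ^ k) * sqrt 2 ^ Suc k"
    unfolding norm_mult using rs_sum_const_bound(2)[of k] \<open>L \<ge> 0\<close> by (intro mult_mono) auto
  have four: "4 \<le> 3 * sqrt 2"
    by (rule power2_le_imp_le) (simp_all add: power_mult_distrib)
  have "2 * ?M + (L * 2 ^ k) * sqrt 2 ^ Suc k = (L * 2 ^ k) * sqrt 2 ^ k * (4 + sqrt 2)"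
    by (simp add: algebra_simps)
  also have "\<dots> \<le> (L * 2 ^ k) * sqrt 2 ^ k * (4 * sqrt 2)"
    using four \<open>L \<ge> 0\<close> by (intro mult_left_mono) auto
  also have "\<dots> = 2 * sqrt 2 ^ Suc k * (L * 2 ^ Suc k)"
    by simp
  finally have sum: "2 * ?M + (L * 2 ^ k) * sqrt 2 ^ Suc k \<le> 2 * sqrt 2 ^ Suc k * (L * 2 ^ Suc k)" .
  have eqs: "rs_sum_p (Suc k) u - u 0 * rs_sum_p (Suc k) (\<lambda>j. 1) = ?p + ?q + ?r"
    "rs_sum_q (Suc k) u - u 0 * rs_sum_q (Suc k) (\<lambda>j. 1) = ?p - ?q - ?r"
    unfolding rs_sum_Suc by (simp_all add: algebra_simps)
  have "cmod (?p + ?q + ?r) \<le> cmod ?p + cmod ?q + cmod ?r" "cmod (?p - ?q - ?r) \<le> cmod ?p + cmod ?q + cmod ?r"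
    by (smt (verit) norm_triangle_ineq norm_triangle_ineq4)+
  then show ?case
    unfolding eqs using p q r sum by (intro conjI) linarith+
qed (use \<open>L \<ge> 0\<close> in simp)

text \<open>
  The radial Gaussian symbol with parameter \<open>c = cis (2 * \<tau>)\<close> on the unit circle.
\<close>

definition circle_symbol :: "real \<Rightarrow> complex ^ 'n \<Rightarrow> complex" where
  "circle_symbol \<tau> z = exp ((1 - cis (2 * \<tau>)) / 2 * of_real ((norm z)\<^sup>2))"

lemma Re_circle_exponent: "Re ((1 - cis (2 * \<tau>)) / 2) = (sin \<tau>)\<^sup>2"
  using cos_double_sin[of \<tau>] by simp

lemma norm_exp_circle_exponent:
  assumes "0 \<le> \<tau>" "\<tau> \<le> 1 / 4" "0 \<le> x"
  shows "cmod (exp ((1 - cis (2 * \<tau>)) / 2 * of_real x)) \<le> exp (x / 16)"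
proof -
  have "\<bar>sin \<tau>\<bar> \<le> 1 / 4" using abs_sin_x_le_abs_x[of \<tau>] assms by simp
  then have "(sin \<tau>)\<^sup>2 \<le> (1 / 4)\<^sup>2" by (simp add: abs_le_square_iff[symmetric])
  then have "(sin \<tau>)\<^sup>2 * x \<le> 1 / 16 * x" using assms by (intro mult_right_mono) (simp_all add: power2_eq_square)
  moreover have "Re ((1 - cis (2 * \<tau>)) / 2 * of_real x) = (sin \<tau>)\<^sup>2 * x"
  proof -
    have "Re (w * of_real x) = Re w * x" for w by simp
    then show ?thesis by (simp only: Re_circle_exponent)
  qed
  ultimately have "Re ((1 - cis (2 * \<tau>)) / 2 * of_real x) \<le> x / 16" by linarith
  then show ?thesis unfolding norm_exp_eq_Re exp_le_cancel_iff .
qed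

lemma norm_cis_diff_le: "cmod (cis a - cis b) \<le> \<bar>a - b\<bar>"
proof (rule power2_le_imp_le)
  have "(cmod (cis a - cis b))\<^sup>2 = 2 - 2 * cos (a - b)"
  proof -
    have "(cmod (cis a - cis b))\<^sup>2 = ((sin a)\<^sup>2 + (cos a)\<^sup>2) + ((sin b)\<^sup>2 + (cos b)\<^sup>2) - 2 * (cos a * cos b + sin a * sin b)"
      unfolding cmod_power2 by (simp add: power2_eq_square algebra_simps del: sin_cos_squared_add sin_cos_squared_add2 sin_cos_squared_add3)
    then show ?thesis by (simp add: cos_diff)
  qed
  also have "\<dots> = (2 * sin ((a - b) / 2))\<^sup>2"
  proof -
    have "2 * ((a - b) / 2) = a - b" by simp
    from cos_double_sin[of "(a - b) / 2", unfolded this] show ?thesis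
      by (simp add: power_mult_distrib)
  qed
  also have "\<dots> \<le> (a - b)\<^sup>2"
    using abs_sin_x_le_abs_x[of "(a - b) / 2"] by (subst abs_le_square_iff[symmetric]) simp
  finally show "(cmod (cis a - cis b))\<^sup>2 \<le> \<bar>a - b\<bar>\<^sup>2" by simp
qed simp

lemma circle_exponent_lipschitz:
  assumes "0 \<le> \<sigma>" "\<sigma> \<le> 1 / 4" "0 \<le> \<tau>" "\<tau> \<le> 1 / 4" "0 \<le> x"
  shows "cmod (exp ((1 - cis (2 * \<sigma>)) / 2 * of_real x) - exp ((1 - cis (2 * \<tau>)) / 2 * of_real x)) \<le> x * exp (x / 16) * \<bar>\<sigma> - \<tau>\<bar>"
proof -
  let ?e = "\<lambda>t. (1 - cis (2 * t)) / 2 * of_real x"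
  have "cmod (exp (?e \<sigma>) - exp (?e \<tau>)) \<le> exp (x / 16) * cmod (?e \<sigma> - ?e \<tau>)"
  proof (rule field_differentiable_bound[where S="{z. Re z \<le> x / 16}" and f'=exp])
    have "exp (Re (?e t)) \<le> exp (x / 16)" if "0 \<le> t" "t \<le> 1 / 4" for t
      using norm_exp_circle_exponent[OF that \<open>0 \<le> x\<close>] by (simp only: norm_exp_eq_Re)
    then show "?e \<sigma> \<in> {z. Re z \<le> x / 16}" "?e \<tau> \<in> {z. Re z \<le> x / 16}"
      using assms by (simp_all only: exp_le_cancel_iff mem_Collect_eq)
    show "convex {z. Re z \<le> x / 16}" by (rule convex_halfspace_Re_le)
  qed (auto intro: DERIV_subset[OF DERIV_exp])
  also have "?e \<sigma> - ?e \<tau> = of_real (x / 2) * (cis (2 * \<tau>) - cis (2 * \<sigma>))"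
    by (simp add: field_simps)
  also have "cmod \<dots> \<le> x / 2 * \<bar>2 * \<tau> - 2 * \<sigma>\<bar>"
    unfolding norm_mult using norm_cis_diff_le[of "2 * \<tau>" "2 * \<sigma>"] assms by (intro mult_mono) auto
  also have "x / 2 * \<bar>2 * \<tau> - 2 * \<sigma>\<bar> = x * \<bar>\<sigma> - \<tau>\<bar>"
    by (simp add: abs_if)
  finally show ?thesis by (simp add: mult_ac)
qed

text \<open>
  An arithmetic progression of \<open>2\<^sup>k\<close> angles starting after \<open>\<alpha>\<close>, of total length \<open>1/8\<close>. The step is
  counted from one, so that every angle differs from \<open>\<alpha>\<close>; this keeps all poles of the functions
  \<open>t \<mapsto> tan (arctan t + x)\<close> used below finite.
\<close>

definition rs_angle :: "real \<Rightarrow> nat \<Rightarrow> nat \<Rightarrow> real" where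
  "rs_angle \<alpha> k j = \<alpha> + real (Suc j) / (8 * 2 ^ k)"

lemma rs_angle_bounds:
  assumes "0 \<le> \<alpha>" "\<alpha> \<le> 1 / 8" "j < 2 ^ k"
  shows "0 \<le> rs_angle \<alpha> k j" "rs_angle \<alpha> k j \<le> 1 / 4"
proof -
  have "real (Suc j) \<le> real (2 ^ k)" using assms by (intro of_nat_mono) simp
  then have "real (Suc j) / (8 * 2 ^ k) \<le> 1 / 8" by (simp add: field_simps)
  then show "rs_angle \<alpha> k j \<le> 1 / 4"
    unfolding rs_angle_def using assms by linarith
  show "0 \<le> rs_angle \<alpha> k j"
    unfolding rs_angle_def using assms by simp
qed

definition rs_symbol :: "real \<Rightarrow> nat \<Rightarrow> complex ^ 'n \<Rightarrow> complex" where
  "rs_symbol \<alpha> k z = rs_sum_p k (\<lambda>j. circle_symbol (rs_angle \<alpha> k j) z) / of_real (sqrt 2 ^ k)"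

text \<open>
  The summands vary along the progression with Lipschitz constant at most \<open>x exp (x / 16)\<close>, where
  \<open>x = |z|\<^sup>2\<close>, per unit of angle. As the progression has length \<open>1/8\<close>, whatever \<open>k\<close> is, this costs
  a factor of order \<open>1 + x\<close> in comparison with constant summands, and the room between the rates
  \<open>1/16\<close> and \<open>1/8\<close> absorbs it.
\<close>

lemma rs_symbol_bound:
  assumes \<alpha>: "0 \<le> \<alpha>" "\<alpha> \<le> 1 / 8"
  shows "cmod (rs_symbol \<alpha> k z) \<le> 4 * exp ((norm z)\<^sup>2 / 8)"
proof -
  define x where "x = (norm z)\<^sup>2"
  have x: "x \<ge> 0" by (simp add: x_def)
  let ?u = "\<lambda>j. exp ((1 - cis (2 * rs_angle \<alpha> k j)) / 2 * of_real x)"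
  let ?L = "x * exp (x / 16) / (8 * 2 ^ k)"
  have "cmod (?u i - ?u j) \<le> ?L * real (j - i)" if "i \<le> j" "j < 2 ^ k" for i j
  proof -
    have "\<bar>rs_angle \<alpha> k i - rs_angle \<alpha> k j\<bar> = real (j - i) / (8 * 2 ^ k)"
      using that by (simp add: rs_angle_def of_nat_diff abs_minus_commute flip: diff_divide_distrib)
    then show ?thesis
      using circle_exponent_lipschitz[OF rs_angle_bounds[OF \<alpha>] rs_angle_bounds[OF \<alpha>] x, of i k j k] that by simp
  qed
  from rs_sum_lipschitz[of k ?u ?L, OF this]
  have "cmod (rs_sum_p k ?u - ?u 0 * rs_sum_p k (\<lambda>j. 1)) \<le> 2 * sqrt 2 ^ k * (?L * 2 ^ k)"
    using x by simp
  moreover have "cmod (?u 0 * rs_sum_p k (\<lambda>j. 1)) \<le> exp (x / 16) * (sqrt 2 ^ Suc k)"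
    unfolding norm_mult using rs_sum_const_bound(1)[of k] norm_exp_circle_exponent[OF rs_angle_bounds[OF \<alpha>] x, of 0 k]
    by (intro mult_mono) auto
  ultimately have "cmod (rs_sum_p k ?u) \<le> 2 * sqrt 2 ^ k * (?L * 2 ^ k) + exp (x / 16) * (sqrt 2 ^ Suc k)"
    using norm_triangle_sub[of "rs_sum_p k ?u" "?u 0 * rs_sum_p k (\<lambda>j. 1)"] by linarith
  also have "\<dots> = sqrt 2 ^ k * (exp (x / 16) * (x / 4 + sqrt 2))"
    by (simp add: field_simps)
  also have "\<dots> \<le> sqrt 2 ^ k * (exp (x / 16) * (4 * exp (x / 16)))"
  proof -
    have "x / 4 + sqrt 2 \<le> 4 * exp (x / 16)"
      using exp_ge_add_one_self[of "x / 16"] sqrt2_less_2 by linarith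
    then show ?thesis by (intro mult_left_mono) auto
  qed
  also have "exp (x / 16) * (4 * exp (x / 16)) = 4 * exp (x / 8)"
    by (simp flip: exp_add)
  finally show ?thesis
    by (simp add: rs_symbol_def circle_symbol_def x_def norm_divide norm_power field_simps)
qed

lemma circle_symbol_measurable [measurable]: "circle_symbol \<tau> \<in> borel_measurable borel"
  unfolding circle_symbol_def[abs_def] by measurable

lemma rs_symbol_measurable [measurable]: "rs_symbol \<alpha> k \<in> borel_measurable borel"
  unfolding rs_symbol_def[abs_def] rs_sum_p_def by measurable

section \<open>The Toeplitz operators of the Rudin-Shapiro symbols\<close>

lemma nn_integral_gauss_rotation:
  fixes h :: "complex ^ 'n \<Rightarrow> ennreal"
  assumes [measurable]: "h \<in> borel_measurable borel" and c: "cmod c = 1"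
  shows "(\<integral>\<^sup>+z. h (c *s z) \<partial>gauss_measure) = (\<integral>\<^sup>+z. h z \<partial>gauss_measure)"
proof -
  have inv: "gauss_weight (c *s z) = gauss_weight z" for z :: "complex ^ 'n"
    using c by (simp add: gauss_weight_def norm_vector_smult)
  have "(\<integral>\<^sup>+z. h z \<partial>gauss_measure) = (\<integral>\<^sup>+z. gauss_weight z * h z \<partial>lborel)"
    unfolding gauss_measure_density by (subst nn_integral_density) simp_all
  also have "\<dots> = (\<integral>\<^sup>+z. gauss_weight z * h z \<partial>distr lborel borel ((*s) c))"
    by (simp add: lborel_distr_rotation[OF c])
  also have "\<dots> = (\<integral>\<^sup>+z. gauss_weight z * h (c *s z) \<partial>lborel)"
    by (subst nn_integral_distr) (simp_all add: inv)
  also have "\<dots> = (\<integral>\<^sup>+z. h (c *s z) \<partial>gauss_measure)"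
    unfolding gauss_measure_density by (subst nn_integral_density) simp_all
  finally show ?thesis ..
qed

lemma rs_sum_measurable [measurable]:
  assumes [measurable]: "\<And>j. u j \<in> borel_measurable M"
  shows "(\<lambda>z. rs_sum_p k (\<lambda>j. u j z)) \<in> borel_measurable M" "(\<lambda>z. rs_sum_q k (\<lambda>j. u j z)) \<in> borel_measurable M"
  unfolding rs_sum_p_def rs_sum_q_def by measurable

text \<open>
  The orbit hypothesis says that shifting the sequence acts by an isometry of \<open>L\<^sup>2\<close>. Then the two
  halves of a Rudin-Shapiro sum can be combined by the parallelogram law, and the isometry disappears
  from the second half on integration. It is the operator form of the sup-norm estimate for the
  classical Rudin-Shapiro polynomials.
\<close>

lemma rs_sum_isometric_orbit:
  fixes u :: "nat \<Rightarrow> complex ^ 'n \<Rightarrow> complex"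
  assumes [measurable]: "\<And>j. u j \<in> borel_measurable borel"
    and orbit: "\<And>m. \<exists>\<omega> c. cmod \<omega> = 1 \<and> cmod c = 1 \<and> (\<forall>j z. u (j + m) z = \<omega> * u j (c *s z))"
  shows "(\<integral>\<^sup>+z. ennreal ((cmod (rs_sum_p k (\<lambda>j. u j z)))\<^sup>2) + ennreal ((cmod (rs_sum_q k (\<lambda>j. u j z)))\<^sup>2) \<partial>gauss_measure)
     = 2 ^ Suc k * (\<integral>\<^sup>+z. (cmod (u 0 z))\<^sup>2 \<partial>gauss_measure)"
proof (induction k)
  case 0
  show ?case by (simp add: nn_integral_add mult_2)
next
  case (Suc k)
  let ?P = "\<lambda>z. rs_sum_p k (\<lambda>j. u j z)" and ?Q = "\<lambda>z. rs_sum_q k (\<lambda>j. u j z)"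
  obtain \<omega> c where \<omega>: "cmod \<omega> = 1" "cmod c = 1" "\<And>j z. u (j + 2 ^ k) z = \<omega> * u j (c *s z)"
    using orbit[of "2 ^ k"] by blast
  have "ennreal ((cmod (rs_sum_p (Suc k) (\<lambda>j. u j z)))\<^sup>2) + ennreal ((cmod (rs_sum_q (Suc k) (\<lambda>j. u j z)))\<^sup>2)
      = 2 * (ennreal ((cmod (?P z))\<^sup>2) + ennreal ((cmod (?Q (c *s z)))\<^sup>2))" for z
  proof -
    have "(cmod (rs_sum_p (Suc k) (\<lambda>j. u j z)))\<^sup>2 + (cmod (rs_sum_q (Suc k) (\<lambda>j. u j z)))\<^sup>2
        = 2 * ((cmod (?P z))\<^sup>2 + (cmod (?Q (c *s z)))\<^sup>2)"
      unfolding rs_sum_Suc complex_parallelogram \<omega>(3) rs_sum_cmult norm_mult \<omega>(1) by simp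
    then have "ennreal ((cmod (rs_sum_p (Suc k) (\<lambda>j. u j z)))\<^sup>2 + (cmod (rs_sum_q (Suc k) (\<lambda>j. u j z)))\<^sup>2)
        = ennreal (2 * ((cmod (?P z))\<^sup>2 + (cmod (?Q (c *s z)))\<^sup>2))"
      by (rule arg_cong)
    then show ?thesis by (simp add: ennreal_mult' )
  qed
  then have "(\<integral>\<^sup>+z. ennreal ((cmod (rs_sum_p (Suc k) (\<lambda>j. u j z)))\<^sup>2) + ennreal ((cmod (rs_sum_q (Suc k) (\<lambda>j. u j z)))\<^sup>2) \<partial>gauss_measure)
     = 2 * ((\<integral>\<^sup>+z. ennreal ((cmod (?P z))\<^sup>2) \<partial>gauss_measure) + (\<integral>\<^sup>+z. ennreal ((cmod (?Q (c *s z)))\<^sup>2) \<partial>gauss_measure))"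
    by (simp add: nn_integral_cmult nn_integral_add)
  also have "(\<integral>\<^sup>+z. ennreal ((cmod (?Q (c *s z)))\<^sup>2) \<partial>gauss_measure) = (\<integral>\<^sup>+z. ennreal ((cmod (?Q z))\<^sup>2) \<partial>gauss_measure)"
    by (rule nn_integral_gauss_rotation[OF _ \<omega>(2), of "\<lambda>z. ennreal ((cmod (?Q z))\<^sup>2)"]) measurable
  also have "(\<integral>\<^sup>+z. ennreal ((cmod (?P z))\<^sup>2) \<partial>gauss_measure) + (\<integral>\<^sup>+z. ennreal ((cmod (?Q z))\<^sup>2) \<partial>gauss_measure)
      = 2 ^ Suc k * (\<integral>\<^sup>+z. (cmod (u 0 z))\<^sup>2 \<partial>gauss_measure)"
    unfolding Suc.IH[symmetric] by (rule nn_integral_add[symmetric]) simp_all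
  finally show ?case by (simp add: mult.assoc)
qed

text \<open>
  For small \<open>\<tau>\<close> the Toeplitz operator of \<open>circle_symbol \<tau>\<close> extends to this unitary operator. The power
  of the phase makes the dependence on \<open>\<tau>\<close> a one-parameter group.
\<close>

definition circle_op :: "real \<Rightarrow> (complex ^ 'n \<Rightarrow> complex) \<Rightarrow> complex ^ 'n \<Rightarrow> complex" where
  "circle_op \<tau> f z = cis (- (2 * \<tau>)) ^ CARD('n) * f (cis (- (2 * \<tau>)) *s z)"

definition rs_op :: "real \<Rightarrow> nat \<Rightarrow> (complex ^ 'n \<Rightarrow> complex) \<Rightarrow> complex ^ 'n \<Rightarrow> complex" where
  "rs_op \<alpha> k f z = rs_sum_p k (\<lambda>j. circle_op (rs_angle \<alpha> k j) f z) / of_real (sqrt 2 ^ k)"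

lemma circle_op_add: "circle_op (\<sigma> + \<tau>) f z = cis (- (2 * \<tau>)) ^ CARD('n) * circle_op \<sigma> f (cis (- (2 * \<tau>)) *s z)"
  for f :: "complex ^ 'n \<Rightarrow> complex"
proof -
  have "cis (- (2 * (\<sigma> + \<tau>))) = cis (- (2 * \<tau>)) * cis (- (2 * \<sigma>))"
    by (simp add: cis_mult algebra_simps)
  then show ?thesis
    by (simp add: circle_op_def power_mult_distrib vector_smult_assoc mult.commute[of "cis (- (2 * \<tau>))" "cis (- (2 * \<sigma>))"])
qed

lemma circle_op_measurable:
  assumes [measurable]: "f \<in> borel_measurable borel"
  shows "circle_op \<tau> f \<in> borel_measurable borel"
  unfolding circle_op_def[abs_def] by measurable

lemma nn_integral_circle_op:
  assumes [measurable]: "f \<in> borel_measurable borel"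
  shows "(\<integral>\<^sup>+z. (cmod (circle_op \<tau> f z))\<^sup>2 \<partial>gauss_measure) = (\<integral>\<^sup>+z. (cmod (f z))\<^sup>2 \<partial>gauss_measure)"
  using nn_integral_gauss_rotation[of "\<lambda>z. ennreal ((cmod (f z))\<^sup>2)" "cis (- (2 * \<tau>))"]
  by (simp add: circle_op_def norm_mult norm_power)

proposition rs_op_L2_bound:
  fixes f :: "complex ^ 'n \<Rightarrow> complex"
  assumes f: "f \<in> borel_measurable borel"
  shows "(\<integral>\<^sup>+z. (cmod (rs_op \<alpha> k f z))\<^sup>2 \<partial>gauss_measure) \<le> 2 * (\<integral>\<^sup>+z. (cmod (f z))\<^sup>2 \<partial>gauss_measure)"
proof -
  let ?u = "\<lambda>j. circle_op (rs_angle \<alpha> k j) f"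
  have [measurable]: "?u j \<in> borel_measurable borel" for j
    by (rule circle_op_measurable[OF f])
  have orbit: "\<exists>\<omega> c. cmod \<omega> = 1 \<and> cmod c = 1 \<and> (\<forall>j z. ?u (j + m) z = \<omega> * ?u j (c *s z))" for m
  proof -
    have "rs_angle \<alpha> k (j + m) = rs_angle \<alpha> k j + real m / (8 * 2 ^ k)" for j
      by (simp add: rs_angle_def field_simps)
    then show ?thesis
      by (intro exI[of _ "cis (- (2 * (real m / (8 * 2 ^ k)))) ^ CARD('n)"] exI[of _ "cis (- (2 * (real m / (8 * 2 ^ k))))"])
         (simp add: norm_power circle_op_add)
  qed
  have scale: "(cmod (rs_op \<alpha> k f z))\<^sup>2 = (1 / 2 ^ k) * (cmod (rs_sum_p k (\<lambda>j. ?u j z)))\<^sup>2" for z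
  proof -
    have "(sqrt 2 ^ k)\<^sup>2 = 2 ^ k" by (simp flip: power_mult add: power_mult mult.commute[of k])
    then show ?thesis by (simp add: rs_op_def norm_divide norm_power power_divide)
  qed
  have "2 ^ k * (\<integral>\<^sup>+z. (cmod (rs_op \<alpha> k f z))\<^sup>2 \<partial>gauss_measure) = (\<integral>\<^sup>+z. ennreal ((cmod (rs_sum_p k (\<lambda>j. ?u j z)))\<^sup>2) \<partial>gauss_measure)"
  proof -
    have "2 ^ k * (\<integral>\<^sup>+z. (cmod (rs_op \<alpha> k f z))\<^sup>2 \<partial>gauss_measure)
      = (\<integral>\<^sup>+z. ennreal (2 ^ k) * ennreal (1 / 2 ^ k * (cmod (rs_sum_p k (\<lambda>j. ?u j z)))\<^sup>2) \<partial>gauss_measure)"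
      unfolding scale by (subst nn_integral_cmult) (simp_all flip: ennreal_power)
    then show ?thesis by (simp flip: ennreal_mult')
  qed
  also have "\<dots> \<le> (\<integral>\<^sup>+z. ennreal ((cmod (rs_sum_p k (\<lambda>j. ?u j z)))\<^sup>2) + ennreal ((cmod (rs_sum_q k (\<lambda>j. ?u j z)))\<^sup>2) \<partial>gauss_measure)"
    by (intro nn_integral_mono) simp
  also have "\<dots> = 2 ^ Suc k * (\<integral>\<^sup>+z. (cmod (f z))\<^sup>2 \<partial>gauss_measure)"
    by (subst rs_sum_isometric_orbit[OF _ orbit]) (simp_all add: nn_integral_circle_op f)
  finally have "2 ^ k * (\<integral>\<^sup>+z. (cmod (rs_op \<alpha> k f z))\<^sup>2 \<partial>gauss_measure) \<le> 2 ^ k * (2 * (\<integral>\<^sup>+z. (cmod (f z))\<^sup>2 \<partial>gauss_measure))"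
    by (simp add: mult_ac)
  then show ?thesis
    by (subst (asm) ennreal_mult_le_mult_iff) (simp_all add: power_eq_top_ennreal)
qed

lemma rs_op_entire:
  assumes "entire f"
  shows "entire (rs_op \<alpha> k f)"
proof -
  have "entire (\<lambda>z. (1 / of_real (sqrt 2 ^ k)) * (\<Sum>j<2 ^ k. of_real (rs_p k j) * (cis (- (2 * rs_angle \<alpha> k j)) ^ CARD('a) * f (cis (- (2 * rs_angle \<alpha> k j)) *s z))))"
    by (intro entire_cmult entire_sum entire_compose_smult assms)
  then show ?thesis
    by (simp add: rs_op_def[abs_def] rs_sum_p_def circle_op_def)
qed

lemma rs_op_bargmann:
  assumes f: "f \<in> bargmann"
  shows "rs_op \<alpha> k f \<in> bargmann"
    and "(LINT z|gauss_measure. (cmod (rs_op \<alpha> k f z))\<^sup>2) \<le> 2 * (LINT z|gauss_measure. (cmod (f z))\<^sup>2)"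
proof -
  note ent = rs_op_entire[OF bargmannD(1)[OF f], of \<alpha> k]
  have [measurable]: "rs_op \<alpha> k f \<in> borel_measurable borel" by (rule entire_imp_borel[OF ent])
  note b = rs_op_L2_bound[OF bargmannD(3)[OF f], of \<alpha> k]
  have eqf: "(\<integral>\<^sup>+z. (cmod (f z))\<^sup>2 \<partial>gauss_measure) = ennreal (LINT z|gauss_measure. (cmod (f z))\<^sup>2)"
    by (rule nn_integral_eq_integral[OF L2_gaussD(2)[OF bargmannD(2)[OF f]]]) simp
  have "(\<integral>\<^sup>+z. (cmod (rs_op \<alpha> k f z))\<^sup>2 \<partial>gauss_measure) < \<infinity>"
    using b unfolding eqf by (rule le_less_trans) (simp add: ennreal_mult_less_top)
  then have int: "integrable gauss_measure (\<lambda>z. (cmod (rs_op \<alpha> k f z))\<^sup>2)"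
    by (simp add: integrable_iff_bounded)
  then show "rs_op \<alpha> k f \<in> bargmann"
    using ent by (simp add: bargmann_def L2_gauss_def)
  have "ennreal (LINT z|gauss_measure. (cmod (rs_op \<alpha> k f z))\<^sup>2) \<le> ennreal (2 * (LINT z|gauss_measure. (cmod (f z))\<^sup>2))"
    using b unfolding eqf nn_integral_eq_integral[OF int] by (simp add: nn_integral_eq_integral[OF int] ennreal_mult')
  then show "(LINT z|gauss_measure. (cmod (rs_op \<alpha> k f z))\<^sup>2) \<le> 2 * (LINT z|gauss_measure. (cmod (f z))\<^sup>2)"
    by (subst (asm) ennreal_le_iff) simp_all
qed

lemma rs_op_add: "rs_op \<alpha> k (\<lambda>z. f z + h z) z = rs_op \<alpha> k f z + rs_op \<alpha> k h z"
  by (simp add: rs_op_def rs_sum_p_def circle_op_def distrib_left sum.distrib add_divide_distrib)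

lemma rs_op_cmult: "rs_op \<alpha> k (\<lambda>z. c * f z) z = c * rs_op \<alpha> k f z"
  by (simp add: rs_op_def rs_sum_p_def circle_op_def sum_distrib_left mult_ac)

lemma norm_circle_symbol_le:
  assumes "0 \<le> \<tau>" "\<tau> \<le> 1 / 4"
  shows "cmod (circle_symbol \<tau> z) \<le> 1 * exp ((norm z)\<^sup>2 / 8)"
proof -
  have "cmod (circle_symbol \<tau> z) \<le> exp ((norm z)\<^sup>2 / 16)"
    unfolding circle_symbol_def using assms by (intro norm_exp_circle_exponent) simp_all
  also have "\<dots> \<le> exp ((norm z)\<^sup>2 / 8)" by simp
  finally show ?thesis by simp
qed

lemma symbol_kernel_integrable:
  assumes "g \<in> borel_measurable borel" "\<And>z. cmod (g z) \<le> C * exp ((norm z)\<^sup>2 / 8)" "f \<in> L2_gauss"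
  shows "integrable gauss_measure (\<lambda>w. g w * f w * bargmann_kernel a w)"
proof -
  have "integrable gauss_measure (\<lambda>w. f w * cnj (cnj (g w) * bargmann_kernel w a))"
    using assms by (intro L2_gauss_mult_integrable L2_gauss_growth) auto
  then show ?thesis by (simp add: cnj_bargmann_kernel mult_ac)
qed

lemma circle_symbol_reproducing:
  fixes f :: "complex ^ 'n \<Rightarrow> complex"
  assumes \<tau>: "0 \<le> \<tau>" "\<tau> \<le> 1 / 4" and f: "f \<in> bargmann"
  shows "(LINT w|gauss_measure. circle_symbol \<tau> w * f w * bargmann_kernel a w) = circle_op \<tau> f a"
proof -
  have "cos (2 * \<tau>) > 0"
    using \<tau> pi_gt3 by (intro cos_gt_zero_pi) linarith+
  then have re: "Re (cis (2 * \<tau>)) > 0" by simp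
  have int: "integrable gauss_measure (\<lambda>w. circle_symbol \<tau> w * f w * bargmann_kernel a w)"
    by (rule symbol_kernel_integrable[OF _ norm_circle_symbol_le[OF \<tau>] bargmannD(2)[OF f]]) measurable
  have inv: "1 / cis (2 * \<tau>) = cis (- (2 * \<tau>))" by (simp add: divide_inverse)
  from gaussian_symbol_reproducing[OF re bargmannD(1)[OF f] int[unfolded circle_symbol_def]]
  show ?thesis
    unfolding circle_symbol_def circle_op_def inv .
qed

lemma rs_symbol_reproducing:
  fixes f :: "complex ^ 'n \<Rightarrow> complex"
  assumes \<alpha>: "0 \<le> \<alpha>" "\<alpha> \<le> 1 / 8" and f: "f \<in> bargmann"
  shows "(LINT w|gauss_measure. rs_symbol \<alpha> k w * f w * bargmann_kernel a w) = rs_op \<alpha> k f a"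
proof -
  have int: "integrable gauss_measure (\<lambda>w. circle_symbol (rs_angle \<alpha> k j) w * f w * bargmann_kernel a w)" if "j < 2 ^ k" for j
    by (rule symbol_kernel_integrable[OF _ norm_circle_symbol_le[OF rs_angle_bounds[OF \<alpha> that]] bargmannD(2)[OF f]]) measurable
  have "(LINT w|gauss_measure. rs_symbol \<alpha> k w * f w * bargmann_kernel a w)
      = (LINT w|gauss_measure. (\<Sum>j<2 ^ k. of_real (rs_p k j) / of_real (sqrt 2 ^ k) * (circle_symbol (rs_angle \<alpha> k j) w * f w * bargmann_kernel a w)))"
    by (intro Bochner_Integration.integral_cong refl)
       (simp add: rs_symbol_def rs_sum_p_def sum_distrib_left sum_distrib_right sum_divide_distrib mult_ac)
  also have "\<dots> = (\<Sum>j<2 ^ k. of_real (rs_p k j) / of_real (sqrt 2 ^ k) * (LINT w|gauss_measure. circle_symbol (rs_angle \<alpha> k j) w * f w * bargmann_kernel a w))"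
    by (subst Bochner_Integration.integral_sum) (use int in auto)
  also have "\<dots> = (\<Sum>j<2 ^ k. of_real (rs_p k j) / of_real (sqrt 2 ^ k) * circle_op (rs_angle \<alpha> k j) f a)"
    by (intro sum.cong refl, subst circle_symbol_reproducing[OF rs_angle_bounds[OF \<alpha>] f]) auto
  also have "\<dots> = rs_op \<alpha> k f a"
    by (simp add: rs_op_def rs_sum_p_def sum_divide_distrib)
  finally show ?thesis .
qed

section \<open>Heat transforms and aligned phases\<close>

lemma heat_integrand_integrable:
  fixes g :: "complex ^ 'n \<Rightarrow> complex"
  assumes g[measurable]: "g \<in> borel_measurable borel" and bound: "\<And>z. cmod (g z) \<le> C * exp ((norm z)\<^sup>2 / 8)"
  shows "integrable lborel (\<lambda>w. g w * of_real (exp (- (norm (w - a))\<^sup>2 / (4 * (1 / 4)))))"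
    (is "integrable lborel ?f")
proof (rule integrable_gaussian_bound)
  show "norm (?f w) \<le> C * exp ((2 * norm a) * norm w - 7 / 8 * (norm w)\<^sup>2)" for w
  proof -
    \<comment> \<open>The Gaussian centred at \<open>a\<close> absorbs the growth rate \<open>1/8\<close> and leaves the rate \<open>7/8\<close>.\<close>
    have "(norm w - norm a)\<^sup>2 \<le> (norm (w - a))\<^sup>2"
      using norm_triangle_ineq3[of w a] by (simp add: abs_le_square_iff[symmetric])
    then have "- (norm (w - a))\<^sup>2 + (norm w)\<^sup>2 / 8 \<le> 2 * norm a * norm w - 7 / 8 * (norm w)\<^sup>2 - (norm a)\<^sup>2"
      by (simp add: power2_diff algebra_simps)
    also have "\<dots> \<le> 2 * norm a * norm w - 7 / 8 * (norm w)\<^sup>2" by simp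
    finally have e: "exp ((norm w)\<^sup>2 / 8) * exp (- (norm (w - a))\<^sup>2) \<le> exp (2 * norm a * norm w - 7 / 8 * (norm w)\<^sup>2)"
      by (simp flip: exp_add)
    have "C \<ge> 0" using order_trans[OF norm_ge_zero bound[of 0]] by simp
    have "norm (?f w) = cmod (g w) * exp (- (norm (w - a))\<^sup>2)" by (simp add: norm_mult)
    also have "\<dots> \<le> (C * exp ((norm w)\<^sup>2 / 8)) * exp (- (norm (w - a))\<^sup>2)"
      by (intro mult_right_mono bound) simp
    also have "\<dots> \<le> C * exp (2 * norm a * norm w - 7 / 8 * (norm w)\<^sup>2)"
      using mult_left_mono[OF e \<open>C \<ge> 0\<close>] by (simp only: mult.assoc)
    finally show ?thesis .
  qed
qed simp_all

lemma cdot_diff_left: "cdot (x - y) w = cdot x w - cdot y w"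
  and cdot_diff_right: "cdot w (x - y) = cdot w x - cdot w y"
  by (simp_all add: cdot_def algebra_simps sum_subtractf)

lemma heat_circle_symbol:
  fixes a :: "complex ^ 'n"
  assumes \<tau>: "0 \<le> \<tau>" "\<tau> \<le> 1 / 4"
  shows "heat_transform (1 / 4) (circle_symbol \<tau>) a
     = (cis (- \<tau>) / of_real (cos \<tau>)) ^ CARD('n) * cis (- (tan \<tau> * (norm a)\<^sup>2))"
proof -
  define c where "c = cis (2 * \<tau>)"
  have cos: "cos \<tau> > 0" using \<tau> pi_gt3 by (intro cos_gt_zero_pi) linarith+
  have "cos (2 * \<tau>) > 0" using \<tau> pi_gt3 by (intro cos_gt_zero_pi) linarith+
  then have re: "Re (1 + c) > 0" by (simp add: c_def)
  have c1: "1 + c = 2 * of_real (cos \<tau>) * cis \<tau>"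
    unfolding c_def by (simp add: complex_eq_iff cos_double_cos sin_double power2_eq_square)
  have frac: "2 / (1 + c) = cis (- \<tau>) / of_real (cos \<tau>)"
    unfolding c1 using cos by (simp add: field_simps cis_mult)
  have frac1: "2 / (1 + c) - 1 = - \<i> * of_real (tan \<tau>)"
    unfolding frac using cos by (simp add: complex_eq_iff tan_def field_simps)
  let ?f = "\<lambda>w. exp (1 * cdot w a)"
  let ?h = "\<lambda>w. ?f w * exp (cdot (2 *s a) w / 2 - (1 + c) * of_real ((norm w)\<^sup>2) / 2)"
  have integrand: "circle_symbol \<tau> w * of_real (exp (- (norm (w - a))\<^sup>2 / (4 * (1 / 4))))
      = exp (- of_real ((norm a)\<^sup>2)) * ?h w" for w
  proof -
    have eq: "of_real ((norm (w - a))\<^sup>2) = cdot w w - cdot w a - cdot a w + cdot a a"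
      unfolding cdot_self[symmetric] by (simp add: cdot_diff_left cdot_diff_right)
    have "(1 - c) / 2 * of_real ((norm w)\<^sup>2) + - of_real ((norm (w - a))\<^sup>2)
      = - of_real ((norm a)\<^sup>2) + (1 * cdot w a + (cdot (2 *s a) w / 2 - (1 + c) * of_real ((norm w)\<^sup>2) / 2))"
      unfolding eq unfolding cdot_smult_left cdot_self[symmetric] by (simp add: field_simps)
    then show ?thesis
      unfolding circle_symbol_def c_def[symmetric] exp_of_real[symmetric] exp_add[symmetric] by simp
  qed
  have meas: "circle_symbol \<tau> \<in> borel_measurable borel" by measurable
  have "integrable lborel (\<lambda>w. exp (of_real ((norm a)\<^sup>2)) * (exp (- of_real ((norm a)\<^sup>2)) * ?h w))"
    using heat_integrand_integrable[OF meas norm_circle_symbol_le[OF \<tau>], of a] unfolding integrand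
    by (rule integrable_mult_right)
  moreover have "exp (of_real ((norm a)\<^sup>2)) * (exp (- of_real ((norm a)\<^sup>2)) * x) = x" for x :: complex
    by (simp only: mult.assoc[symmetric] exp_add[symmetric]) simp
  ultimately have int: "integrable lborel ?h"
    by (simp only:)
  have "(LINT w|lborel. circle_symbol \<tau> w * of_real (exp (- (norm (w - a))\<^sup>2 / (4 * (1 / 4)))))
      = exp (- of_real ((norm a)\<^sup>2)) * ((2 * of_real pi / (1 + c)) ^ CARD('n) * exp (1 * cdot ((1 / (1 + c)) *s (2 *s a)) a))"
    unfolding integrand integral_mult_right_zero gaussian_reproducing[OF re entire_exp_cdot int] ..
  also have "\<dots> = of_real pi ^ CARD('n) * ((2 / (1 + c)) ^ CARD('n) * exp ((2 / (1 + c) - 1) * of_real ((norm a)\<^sup>2)))"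
    unfolding cdot_smult_left cdot_self
    by (simp add: power_mult_distrib power_divide exp_diff exp_minus field_simps)
  finally have "(LINT w|lborel. circle_symbol \<tau> w * of_real (exp (- (norm (w - a))\<^sup>2 / (4 * (1 / 4)))))
      = of_real pi ^ CARD('n) * ((cis (- \<tau>) / of_real (cos \<tau>)) ^ CARD('n) * exp (- \<i> * of_real (tan \<tau>) * of_real ((norm a)\<^sup>2)))"
    unfolding frac1 unfolding frac .
  then show ?thesis
    by (simp add: heat_transform_def cis_conv_exp mult.assoc)
qed

lemma heat_rs_symbol:
  fixes a :: "complex ^ 'n"
  assumes \<alpha>: "0 \<le> \<alpha>" "\<alpha> \<le> 1 / 8"
  shows "heat_transform (1 / 4) (rs_symbol \<alpha> k) a
     = rs_sum_p k (\<lambda>j. heat_transform (1 / 4) (circle_symbol (rs_angle \<alpha> k j)) a) / of_real (sqrt 2 ^ k)"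
proof -
  let ?G = "\<lambda>w. complex_of_real (exp (- (norm (w - a))\<^sup>2 / (4 * (1 / 4))))"
  have int: "integrable lborel (\<lambda>w. circle_symbol (rs_angle \<alpha> k j) w * ?G w)" if "j < 2 ^ k" for j
    by (rule heat_integrand_integrable[OF _ norm_circle_symbol_le[OF rs_angle_bounds[OF \<alpha> that]]]) measurable
  have "(LINT w|lborel. rs_symbol \<alpha> k w * ?G w)
      = (LINT w|lborel. (\<Sum>j<2 ^ k. of_real (rs_p k j) / of_real (sqrt 2 ^ k) * (circle_symbol (rs_angle \<alpha> k j) w * ?G w)))"
    by (intro Bochner_Integration.integral_cong refl)
       (simp add: rs_symbol_def rs_sum_p_def sum_distrib_left sum_distrib_right sum_divide_distrib mult_ac)
  also have "\<dots> = (\<Sum>j<2 ^ k. of_real (rs_p k j) / of_real (sqrt 2 ^ k) * (LINT w|lborel. circle_symbol (rs_angle \<alpha> k j) w * ?G w))"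
    by (subst Bochner_Integration.integral_sum) (use int in auto)
  finally show ?thesis
    by (simp add: heat_transform_def rs_sum_p_def sum_divide_distrib mult.commute)
qed

text \<open>
  Kronecker's theorem alone does not control the sign of \<open>t\<close>. By simultaneous Dirichlet
  approximation some positive multiple of \<open>|t|\<close> is nearly a common period, and adding it makes the
  parameter nonnegative.
\<close>

lemma Kronecker_nonneg:
  fixes \<beta> \<theta>:: "nat \<Rightarrow> real" and n:: nat
  assumes indp: "module.independent (\<lambda>r. (*) (real_of_int r)) (\<theta> ` {..<n})"
    and inj: "inj_on \<theta> {..<n}" and \<epsilon>: "\<epsilon> > 0"
  obtains t h where "t \<ge> 0" "\<And>i. i < n \<Longrightarrow> \<bar>t * \<theta> i - of_int (h i) - \<beta> i\<bar> < \<epsilon>"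
proof -
  obtain t h where t: "\<And>i. i < n \<Longrightarrow> \<bar>t * \<theta> i - of_int (h i) - \<beta> i\<bar> < \<epsilon> / 2"
    using Kronecker_thm_1[OF indp inj, of "\<epsilon> / 2" \<beta>] \<epsilon> by auto
  obtain N :: nat where N: "1 / N < \<epsilon> / 2" "N > 0"
    by (metis half_gt_zero \<epsilon> gr_zeroI inverse_eq_divide real_arch_inverse)
  obtain q p where q: "0 < q" and p: "\<And>i. i < n \<Longrightarrow> \<bar>of_int q * (\<bar>t\<bar> * \<theta> i) - of_int (p i)\<bar> < 1 / N"
    using Dirichlet_approx_simult[OF N(2), of n "\<lambda>i. \<bar>t\<bar> * \<theta> i"] by metis
  show thesis
  proof (rule that)
    have "1 * \<bar>t\<bar> \<le> of_int q * \<bar>t\<bar>" using q by (intro mult_right_mono) auto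
    then show "0 \<le> t + of_int q * \<bar>t\<bar>" by simp
    fix i assume i: "i < n"
    have "(t + of_int q * \<bar>t\<bar>) * \<theta> i - of_int (h i + p i) - \<beta> i
       = (t * \<theta> i - of_int (h i) - \<beta> i) + (of_int q * (\<bar>t\<bar> * \<theta> i) - of_int (p i))"
      by (simp add: algebra_simps)
    then show "\<bar>(t + of_int q * \<bar>t\<bar>) * \<theta> i - of_int (h i + p i) - \<beta> i\<bar> < \<epsilon>"
      using t[OF i] p[OF i] N by linarith
  qed
qed

text \<open>
  By the addition theorem the summands are the tangents of \<open>arctan t + arctan (b j)\<close>. They are
  rational functions of \<open>t\<close> with pairwise distinct poles \<open>1 / b j\<close>, hence no nontrivial combination
  of them vanishes identically: after clearing denominators the value at the \<open>k\<close>-th pole is a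
  nonzero multiple of \<open>c k\<close>.
\<close>

lemma tan_shift_relation_finite:
  fixes b :: "nat \<Rightarrow> real" and c :: "nat \<Rightarrow> int"
  assumes b: "\<And>j. j < K \<Longrightarrow> b j \<noteq> 0" and inj: "inj_on b {..<K}" and k: "k < K" "c k \<noteq> 0"
  shows "finite {t. (\<forall>j<K. t * b j \<noteq> 1) \<and> (\<Sum>j<K. of_int (c j) * ((t + b j) / (1 - t * b j))) = 0}"
proof -
  define p where "p = (\<Sum>j<K. smult (of_int (c j)) ([:b j, 1:] * (\<Prod>i\<in>{..<K} - {j}. [:1, - b i:])))"
  have poly_p: "poly p t = (\<Sum>j<K. of_int (c j) * ((t + b j) * (\<Prod>i\<in>{..<K} - {j}. 1 - t * b i)))" for t
    by (simp add: p_def poly_sum poly_prod add.commute distrib_right)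
  have "p \<noteq> 0"
  proof
    assume "p = 0"
    have bk: "b k \<noteq> 0" using b k by simp
    have "0 = poly p (1 / b k)" using \<open>p = 0\<close> by simp
    also have "\<dots> = (\<Sum>j\<in>{k}. of_int (c j) * ((1 / b k + b j) * (\<Prod>i\<in>{..<K} - {j}. 1 - 1 / b k * b i)))"
      unfolding poly_p
    proof (rule sum.mono_neutral_right)
      show "\<forall>j\<in>{..<K} - {k}. of_int (c j) * ((1 / b k + b j) * (\<Prod>i\<in>{..<K} - {j}. 1 - 1 / b k * b i)) = 0"
        using k bk by (auto intro!: prod_zero bexI[of _ k])
    qed (use k in auto)
    finally have "of_int (c k) * ((1 / b k + b k) * (\<Prod>i\<in>{..<K} - {k}. 1 - 1 / b k * b i)) = 0" by simp
    moreover have "1 - 1 / b k * b i \<noteq> 0" if "i \<in> {..<K} - {k}" for i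
      using that bk inj k by (auto simp: inj_on_def)
    moreover have "1 / b k + b k \<noteq> 0"
    proof -
      have "1 / b k + b k = (1 + (b k)\<^sup>2) / b k" using bk by (simp add: field_simps power2_eq_square)
      moreover have "1 + (b k)\<^sup>2 \<noteq> 0" by (smt (verit) zero_le_power2)
      ultimately show ?thesis using bk by simp
    qed
    ultimately show False using k by simp
  qed
  have "poly p t = 0" if t: "\<forall>j<K. t * b j \<noteq> 1" "(\<Sum>j<K. of_int (c j) * ((t + b j) / (1 - t * b j))) = 0" for t
  proof -
    have "poly p t = (\<Sum>j<K. (\<Prod>i<K. 1 - t * b i) * (of_int (c j) * ((t + b j) / (1 - t * b j))))"
      unfolding poly_p
    proof (intro sum.cong refl)
      fix j assume "j \<in> {..<K}"
      then show "of_int (c j) * ((t + b j) * (\<Prod>i\<in>{..<K} - {j}. 1 - t * b i))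
          = (\<Prod>i<K. 1 - t * b i) * (of_int (c j) * ((t + b j) / (1 - t * b j)))"
        using t(1) by (subst prod.remove[of _ j]) (auto simp: field_simps)
    qed
    then have "poly p t = (\<Prod>i<K. 1 - t * b i) * (\<Sum>j<K. of_int (c j) * ((t + b j) / (1 - t * b j)))"
      unfolding sum_distrib_left .
    then show ?thesis unfolding t(2) by simp
  qed
  then have "{t. (\<forall>j<K. t * b j \<noteq> 1) \<and> (\<Sum>j<K. of_int (c j) * ((t + b j) / (1 - t * b j))) = 0} \<subseteq> {t. poly p t = 0}"
    by blast
  then show ?thesis
    using poly_roots_finite[OF \<open>p \<noteq> 0\<close>] finite_subset by blast
qed

lemma tan_eq_imp_eq:
  fixes x y :: real
  assumes "tan x = tan y" "0 < x" "x \<le> 1 / 8" "0 < y" "y \<le> 1 / 8"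
  shows "x = y"
proof (rule linorder_cases)
  assume "x < y"
  then have "tan x < tan y" using assms pi_gt3 by (intro tan_monotone) linarith+
  then show ?thesis using assms by simp
next
  assume "y < x"
  then have "tan y < tan x" using assms pi_gt3 by (intro tan_monotone) linarith+
  then show ?thesis using assms by simp
qed

text \<open>
  There are countably many nontrivial integer relations, each of which holds for finitely many
  \<open>\<alpha>\<close> between \<open>0\<close> and \<open>1/8\<close> only, whereas an interval is uncountable.
\<close>

lemma generic_angle_exists:
  obtains \<alpha> where "0 \<le> \<alpha>" "\<alpha> \<le> 1 / 8"
    "\<And>c :: nat \<Rightarrow> int. (\<Sum>j<2 ^ k. of_int (c j) * tan (rs_angle \<alpha> k j)) = 0 \<Longrightarrow> (\<forall>j<2 ^ k. c j = 0)"
proof -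
  define K :: nat where "K = 2 ^ k"
  define b where "b j = tan (real (Suc j) / (8 * 2 ^ k))" for j
  have step: "0 < real (Suc j) / (8 * 2 ^ k)" "real (Suc j) / (8 * 2 ^ k) \<le> 1 / 8" if "j < K" for j
  proof -
    have "real (Suc j) \<le> real (2 ^ k)" using that unfolding K_def by (intro of_nat_mono) simp
    then show "real (Suc j) / (8 * 2 ^ k) \<le> 1 / 8" by (simp add: field_simps)
  qed simp
  have b0: "b j \<noteq> 0" if "j < K" for j
    using tan_gt_zero[of "real (Suc j) / (8 * 2 ^ k)"] step[OF that] pi_gt3 unfolding b_def by linarith
  have inj: "inj_on b {..<K}"
  proof (rule inj_onI)
    fix i j assume ij: "i \<in> {..<K}" "j \<in> {..<K}" "b i = b j"
    have "real (Suc i) / (8 * 2 ^ k) = real (Suc j) / (8 * 2 ^ k)"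
      using ij(1,2) by (intro tan_eq_imp_eq[OF ij(3)[unfolded b_def]] step) simp_all
    then show "i = j" by simp
  qed
  let ?bad = "\<lambda>c :: nat \<Rightarrow> int. {t. (\<forall>j<K. t * b j \<noteq> 1) \<and> (\<Sum>j<K. of_int (c j) * ((t + b j) / (1 - t * b j))) = 0}"
  let ?C = "{c \<in> {..<K} \<rightarrow>\<^sub>E (UNIV :: int set). \<exists>j<K. c j \<noteq> 0}"
  define B where "B = (\<Union>c\<in>?C. ?bad c)"
  have "countable B"
    unfolding B_def
  proof (rule countable_UN)
    have cnt: "countable ({..<K} \<rightarrow>\<^sub>E (UNIV :: int set))"
      by (rule countable_PiE) auto
    show "countable ?C"
      by (rule countable_subset[OF _ cnt]) (rule Collect_restrict)
    fix c assume "c \<in> ?C"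
    then obtain j where "j < K" "c j \<noteq> 0" by blast
    from tan_shift_relation_finite[of K b j c, OF b0 inj this] show "countable (?bad c)"
      by (rule countable_finite)
  qed
  moreover have "tan (1 / 8) > (0 :: real)"
    using pi_gt3 by (intro tan_gt_zero) linarith+
  then have "uncountable {0<..<tan (1 / 8 :: real)}"
    by (simp add: uncountable_open_interval)
  ultimately have "\<not> {0<..<tan (1 / 8)} \<subseteq> B"
    using countable_subset by blast
  then obtain t where t: "t \<in> {0<..<tan (1 / 8)}" "t \<notin> B"
    by blast
  define \<alpha> where "\<alpha> = arctan t"
  have \<alpha>: "0 < \<alpha>" "\<alpha> < 1 / 8"
  proof -
    show "0 < \<alpha>" using t by (simp add: \<alpha>_def)
    have "arctan t < arctan (tan (1 / 8))" using t by (simp add: arctan_less_iff)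
    also have "\<dots> = 1 / 8" using pi_gt3 by (intro arctan_tan) linarith+
    finally show "\<alpha> < 1 / 8" by (simp add: \<alpha>_def)
  qed
  have tan_rs: "tan (rs_angle \<alpha> k j) = (t + b j) / (1 - t * b j)" "t * b j \<noteq> 1" if "j < K" for j
  proof -
    have c: "cos \<alpha> \<noteq> 0" "cos (real (Suc j) / (8 * 2 ^ k)) \<noteq> 0" "cos (\<alpha> + real (Suc j) / (8 * 2 ^ k)) \<noteq> 0"
      using \<alpha> step[OF that] pi_gt3 by (intro less_imp_neq[THEN not_sym] cos_gt_zero_pi; linarith)+
    show "tan (rs_angle \<alpha> k j) = (t + b j) / (1 - t * b j)"
      unfolding rs_angle_def tan_add[OF c] by (simp add: b_def \<alpha>_def tan_arctan)
    have "1 - t * b j = cos (\<alpha> + real (Suc j) / (8 * 2 ^ k)) / (cos \<alpha> * cos (real (Suc j) / (8 * 2 ^ k)))"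
      using lemma_tan_add1[OF c(1,2)] by (simp add: b_def \<alpha>_def tan_arctan)
    then show "t * b j \<noteq> 1" using c by auto
  qed
  show thesis
  proof (rule that[of \<alpha>])
    fix c :: "nat \<Rightarrow> int"
    assume sum: "(\<Sum>j<2 ^ k. of_int (c j) * tan (rs_angle \<alpha> k j)) = 0"
    show "\<forall>j<2 ^ k. c j = 0"
    proof (rule ccontr)
      assume "\<not> (\<forall>j<2 ^ k. c j = 0)"
      then have "restrict c {..<K} \<in> ?C" by (auto simp: K_def)
      moreover have "t \<in> ?bad (restrict c {..<K})"
        using sum tan_rs by (simp add: K_def)
      ultimately show False using t(2) unfolding B_def by blast
    qed
  qed (use \<alpha> in auto)
qed

lemma integer_independentI:
  fixes s :: "nat \<Rightarrow> real"
  assumes rel: "\<And>c :: nat \<Rightarrow> int. (\<Sum>j<K. of_int (c j) * s j) = 0 \<Longrightarrow> (\<forall>j<K. c j = 0)"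
  shows "inj_on s {..<K}" "module.independent (\<lambda>r. (*) (real_of_int r)) (s ` {..<K})"
proof -
  show inj: "inj_on s {..<K}"
  proof (rule inj_onI, rule ccontr)
    fix i j assume ij: "i \<in> {..<K}" "j \<in> {..<K}" "s i = s j" "i \<noteq> j"
    let ?c = "\<lambda>l. if l = i then 1 else if l = j then - 1 else 0 :: int"
    have "(\<Sum>l<K. of_int (?c l) * s l) = (\<Sum>l\<in>{i, j}. of_int (?c l) * s l)"
      using ij(1,2) by (intro sum.mono_neutral_right) auto
    also have "\<dots> = 0" using ij(3,4) by simp
    finally have "\<forall>l<K. ?c l = 0" by (rule rel)
    then have "?c i = 0" using ij(1) by blast
    then show False by simp
  qed
  interpret Modules.module "(\<lambda>r. (*) (real_of_int r))"
    by (simp add: Modules.module.intro distrib_left mult.commute)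
  show "independent (s ` {..<K})"
    unfolding independent_explicit_module
  proof (intro allI impI)
    fix T u v
    assume T: "finite T" "T \<subseteq> s ` {..<K}" "(\<Sum>v\<in>T. of_int (u v) * v) = 0" "v \<in> T"
    let ?c = "\<lambda>j. if s j \<in> T then u (s j) else 0"
    have "(\<Sum>j<K. of_int (?c j) * s j) = (\<Sum>x\<in>s ` {..<K}. of_int (if x \<in> T then u x else 0) * x)"
      by (simp add: sum.reindex[OF inj])
    also have "\<dots> = (\<Sum>v\<in>T. of_int (if v \<in> T then u v else 0) * v)"
      using T(1,2) by (intro sum.mono_neutral_right) auto
    also have "\<dots> = (\<Sum>v\<in>T. of_int (u v) * v)" by (rule sum.cong) simp_all
    also have "\<dots> = 0" by (rule T(3))
    finally have "\<forall>j<K. ?c j = 0" by (rule rel)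
    moreover obtain j where "j < K" "v = s j" using T(2,4) by blast
    ultimately show "u v = 0" using T(4) by metis
  qed
qed

text \<open>
  Each summand of the heat transform is a phase times a factor of modulus at least one. Kronecker's
  theorem aligns the phases up to \<open>\<pi> / 3\<close>, where the real part is still at least one half.
\<close>

lemma rs_symbol_heat_large:
  obtains \<alpha> and a :: "complex ^ 'n" where "0 \<le> \<alpha>" "\<alpha> \<le> 1 / 8"
    "cmod (heat_transform (1 / 4) (rs_symbol \<alpha> k) a) \<ge> sqrt 2 ^ k / 2"
proof -
  obtain \<alpha> where \<alpha>: "0 \<le> \<alpha>" "\<alpha> \<le> 1 / 8"
    and gen: "\<And>c :: nat \<Rightarrow> int. (\<Sum>j<2 ^ k. of_int (c j) * tan (rs_angle \<alpha> k j)) = 0 \<Longrightarrow> (\<forall>j<2 ^ k. c j = 0)"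
    using generic_angle_exists by blast
  let ?\<tau> = "rs_angle \<alpha> k"
  \<comment> \<open>The signs, too, are phases: \<open>-1 = cis pi\<close>.\<close>
  define \<delta> where "\<delta> j = (if rs_p k j = 1 then 0 else pi)" for j
  have \<delta>: "complex_of_real (rs_p k j) = cis (\<delta> j)" for j
    using rs_sign(1)[of k j] by (auto simp: \<delta>_def)
  \<comment> \<open>The target for \<open>t * tan (rs_angle \<alpha> k j)\<close> modulo one, where \<open>|a|\<^sup>2 = 2 * pi * t\<close>.\<close>
  define \<beta> where "\<beta> j = (\<delta> j - real CARD('n) * ?\<tau> j) / (2 * pi)" for j
  obtain t h where t: "t \<ge> 0" and h: "\<And>j. j < 2 ^ k \<Longrightarrow> \<bar>t * tan (?\<tau> j) - of_int (h j) - \<beta> j\<bar> < 1 / 6"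
  proof -
    note ind = integer_independentI[where s="\<lambda>j. tan (?\<tau> j)" and K="2 ^ k", OF gen]
    show thesis
      by (rule Kronecker_nonneg[OF ind(2) ind(1), where \<epsilon>="1 / 6" and \<beta>=\<beta>]) (assumption, assumption, simp, rule that)
  qed
  obtain a :: "complex ^ 'n" where a: "norm a = sqrt (2 * pi * t)"
    using vector_choose_size[of "sqrt (2 * pi * t)"] t by auto
  have a2: "(norm a)\<^sup>2 = 2 * pi * t" using a t by simp
  let ?H = "\<lambda>j. heat_transform (1 / 4) (circle_symbol (?\<tau> j)) a"
  have re_ge: "Re (of_real (rs_p k j) * ?H j) \<ge> 1 / 2" if j: "j < 2 ^ k" for j
  proof -
    note b = rs_angle_bounds[OF \<alpha> j]
    have cos: "0 < cos (?\<tau> j)" using b pi_gt3 by (intro cos_gt_zero_pi) linarith+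
    define \<eta> where "\<eta> = t * tan (?\<tau> j) - of_int (h j) - \<beta> j"
    have phase: "\<delta> j - real CARD('n) * ?\<tau> j - tan (?\<tau> j) * (norm a)\<^sup>2 = - (2 * pi * \<eta>) + 2 * pi * of_int (- h j)"
      unfolding a2 \<eta>_def \<beta>_def by (simp add: field_simps)
    have "of_real (rs_p k j) * ?H j = of_real (1 / cos (?\<tau> j) ^ CARD('n)) *
        (cis (\<delta> j) * (cis (- ?\<tau> j) ^ CARD('n) * cis (- (tan (?\<tau> j) * (norm a)\<^sup>2))))"
      unfolding heat_circle_symbol[OF b] \<delta> by (simp add: power_divide)
    also have "cis (\<delta> j) * (cis (- ?\<tau> j) ^ CARD('n) * cis (- (tan (?\<tau> j) * (norm a)\<^sup>2)))
        = cis (\<delta> j - real CARD('n) * ?\<tau> j - tan (?\<tau> j) * (norm a)\<^sup>2)"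
      by (simp only: Complex.DeMoivre cis_mult) (rule arg_cong[where f=cis], simp)
    also have "\<dots> = cis (- (2 * pi * \<eta>)) * cis (2 * pi * of_int (- h j))"
      unfolding phase cis_mult ..
    also have "cis (2 * pi * of_int (- h j)) = 1"
      by (rule cis_multiple_2pi) (rule Ints_of_int)
    finally have Re: "Re (of_real (rs_p k j) * ?H j) = 1 / cos (?\<tau> j) ^ CARD('n) * cos (2 * pi * \<eta>)"
      by (simp add: Re_complex_of_real)
    have "\<bar>2 * pi * \<eta>\<bar> \<le> pi / 3"
      using h[OF j] unfolding \<eta>_def[symmetric] by (simp add: abs_mult field_simps)
    then have "cos (pi / 3) \<le> cos \<bar>2 * pi * \<eta>\<bar>"
      by (intro cos_monotone_0_pi_le) auto
    then have half: "1 / 2 \<le> cos (2 * pi * \<eta>)" by (simp add: cos_60)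
    have "cos (?\<tau> j) ^ CARD('n) \<le> 1" using cos by (intro power_le_one) auto
    then have "1 \<le> 1 / cos (?\<tau> j) ^ CARD('n)" using cos by simp
    from mult_mono[OF this half] show ?thesis unfolding Re using cos by simp
  qed
  have "2 ^ k * (1 / 2) \<le> (\<Sum>j<2 ^ k. Re (of_real (rs_p k j) * ?H j))"
    using sum_mono[of "{..<2 ^ k}" "\<lambda>_. 1 / 2" "\<lambda>j. Re (of_real (rs_p k j) * ?H j)"] re_ge by simp
  also have "\<dots> = Re (rs_sum_p k ?H)" by (simp add: rs_sum_p_def)
  also have "\<dots> \<le> cmod (rs_sum_p k ?H)" by (rule complex_Re_le_cmod)
  finally have "sqrt 2 ^ k * (sqrt 2 ^ k / 2) \<le> cmod (rs_sum_p k ?H)"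
    by (simp flip: power_mult_distrib)
  then have "sqrt 2 ^ k / 2 \<le> cmod (heat_transform (1 / 4) (rs_symbol \<alpha> k) a)"
    unfolding heat_rs_symbol[OF \<alpha>] norm_divide by (simp add: norm_power field_simps)
  with \<alpha> that show thesis by blast
qed

section \<open>A gliding hump\<close>

text \<open>
  The sign of the \<open>k\<close>-th term is chosen, in terms of the earlier ones, so that at the \<open>k\<close>-th point
  the new term is not cancelled by the partial sum. Here \<open>c k j\<close> is the value of the \<open>j\<close>-th term,
  with its positive weight, at the \<open>k\<close>-th point.
\<close>

fun hump_sign :: "(nat \<Rightarrow> nat \<Rightarrow> complex) \<Rightarrow> nat \<Rightarrow> real" where
  "hump_sign c k = (if cmod (c k k) \<le> cmod ((\<Sum>j<k. of_real (hump_sign c j) * c k j) + c k k) then 1 else - 1)"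

declare hump_sign.simps [simp del]

lemma hump_sign_abs: "\<bar>hump_sign c k\<bar> = 1"
  by (subst hump_sign.simps) simp

lemma hump_sign_no_cancellation:
  "cmod (c k k) \<le> cmod (\<Sum>j<Suc k. of_real (hump_sign c j) * c k j)"
proof -
  let ?F = "\<Sum>j<k. of_real (hump_sign c j) * c k j"
  have "2 * cmod (c k k) = cmod ((?F + c k k) - (?F - c k k))" by (simp add: norm_mult)
  also have "\<dots> \<le> cmod (?F + c k k) + cmod (?F - c k k)" by (rule norm_triangle_ineq4)
  finally show ?thesis
    by (simp add: hump_sign.simps[of c k])
qed

text \<open>
  This is the uniform boundedness principle for the functionals
  \<open>w \<mapsto> \<Sum>N. w N * b N a\<close> on absolutely summable sequences, whose norms are the suprema over \<open>N\<close> of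
  \<open>|b N a|\<close>. At the point \<open>a k\<close> the index \<open>\<nu> k\<close> nearly attains the norm \<open>D k\<close>. The term with
  weight \<open>3\<^sup>-\<^sup>k\<close> then contributes at least \<open>3/4\<close> of \<open>3\<^sup>-\<^sup>k D k\<close>, and all later terms together at most
  \<open>1/2\<close> of \<open>3\<^sup>-\<^sup>k D k\<close>. Since \<open>D k\<close> is at least \<open>12\<^sup>k\<close>, the remaining quarter is at least \<open>4\<^sup>k / 4\<close>.
\<close>

proposition gliding_hump:
  fixes b :: "nat \<Rightarrow> 'a \<Rightarrow> complex"
  assumes bd: "\<And>a. \<exists>D. \<forall>N. cmod (b N a) \<le> D" and unb: "\<And>R. \<exists>N a. cmod (b N a) > R"
  obtains w :: "nat \<Rightarrow> real" and \<nu> :: "nat \<Rightarrow> nat"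
  where "\<And>k. \<bar>w k\<bar> = (1 / 3) ^ k" "\<And>R. \<exists>a. cmod (\<Sum>k. of_real (w k) * b (\<nu> k) a) > R"
proof -
  have "\<exists>N a D. (\<forall>N'. cmod (b N' a) \<le> D) \<and> 3 / 4 * D \<le> cmod (b N a) \<and> 12 ^ k \<le> D" for k :: nat
  proof -
    obtain N0 a where N0: "cmod (b N0 a) > 12 ^ k" using unb by blast
    define D where "D = (SUP N. cmod (b N a))"
    have bdd: "bdd_above (range (\<lambda>N. cmod (b N a)))"
      using bd[of a] by (auto simp: bdd_above_def)
    have le: "cmod (b N a) \<le> D" for N unfolding D_def by (rule cSUP_upper[OF _ bdd]) simp
    have D: "12 ^ k < D" using N0 le[of N0] by linarith
    moreover have "(0 :: real) < 12 ^ k" by simp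
    ultimately have "3 / 4 * D < D" by linarith
    then obtain N where "3 / 4 * D < cmod (b N a)"
      unfolding D_def using less_cSUP_iff[OF _ bdd] by blast
    with le D show ?thesis by (intro exI[of _ N] exI[of _ a] exI[of _ D]) auto
  qed
  then obtain \<nu> a D where le: "\<And>k N. cmod (b N (a k)) \<le> D k"
    and near: "\<And>k. 3 / 4 * D k \<le> cmod (b (\<nu> k) (a k))" and large: "\<And>k. 12 ^ k \<le> D k"
    by metis
  define c where "c k j = of_real ((1 / 3) ^ j) * b (\<nu> j) (a k)" for k j
  define w where "w j = hump_sign c j * (1 / 3) ^ j" for j
  have wabs: "\<bar>w j\<bar> = (1 / 3) ^ j" for j by (simp add: w_def abs_mult hump_sign_abs)
  have wb: "of_real (w j) * b (\<nu> j) (a k) = of_real (hump_sign c j) * c k j" for j k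
    by (simp add: w_def c_def)
  have "\<exists>x. cmod (\<Sum>j. of_real (w j) * b (\<nu> j) x) > R" for R
  proof -
    obtain k where k: "4 * R < 4 ^ k" using real_arch_pow[of 4 "4 * R"] by auto
    let ?u = "\<lambda>j. of_real (w j) * b (\<nu> j) (a k)"
    have bound: "norm (?u j) \<le> (1 / 3) ^ j * D k" for j
      using le[of "\<nu> j" k] by (simp add: norm_mult wabs mult_left_mono)
    have geo: "summable (\<lambda>j. (1 / 3 :: real) ^ j * D k)"
      by (intro summable_mult2 summable_geometric) simp
    have sumu: "summable ?u" by (rule summable_comparison_test'[OF geo bound])
    have tail: "norm (\<Sum>j. ?u (j + Suc k)) \<le> (1 / 3) ^ k / 2 * D k"
    proof -
      have "norm (\<Sum>j. ?u (j + Suc k)) \<le> (\<Sum>j. (1 / 3) ^ (j + Suc k) * D k)"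
        using summable_iff_shift[THEN iffD2, OF geo, of "Suc k"] bound by (intro norm_suminf_le)
      also have "\<dots> = (\<Sum>j. (1 / 3) ^ j * ((1 / 3) ^ Suc k * D k))"
        by (simp add: power_add mult_ac)
      also have "\<dots> = (\<Sum>j. (1 / 3) ^ j) * ((1 / 3) ^ Suc k * D k)"
        by (rule suminf_mult2[symmetric]) (simp add: summable_geometric)
      also have "\<dots> = (1 / 3) ^ k / 2 * D k" by (subst suminf_geometric) simp_all
      finally show ?thesis .
    qed
    have head: "(1 / 3) ^ k * (3 / 4 * D k) \<le> norm (\<Sum>j<Suc k. ?u j)"
    proof -
      have "(1 / 3) ^ k * (3 / 4 * D k) \<le> (1 / 3) ^ k * cmod (b (\<nu> k) (a k))"
        by (rule mult_left_mono[OF near]) simp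
      also have "\<dots> = cmod (c k k)" by (simp add: c_def norm_mult norm_power)
      also have "\<dots> \<le> norm (\<Sum>j<Suc k. ?u j)" unfolding wb by (rule hump_sign_no_cancellation)
      finally show ?thesis .
    qed
    have "(\<Sum>j<Suc k. ?u j) = (\<Sum>j. ?u j) - (\<Sum>j. ?u (j + Suc k))"
      using suminf_split_initial_segment[OF sumu, of "Suc k"] by simp
    then have "norm (\<Sum>j<Suc k. ?u j) \<le> norm (\<Sum>j. ?u j) + norm (\<Sum>j. ?u (j + Suc k))"
      by (simp add: norm_triangle_ineq4)
    with head tail have "(1 / 3) ^ k * D k / 4 \<le> norm (\<Sum>j. ?u j)" by argo
    moreover have "(1 / 3) ^ k * 12 ^ k \<le> (1 / 3) ^ k * D k" by (rule mult_left_mono[OF large]) simp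
    moreover have "(1 / 3 :: real) ^ k * 12 ^ k = 4 ^ k" by (simp flip: power_mult_distrib)
    ultimately have "R < norm (\<Sum>j. ?u j)" using k by linarith
    then show ?thesis by blast
  qed
  with wabs that show thesis by blast
qed

section \<open>Series of symbols and of operators\<close>

text \<open>
  Cauchy's inequality on the complex line through \<open>z\<close> in direction \<open>v\<close>, for the circle of radius
  \<open>1 / |v|\<close>.
\<close>

lemma entire_derivative_bound:
  assumes f: "entire f" and D: "(f has_derivative D) (at z)"
    and B: "\<And>y. norm (y - z) \<le> 1 \<Longrightarrow> cmod (f y) \<le> B"
  shows "cmod (D v) \<le> B * norm v"
proof (cases "v = 0")
  case True
  then show ?thesis using D by (simp add: linear_0 has_derivative_linear)
next
  case False
  let ?\<phi> = "\<lambda>\<zeta>. f (z + \<zeta> *s v)"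
  have "cmod ((deriv ^^ 1) ?\<phi> 0) \<le> fact 1 * B / (1 / norm v) ^ 1"
  proof (rule Cauchy_inequality)
    show "?\<phi> holomorphic_on ball 0 (1 / norm v)" "continuous_on (cball 0 (1 / norm v)) ?\<phi>"
      using entire_imp_holomorphic_on_line(1)[OF f] holomorphic_on_imp_continuous_on by blast+
    fix \<zeta> :: complex assume "cmod (0 - \<zeta>) = 1 / norm v"
    then show "cmod (?\<phi> \<zeta>) \<le> B" using False by (intro B) (simp add: norm_vector_smult)
  qed (use False in simp)
  moreover have "deriv ?\<phi> 0 = D v"
    by (rule DERIV_imp_deriv[OF entire_imp_holomorphic_on_line(2)[OF f D]])
  ultimately show ?thesis by simp
qed

proposition entire_series:
  fixes F :: "nat \<Rightarrow> complex ^ 'n \<Rightarrow> complex"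
  assumes F: "\<And>k. entire (F k)" and c: "summable c" "\<And>k. 0 \<le> c k"
    and bound: "\<And>k z. cmod (F k z) \<le> c k * B (norm z)" and B: "mono B"
  shows "entire (\<lambda>z. \<Sum>k. F k z)"
  unfolding entire_def
proof
  fix z0 :: "complex ^ 'n"
  obtain D where D: "\<And>k z. (F k has_derivative D k z) (at z)" and lin: "\<And>k z a v. D k z (a *s v) = a * D k z v"
    using F unfolding entire_def by metis
  define M where "M = max 0 (B (norm z0 + 2))"
  have Dbound: "cmod (D k z v) \<le> c k * (M * norm v)" if "z \<in> ball z0 1" for k z v
  proof -
    have "cmod (D k z v) \<le> (c k * M) * norm v"
    proof (rule entire_derivative_bound[OF F D])
      fix y assume y: "norm (y - z) \<le> 1"
      have "norm y \<le> norm z0 + norm (z - z0) + norm (y - z)"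
        using norm_triangle_ineq[of z0 "z - z0"] norm_triangle_ineq[of z "y - z"] by simp
      then have "B (norm y) \<le> B (norm z0 + 2)"
        using y that by (intro monoD[OF B]) (simp add: dist_norm norm_minus_commute)
      then have "c k * B (norm y) \<le> c k * M"
        by (intro mult_left_mono c(2)) (simp add: M_def)
      with bound[of k y] show "cmod (F k y) \<le> c k * M" by linarith
    qed
    then show ?thesis by (simp add: mult.assoc)
  qed
  have sumD: "summable (\<lambda>k. D k z v)" if "z \<in> ball z0 1" for z v
    by (rule summable_comparison_test'[OF summable_mult2[OF c(1)] Dbound[OF that]])
  have sumF: "summable (\<lambda>k. F k z)" for z
    by (rule summable_comparison_test'[OF summable_mult2[OF c(1)] bound])
  have "\<exists>g. \<forall>x\<in>ball z0 1. (\<lambda>k. F k x) sums g x \<and> (g has_derivative (\<lambda>v. \<Sum>k. D k x v)) (at x within ball z0 1)"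
  proof (rule has_derivative_series)
    fix e :: real assume "e > 0"
    \<comment> \<open>The shift by one avoids a division by zero when the bound \<open>M\<close> vanishes.\<close>
    define d where "d = e / (M + 1)"
    have M: "M \<ge> 0" by (simp add: M_def)
    with \<open>e > 0\<close> have d: "d > 0" by (simp add: d_def)
    from suminf_exist_split[OF d c(1)] obtain N where N: "\<And>n. n \<ge> N \<Longrightarrow> norm (\<Sum>k. c (k + n)) < d" by blast
    show "\<forall>\<^sub>F n in sequentially. \<forall>x\<in>ball z0 1. \<forall>v. norm ((\<Sum>k<n. D k x v) - (\<Sum>k. D k x v)) \<le> e * norm v"
      using eventually_ge_at_top[of N]
    proof eventually_elim
      case (elim n)
      show ?case
      proof (intro ballI allI)
        fix x v assume x: "x \<in> ball z0 1"
        have cn: "summable (\<lambda>k. c (k + n))" using c(1) by (simp add: summable_iff_shift)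
        have "norm ((\<Sum>k<n. D k x v) - (\<Sum>k. D k x v)) = norm (\<Sum>k. D (k + n) x v)"
          unfolding suminf_minus_initial_segment[OF sumD[OF x]] by (rule norm_minus_commute)
        also have "\<dots> \<le> (\<Sum>k. c (k + n) * (M * norm v))"
          by (intro norm_suminf_le Dbound x summable_mult2 cn)
        also have "\<dots> = (\<Sum>k. c (k + n)) * (M * norm v)" by (rule suminf_mult2[OF cn, symmetric])
        also have "\<dots> \<le> d * (M * norm v)"
          using N[OF elim] M by (intro mult_right_mono) auto
        also have "\<dots> = e * (M / (M + 1)) * norm v" by (simp add: d_def)
        also have "\<dots> \<le> e * 1 * norm v"
          using M \<open>e > 0\<close> by (intro mult_right_mono mult_left_mono) auto
        finally show "norm ((\<Sum>k<n. D k x v) - (\<Sum>k. D k x v)) \<le> e * norm v" by simp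
      qed
    qed
  next
    show "(\<lambda>k. F k z0) sums (\<Sum>k. F k z0)" by (rule summable_sums[OF sumF])
  qed (auto intro: has_derivative_at_withinI D)
  then obtain g where g: "\<And>x. x \<in> ball z0 1 \<Longrightarrow> (\<lambda>k. F k x) sums g x"
    "\<And>x. x \<in> ball z0 1 \<Longrightarrow> (g has_derivative (\<lambda>v. \<Sum>k. D k x v)) (at x within ball z0 1)" by blast
  have "(g has_derivative (\<lambda>v. \<Sum>k. D k z0 v)) (at z0)"
    using g(2)[of z0] by (simp add: at_within_open[of z0 "ball z0 1"])
  then have "((\<lambda>z. \<Sum>k. F k z) has_derivative (\<lambda>v. \<Sum>k. D k z0 v)) (at z0)"
    by (rule has_derivative_transform_within_open[of _ _ _ _ "ball z0 1"]) (use g(1) sums_unique in auto)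
  moreover have "(\<Sum>k. D k z0 (a *s v)) = a * (\<Sum>k. D k z0 v)" for a v
    unfolding lin by (rule suminf_mult) (simp add: sumD)
  ultimately show "\<exists>D. ((\<lambda>z. \<Sum>k. F k z) has_derivative D) (at z0) \<and> (\<forall>a v. D (a *s v) = a * D v)"
    by blast
qed

text \<open>
  The Cauchy-Schwarz inequality for the weights \<open>v\<close>, obtained from the nonnegativity of the variance.
\<close>

lemma weighted_suminf_power2_le:
  fixes v x :: "nat \<Rightarrow> real"
  assumes v: "summable v" "\<And>k. 0 \<le> v k" and x: "\<And>k. \<bar>x k\<bar> \<le> C"
  shows "(\<Sum>k. v k * x k)\<^sup>2 \<le> suminf v * (\<Sum>k. v k * (x k)\<^sup>2)"
proof (cases "suminf v = 0")
  case True
  then have "v k = 0" for k using suminf_eq_zero_iff[OF v] by simp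
  then show ?thesis by simp
next
  case False
  have V: "suminf v > 0" using False suminf_nonneg[OF v] by linarith
  have s1: "summable (\<lambda>k. v k * x k)"
    by (rule summable_comparison_test'[OF summable_mult2[OF v(1), of C], of 0])
       (use v(2) x in \<open>auto simp: abs_mult intro!: mult_mono\<close>)
  have s2: "summable (\<lambda>k. v k * (x k)\<^sup>2)"
  proof (rule summable_comparison_test'[OF summable_mult2[OF v(1), of "C\<^sup>2"], of 0])
    fix k show "norm (v k * (x k)\<^sup>2) \<le> v k * C\<^sup>2"
      using power_mono[OF x[of k], of 2] v(2)[of k] by (simp add: abs_mult mult_left_mono)
  qed
  define m where "m = (\<Sum>k. v k * x k) / suminf v"
  have "0 \<le> (\<Sum>k. v k * (x k - m)\<^sup>2)"
  proof (rule suminf_nonneg)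
    have "v k * (x k - m)\<^sup>2 = v k * (x k)\<^sup>2 - 2 * m * (v k * x k) + m\<^sup>2 * v k" for k
      by (simp add: power2_eq_square algebra_simps)
    then show "summable (\<lambda>k. v k * (x k - m)\<^sup>2)"
      by (simp only:) (intro summable_add summable_diff summable_mult s1 s2 v(1))
  qed (use v(2) in simp)
  also have "(\<Sum>k. v k * (x k - m)\<^sup>2) = (\<Sum>k. v k * (x k)\<^sup>2 - 2 * m * (v k * x k) + m\<^sup>2 * v k)"
    by (intro suminf_cong) (simp add: power2_eq_square algebra_simps)
  also have "\<dots> = (\<Sum>k. v k * (x k)\<^sup>2) - 2 * m * (\<Sum>k. v k * x k) + m\<^sup>2 * suminf v"
    by (simp only: suminf_add[symmetric] suminf_diff[symmetric] suminf_mult summable_add summable_diff summable_mult s1 s2 v(1))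
  also have "\<dots> = (\<Sum>k. v k * (x k)\<^sup>2) - (\<Sum>k. v k * x k)\<^sup>2 / suminf v"
    using V by (simp add: m_def power2_eq_square field_simps)
  finally show ?thesis using V by (simp add: field_simps)
qed

lemma thirds_sums: "(\<lambda>k. (1 / 3 :: real) ^ k) sums (3 / 2)"
  using geometric_sums[of "1 / 3 :: real"] by simp

lemmas thirds_summable = sums_summable[OF thirds_sums]
lemmas thirds_suminf = sums_unique[OF thirds_sums, symmetric]

lemma summable_weighted:
  fixes w :: "nat \<Rightarrow> real" and x :: "nat \<Rightarrow> complex"
  assumes w: "\<And>k. \<bar>w k\<bar> = (1 / 3) ^ k" and x: "\<And>k. cmod (x k) \<le> C"
  shows "summable (\<lambda>k. of_real (w k) * x k)" "summable (\<lambda>k. cmod (of_real (w k) * x k))"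
    "cmod (\<Sum>k. of_real (w k) * x k) \<le> 3 / 2 * C"
proof -
  have b: "cmod (of_real (w k) * x k) \<le> (1 / 3) ^ k * C" for k
    unfolding norm_mult norm_of_real w using x by (intro mult_left_mono) auto
  note s = summable_mult2[OF thirds_summable, of C]
  show "summable (\<lambda>k. of_real (w k) * x k)" by (rule summable_comparison_test'[OF s b])
  show "summable (\<lambda>k. cmod (of_real (w k) * x k))"
    by (rule summable_comparison_test'[OF s, of 0]) (use b in simp)
  have "cmod (\<Sum>k. of_real (w k) * x k) \<le> (\<Sum>k. (1 / 3) ^ k * C)" by (rule norm_suminf_le[OF b s])
  also have "\<dots> = 3 / 2 * C" by (simp only: suminf_mult2[OF thirds_summable, symmetric] thirds_suminf)
  finally show "cmod (\<Sum>k. of_real (w k) * x k) \<le> 3 / 2 * C" .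
qed

lemma integral_weighted_series:
  fixes w :: "nat \<Rightarrow> real" and f :: "nat \<Rightarrow> 'a \<Rightarrow> complex"
  assumes w: "\<And>k. \<bar>w k\<bar> = (1 / 3) ^ k" and f[measurable]: "\<And>k. f k \<in> borel_measurable M" "m \<in> borel_measurable M"
    and bound: "\<And>k x. cmod (f k x) \<le> G x" and G: "integrable M (\<lambda>x. of_real (G x) * m x)"
  shows "(LINT x|M. (\<Sum>k. of_real (w k) * f k x) * m x) = (\<Sum>k. of_real (w k) * (LINT x|M. f k x * m x))"
proof -
  have b: "cmod (f k x * m x) \<le> cmod (of_real (G x) * m x)" for k x
    using bound[of k x] by (auto simp: norm_mult intro!: mult_right_mono)
  have int: "integrable M (\<lambda>x. f k x * m x)" for k
    by (rule Bochner_Integration.integrable_bound[OF G]) (use b in auto)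
  have le: "cmod (of_real (w k) * (f k x * m x)) \<le> (1 / 3) ^ k * cmod (of_real (G x) * m x)" for k x
    unfolding norm_mult[of "of_real (w k)"] norm_of_real w by (rule mult_left_mono[OF b]) simp
  have "(LINT x|M. (\<Sum>k. of_real (w k) * f k x) * m x) = (LINT x|M. (\<Sum>k. of_real (w k) * (f k x * m x)))"
    by (intro Bochner_Integration.integral_cong refl)
       (simp add: suminf_mult2[OF summable_weighted(1)[OF w bound]] mult.assoc)
  also have "\<dots> = (\<Sum>k. (LINT x|M. of_real (w k) * (f k x * m x)))"
  proof (rule integral_suminf)
    show "integrable M (\<lambda>x. of_real (w k) * (f k x * m x))" for k by (intro integrable_mult_right int)
    show "AE x in M. summable (\<lambda>k. cmod (of_real (w k) * (f k x * m x)))"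
      by (intro AE_I2 summable_weighted(2)[OF w b])
    show "summable (\<lambda>k. LINT x|M. cmod (of_real (w k) * (f k x * m x)))"
    proof (rule summable_comparison_test'[OF summable_mult2[OF thirds_summable, of "LINT x|M. cmod (of_real (G x) * m x)"], of 0])
      fix k :: nat
      have "(LINT x|M. cmod (of_real (w k) * (f k x * m x))) \<le> (LINT x|M. (1 / 3) ^ k * cmod (of_real (G x) * m x))"
        by (intro integral_mono le integrable_mult_right integrable_norm int G)
      then show "norm (LINT x|M. cmod (of_real (w k) * (f k x * m x))) \<le> (1 / 3) ^ k * (LINT x|M. cmod (of_real (G x) * m x))"
        by simp
    qed
  qed
  finally show ?thesis by simp
qed

lemma L2_weighted_series:
  fixes w :: "nat \<Rightarrow> real" and F :: "nat \<Rightarrow> complex ^ 'n \<Rightarrow> complex"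
  assumes w: "\<And>k. \<bar>w k\<bar> = (1 / 3) ^ k" and F: "\<And>k. F k \<in> L2_gauss"
    and A: "\<And>k. (LINT z|gauss_measure. (cmod (F k z))\<^sup>2) \<le> A" and C: "\<And>k z. cmod (F k z) \<le> C z"
  shows "(\<lambda>z. \<Sum>k. of_real (w k) * F k z) \<in> L2_gauss"
    and "(LINT z|gauss_measure. (cmod (\<Sum>k. of_real (w k) * F k z))\<^sup>2) \<le> 9 / 4 * A"
proof -
  note [measurable] = L2_gaussD(1)[OF F]
  let ?Q = "\<lambda>k z. (1 / 3) ^ k * (cmod (F k z))\<^sup>2"
  have C2: "(cmod (F k z))\<^sup>2 \<le> (C z)\<^sup>2" for k z by (rule power_mono[OF C]) simp
  have Qle: "norm (?Q k z) \<le> (1 / 3) ^ k * (C z)\<^sup>2" for k z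
    using C2[of k z] by (simp add: mult_left_mono)
  have Qsum: "summable (\<lambda>k. norm (?Q k z))" for z
    by (rule summable_comparison_test'[OF summable_mult2[OF thirds_summable, of "(C z)\<^sup>2"], of 0]) (use Qle in simp)
  have Qint: "integrable gauss_measure (?Q k)" for k
    by (intro integrable_mult_right L2_gaussD(2) F)
  have Qile: "(LINT z|gauss_measure. ?Q k z) \<le> (1 / 3) ^ k * A" for k
    using A[of k] by (simp add: mult_left_mono)
  have Qisum: "summable (\<lambda>k. LINT z|gauss_measure. norm (?Q k z))"
    by (rule summable_comparison_test'[OF summable_mult2[OF thirds_summable, of A], of 0]) (use Qile in simp)
  note Q = integrable_suminf[OF Qint AE_I2[OF Qsum] Qisum] integral_suminf[OF Qint AE_I2[OF Qsum] Qisum]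
  have le: "(cmod (\<Sum>k. of_real (w k) * F k z))\<^sup>2 \<le> 3 / 2 * (\<Sum>k. ?Q k z)" for z
  proof -
    have "cmod (\<Sum>k. of_real (w k) * F k z) \<le> (\<Sum>k. cmod (of_real (w k) * F k z))"
      by (rule summable_norm[OF summable_weighted(2)[OF w C]])
    also have "\<dots> = (\<Sum>k. (1 / 3) ^ k * cmod (F k z))" by (simp add: norm_mult w)
    finally have "(cmod (\<Sum>k. of_real (w k) * F k z))\<^sup>2 \<le> (\<Sum>k. (1 / 3) ^ k * cmod (F k z))\<^sup>2"
      by (rule power_mono) simp
    also have "\<dots> \<le> 3 / 2 * (\<Sum>k. ?Q k z)"
      using weighted_suminf_power2_le[OF thirds_summable, of "\<lambda>k. cmod (F k z)" "C z"] C
      by (simp add: thirds_suminf)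
    finally show ?thesis .
  qed
  have meas: "(\<lambda>z. \<Sum>k. of_real (w k) * F k z) \<in> borel_measurable borel" by measurable
  have int: "integrable gauss_measure (\<lambda>z. (cmod (\<Sum>k. of_real (w k) * F k z))\<^sup>2)"
  proof (rule Bochner_Integration.integrable_bound)
    show "integrable gauss_measure (\<lambda>z. 3 / 2 * (\<Sum>k. ?Q k z))" by (intro integrable_mult_right Q(1))
    show "AE z in gauss_measure. norm ((cmod (\<Sum>k. of_real (w k) * F k z))\<^sup>2) \<le> norm (3 / 2 * (\<Sum>k. ?Q k z))"
      using le by (intro AE_I2) (simp add: order_trans[OF _ abs_ge_self])
    show "(\<lambda>z. (cmod (\<Sum>k. of_real (w k) * F k z))\<^sup>2) \<in> borel_measurable gauss_measure"
      using meas by simp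
  qed
  show "(\<lambda>z. \<Sum>k. of_real (w k) * F k z) \<in> L2_gauss" by (rule L2_gaussI[OF meas int])
  have "(LINT z|gauss_measure. (cmod (\<Sum>k. of_real (w k) * F k z))\<^sup>2) \<le> (LINT z|gauss_measure. 3 / 2 * (\<Sum>k. ?Q k z))"
    by (intro integral_mono int integrable_mult_right Q(1) le)
  also have "\<dots> = 3 / 2 * (\<Sum>k. LINT z|gauss_measure. ?Q k z)" by (simp only: integral_mult_right_zero Q(2))
  also have "\<dots> \<le> 3 / 2 * (\<Sum>k. (1 / 3) ^ k * A)"
    using Qisum by (intro mult_left_mono suminf_le Qile summable_mult2 thirds_summable) simp_all
  also have "\<dots> = 9 / 4 * A" by (simp add: suminf_mult2[OF thirds_summable, symmetric] thirds_suminf)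
  finally show "(LINT z|gauss_measure. (cmod (\<Sum>k. of_real (w k) * F k z))\<^sup>2) \<le> 9 / 4 * A" .
qed

section \<open>The counterexample\<close>

lemma heat_transform_bound:
  fixes g :: "complex ^ 'n \<Rightarrow> complex"
  assumes g: "g \<in> borel_measurable borel" and bound: "\<And>z. cmod (g z) \<le> C * exp ((norm z)\<^sup>2 / 8)"
  shows "cmod (heat_transform (1 / 4) g a)
    \<le> (LINT w|lborel. C * exp ((norm w)\<^sup>2 / 8) * exp (- (norm (w - a))\<^sup>2)) / pi ^ CARD('n)"
proof -
  have "C \<ge> 0" using order_trans[OF norm_ge_zero bound[of 0]] by simp
  have "integrable lborel (\<lambda>w. norm (of_real (C * exp ((norm w)\<^sup>2 / 8)) * of_real (exp (- (norm (w - a))\<^sup>2 / (4 * (1 / 4)))) :: complex))"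
    using \<open>C \<ge> 0\<close> by (intro integrable_norm heat_integrand_integrable[where C=C]) (simp_all add: norm_mult)
  then have dom: "integrable lborel (\<lambda>w. C * exp ((norm w)\<^sup>2 / 8) * exp (- (norm (w - a))\<^sup>2))"
    using \<open>C \<ge> 0\<close> by (simp add: norm_mult)
  have int: "integrable lborel (\<lambda>w. g w * of_real (exp (- (norm (w - a))\<^sup>2)))"
    using heat_integrand_integrable[OF g bound, of a] by simp
  have "cmod (LINT w|lborel. g w * of_real (exp (- (norm (w - a))\<^sup>2)))
      \<le> (LINT w|lborel. cmod (g w * of_real (exp (- (norm (w - a))\<^sup>2))))"
    by (rule integral_norm_bound)
  also have "\<dots> \<le> (LINT w|lborel. C * exp ((norm w)\<^sup>2 / 8) * exp (- (norm (w - a))\<^sup>2))"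
    by (intro integral_mono integrable_norm int dom) (use bound in \<open>auto simp: norm_mult intro: mult_right_mono\<close>)
  finally show ?thesis
    by (simp add: heat_transform_def norm_divide norm_power divide_right_mono)
qed

lemma L2_norm_power2: "(L2_norm f)\<^sup>2 = (LINT z|gauss_measure. (cmod (f z))\<^sup>2)"
  unfolding L2_norm_def by (rule real_sqrt_pow2) simp

theorem theorem1p2:
  "\<exists>g :: complex ^ 'n::finite \<Rightarrow> complex.
     g \<in> borel_measurable lborel \<and>
     (\<forall>a. (\<lambda>z. g z * normalized_kernel a z) \<in> L2_gauss) \<and>
     toeplitz_extends_bounded g \<and>
     \<not> bounded (range (heat_transform (1/4) g))"
proof -
  have "\<forall>k. \<exists>\<alpha>. 0 \<le> \<alpha> \<and> \<alpha> \<le> 1 / 8 \<and>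
      (\<exists>a :: complex ^ 'n. sqrt 2 ^ k / 2 \<le> cmod (heat_transform (1 / 4) (rs_symbol \<alpha> k) a))"
    using rs_symbol_heat_large by meson
  then obtain \<alpha> where \<alpha>: "\<And>k. 0 \<le> \<alpha> k" "\<And>k. \<alpha> k \<le> 1 / 8"
    and large: "\<And>k. \<exists>a :: complex ^ 'n. sqrt 2 ^ k / 2 \<le> cmod (heat_transform (1 / 4) (rs_symbol (\<alpha> k) k) a)"
    by metis
  define b where "b k = heat_transform (1 / 4) (rs_symbol (\<alpha> k) k :: complex ^ 'n \<Rightarrow> complex)" for k
  have bd: "\<exists>D. \<forall>k. cmod (b k a) \<le> D" for a
    unfolding b_def using heat_transform_bound[OF rs_symbol_measurable rs_symbol_bound[OF \<alpha>]] by blast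
  have unb: "\<exists>k a. cmod (b k a) > R" for R
  proof -
    obtain k where "2 * R < sqrt 2 ^ k" using real_arch_pow[of "sqrt 2" "2 * R"] by auto
    moreover obtain a where "sqrt 2 ^ k / 2 \<le> cmod (b k a)" using large unfolding b_def by blast
    ultimately show ?thesis by (intro exI[of _ k] exI[of _ a]) linarith
  qed
  obtain w :: "nat \<Rightarrow> real" and \<nu> :: "nat \<Rightarrow> nat"
    where w: "\<And>k. \<bar>w k\<bar> = (1 / 3) ^ k" and hump: "\<And>R. \<exists>a. cmod (\<Sum>k. of_real (w k) * b (\<nu> k) a) > R"
    using gliding_hump[of b, OF bd unb] by metis
  define f :: "nat \<Rightarrow> complex ^ 'n \<Rightarrow> complex" where "f k = rs_symbol (\<alpha> (\<nu> k)) (\<nu> k)" for k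
  define op :: "nat \<Rightarrow> (complex ^ 'n \<Rightarrow> complex) \<Rightarrow> complex ^ 'n \<Rightarrow> complex"
    where "op k = rs_op (\<alpha> (\<nu> k)) (\<nu> k)" for k
  define g where "g z = (\<Sum>k. of_real (w k) * f k z)" for z
  define S where "S h z = (\<Sum>k. of_real (w k) * op k h z)" for h z
  have f_meas [measurable]: "f k \<in> borel_measurable borel" for k
    unfolding f_def by (rule rs_symbol_measurable)
  have f_bound: "cmod (f k z) \<le> 4 * exp ((norm z)\<^sup>2 / 8)" for k z
    unfolding f_def by (rule rs_symbol_bound[OF \<alpha>])
  have g_meas: "g \<in> borel_measurable borel"
    unfolding g_def[abs_def] by measurable
  have g_bound: "cmod (g z) \<le> 6 * exp ((norm z)\<^sup>2 / 8)" for z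
    using summable_weighted(3)[of w "\<lambda>k. f k z", OF w f_bound] by (simp add: g_def)

  have kernels: "(\<lambda>z. g z * normalized_kernel a z) \<in> L2_gauss" for a
    using L2_gauss_cmult[OF L2_gauss_growth[OF g_meas g_bound, of a], of "1 / csqrt (bargmann_kernel a a)"]
    by (simp add: normalized_kernel_def)

  have heat: "heat_transform (1 / 4) g a = (\<Sum>k. of_real (w k) * b (\<nu> k) a)" for a
  proof -
    let ?m = "\<lambda>v. complex_of_real (exp (- (norm (v - a))\<^sup>2 / (4 * (1 / 4))))"
    have dom: "integrable lborel (\<lambda>v. of_real (4 * exp ((norm v)\<^sup>2 / 8)) * ?m v)"
      by (rule heat_integrand_integrable[where C=4]) simp_all
    have eq: "(LINT v|lborel. g v * ?m v) = (\<Sum>k. of_real (w k) * (LINT v|lborel. f k v * ?m v))"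
      unfolding g_def by (rule integral_weighted_series[where G="\<lambda>v. 4 * exp ((norm v)\<^sup>2 / 8)", OF w _ _ f_bound dom]) simp_all
    have b_eq: "b (\<nu> k) a = (LINT v|lborel. f k v * ?m v) / of_real ((4 * pi * (1 / 4)) ^ CARD('n))" for k
      by (simp add: b_def f_def heat_transform_def)
    \<comment> \<open>Any bound that does not depend on \<open>k\<close> serves for the summability below.\<close>
    have "cmod (of_real ((4 * pi * (1 / 4)) ^ CARD('n)) * b (\<nu> k) a) \<le> cmod (of_real ((4 * pi * (1 / 4)) ^ CARD('n))) * (SOME D. \<forall>k. cmod (b k a) \<le> D)" for k
      unfolding norm_mult using someI_ex[OF bd[of a]] by (intro mult_left_mono) auto
    from summable_weighted(1)[of w, OF w this]
    have "summable (\<lambda>k. of_real (w k) * (LINT v|lborel. f k v * ?m v))"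
      unfolding b_eq by simp
    then show ?thesis
      unfolding b_eq heat_transform_def eq times_divide_eq_right[of "of_real (w _)"] by (rule suminf_divide[symmetric])
  qed

  have op_bargmann: "op k h \<in> bargmann"
    and op_norm: "(LINT z|gauss_measure. (cmod (op k h z))\<^sup>2) \<le> 2 * (L2_norm h)\<^sup>2" if "h \<in> bargmann" for k h
    unfolding op_def L2_norm_power2 by (intro rs_op_bargmann that)+
  have op_bound: "cmod (op k h z) \<le> 2 * (L2_norm h)\<^sup>2 + exp ((norm z)\<^sup>2 / 2)" if "h \<in> bargmann" for k h z
    using bargmann_pointwise_bound[OF op_bargmann[OF that], of k z] op_norm[OF that, of k] by linarith
  have op_add: "op k (\<lambda>z. h1 z + h2 z) z = op k h1 z + op k h2 z"
    and op_cmult: "op k (\<lambda>z. c * h1 z) z = c * op k h1 z" for k h1 h2 z c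
    by (simp_all add: op_def rs_op_add rs_op_cmult)
  note S_summable = summable_weighted(1)[of w, OF w op_bound]
  have S_L2: "S h \<in> L2_gauss" and S_norm: "(L2_norm (S h))\<^sup>2 \<le> 9 / 4 * (2 * (L2_norm h)\<^sup>2)" if "h \<in> bargmann" for h
    unfolding S_def[abs_def] L2_norm_power2[of "\<lambda>z. \<Sum>k. of_real (w k) * op k h z"]
    using op_bargmann[OF that] op_norm[OF that] op_bound[OF that]
    by (intro L2_weighted_series w bargmannD(2); blast)+
  have S_bargmann: "S h \<in> bargmann" if "h \<in> bargmann" for h
  proof -
    have "entire (\<lambda>z. \<Sum>k. of_real (w k) * op k h z)"
    proof (rule entire_series[where c="\<lambda>k. (1 / 3) ^ k" and B="\<lambda>r. 2 * (L2_norm h)\<^sup>2 + exp ((max 0 r)\<^sup>2 / 2)"])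
      show "entire (\<lambda>z. of_real (w k) * op k h z)" for k
        by (rule entire_cmult[OF bargmannD(1)[OF op_bargmann[OF that]]])
      show "cmod (of_real (w k) * op k h z) \<le> (1 / 3) ^ k * (2 * (L2_norm h)\<^sup>2 + exp ((max 0 (norm z))\<^sup>2 / 2))" for k z
        unfolding norm_mult norm_of_real w using op_bound[OF that, of k z] by (intro mult_left_mono) simp_all
      \<comment> \<open>The truncation at zero makes the bound monotone for negative arguments as well.\<close>
      show "mono (\<lambda>r. 2 * (L2_norm h)\<^sup>2 + exp ((max 0 r)\<^sup>2 / 2) :: real)"
        by (intro monoI) (auto intro!: power_mono)
    qed (simp_all add: thirds_summable)
    with S_L2[OF that] show ?thesis by (simp add: bargmann_def S_def[abs_def])
  qed
  have "bounded_operator_on_bargmann S"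
    unfolding bounded_operator_on_bargmann_def
  proof (intro conjI ballI allI exI[of _ 3])
    fix h1 h2 :: "complex ^ 'n \<Rightarrow> complex" assume h: "h1 \<in> bargmann" "h2 \<in> bargmann"
    show "S (\<lambda>z. h1 z + h2 z) = (\<lambda>z. S h1 z + S h2 z)"
      unfolding S_def by (rule ext, subst suminf_add) (simp_all add: S_summable h op_add distrib_left)
  next
    fix c and h :: "complex ^ 'n \<Rightarrow> complex" assume h: "h \<in> bargmann"
    show "S (\<lambda>z. c * h z) = (\<lambda>z. c * S h z)"
      unfolding S_def by (rule ext, subst suminf_mult[symmetric]) (simp_all add: S_summable h op_cmult mult.left_commute)
  next
    fix h :: "complex ^ 'n \<Rightarrow> complex" assume h: "h \<in> bargmann"
    have "(L2_norm (S h))\<^sup>2 \<le> (3 * L2_norm h)\<^sup>2"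
    proof -
      have "(3 * L2_norm h)\<^sup>2 = 9 * (L2_norm h)\<^sup>2" by (simp add: power_mult_distrib)
      then show ?thesis using S_norm[OF h] zero_le_power2[of "L2_norm h"] by linarith
    qed
    then show "L2_norm (S h) \<le> 3 * L2_norm h"
      by (rule power2_le_imp_le) (simp add: L2_norm_def)
  qed (rule S_bargmann)
  moreover have "S h = toeplitz g h" if dom: "h \<in> toeplitz_domain g" for h
  proof -
    from dom have h: "h \<in> bargmann" and gh: "(\<lambda>z. g z * h z) \<in> L2_gauss" by (simp_all add: toeplitz_domain_def)
    have "L2_inner (\<lambda>z. g z * h z) (\<lambda>z. bargmann_kernel z a) = S h a" for a
    proof -
      \<comment> \<open>Only the product \<open>g h\<close> is known to be square-integrable, not the single terms of the series, so the interchange is made in the absolutely convergent pairing with a kernel.\<close>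
      let ?m = "\<lambda>z. h z * bargmann_kernel a z"
      have dom: "integrable gauss_measure (\<lambda>z. of_real (4 * exp ((norm z)\<^sup>2 / 8)) * ?m z)"
        using symbol_kernel_integrable[of "\<lambda>z. of_real (4 * exp ((norm z)\<^sup>2 / 8))" 4 h a] bargmannD(2)[OF h]
        by (simp add: mult.assoc)
      have "L2_inner (\<lambda>z. g z * h z) (\<lambda>z. bargmann_kernel z a) = (LINT z|gauss_measure. (\<Sum>k. of_real (w k) * f k z) * ?m z)"
        by (simp add: L2_inner_def cnj_bargmann_kernel g_def mult.assoc)
      also have "\<dots> = (\<Sum>k. of_real (w k) * (LINT z|gauss_measure. f k z * ?m z))"
        using bargmannD(3)[OF h]
        by (intro integral_weighted_series[where G="\<lambda>z. 4 * exp ((norm z)\<^sup>2 / 8)", OF w _ _ f_bound dom]) simp_all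
      also have "\<dots> = S h a"
        using rs_symbol_reproducing[OF \<alpha> h] by (simp add: S_def f_def op_def mult.assoc)
      finally show ?thesis .
    qed
    from bargmann_proj_eqI[OF gh S_bargmann[OF h] this] show ?thesis by (simp add: toeplitz_def)
  qed
  ultimately have "toeplitz_extends_bounded g"
    unfolding toeplitz_extends_bounded_def by blast
  moreover have "\<not> bounded (range (heat_transform (1 / 4) g))"
  proof
    assume "bounded (range (heat_transform (1 / 4) g))"
    then obtain R where "\<And>a. cmod (heat_transform (1 / 4) g a) \<le> R" by (auto simp: bounded_iff)
    moreover obtain a where "cmod (\<Sum>k. of_real (w k) * b (\<nu> k) a) > R" using hump by blast
    ultimately show False unfolding heat[symmetric] by (metis not_less)
  qed
  ultimately show ?thesis
    using g_meas kernels by (intro exI[of _ g]) simp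
qed

end
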